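(* Let $\mathcal{T}$ be a triangulated category with a Serre functor $\mathbb{S}$, let $n\ge2$, and let $\mathcal{D}$ be a functorially finite $n$-rigid $\mathbb{S}_n$-subcategory of $\mathcal{T}$. Let $\mathcal{Z}=\bigcap_{i=1}^{n-1}\mathcal{D}[-i]^\perp=\bigcap_{i=1}^{n-1}{}^\perp\mathcal{D}[i]\supset\mathcal{D}$, and let $\mathcal{U}=\mathcal{Z}/[\mathcal{D}]$, a triangulated category with shift $\langle1\rangle$ and Serre functor $\mathbb{S}'=\mathbb{S}_n\circ\langle n\rangle$. Then the correspondence $\mathcal{C}\mapsto\overline{\mathcal{C}}:=\mathcal{C}/[\mathcal{D}]$ gives (1) a one-one correspondence between $n$-cluster tilting subcategories of $\mathcal{T}$ containing $\mathcal{D}$ and $n$-cluster tilting subcategories of $\mathcal{U}$, and (2) a one-one correspondence between $n$-rigid $\mathbb{S}_n$-subcategories of $\mathcal{T}$ containing $\mathcal{D}$ and $n$-rigid $\mathbb{S}'_n$-subcategories of $\mathcal{U}$, where $\mathbb{S}'_n:=\mathbb{S}'\circ\langle-n\rangle$.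
   Context: Conventions: $k$ is a fixed field; all additive categories are Krull-Schmidt; triangulated categories are $k$-linear with finite-dimensional Hom-spaces and shift $[1]$. A subcategory means a full subcategory closed under isomorphisms, direct sums and direct summands (not necessarily under the shift). $(\mathcal{X},\mathcal{Y})=0$ means all morphisms from objects of $\mathcal X$ to objects of $\mathcal Y$ vanish; $\mathcal{X}^\perp=\{T\mid(\mathcal{X},T)=0\}$, ${}^\perp\mathcal{X}=\{T\mid (T,\mathcal{X})=0\}$. $[\mathcal{D}]$ is the ideal of morphisms factoring through objects of $\mathcal{D}$, and $\mathcal{Z}/[\mathcal{D}]$ is the quotient category with the same objects as $\mathcal{Z}$. A Serre functor is a $k$-linear autofunctor $\mathbb{S}$ with functorial isomorphisms $(X,Y)\simeq D(Y,\mathbb{S}X)$, $D$ the $k$-dual. $\mathbb{S}_n=\mathbb{S}\circ[-n]$; an $\mathbb{S}_n$-subcategory is a subcategory $\mathcal{C}$ with $\mathcal{C}=\mathbb{S}_n\mathcal{C}=\mathbb{S}_n^{-1}\mathcal{C}$ (and similarly for $\mathbb{S}'_n$ in $\mathcal{U}$). In a triangulated category with shift $[1]$, $\mathcal{C}$ is $n$-rigid if $(\mathcal{C},\mathcal{C}[i])=0$ for $0<i<n$; a functorially finite subcategory $\mathcal{C}$ is $n$-cluster tilting if $\mathcal{C}=\bigcap_{i=1}^{n-1}\mathcal{C}[-i]^\perp=\bigcap_{i=1}^{n-1}{}^\perp\mathcal{C}[i]$. (Functorially finite: every object has a right approximation $X\to T$, i.e. $X\in\mathcal{C}$ and $(-,X)\to(-,T)$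 surjective on $\mathcal{C}$, and dually a left approximation.) Triangulated structure on $\mathcal{U}$: for each $X\in\mathcal{Z}$ fix a triangle $X\xrightarrow{\alpha_X}D_X\xrightarrow{\beta_X}X\langle1\rangle\xrightarrow{\gamma_X}X[1]$ in $\mathcal{T}$ with $\alpha_X$ a left $\mathcal{D}$-approximation (then $X\langle1\rangle\in\mathcal{Z}$). For $f:X\to X'$, choose a morphism of triangles $(f,g,h,f[1])$ and put $\overline{f}\langle1\rangle=\overline{h}$; this gives an auto-equivalence $\langle1\rangle$ of $\mathcal{U}$. For a triangle $X\xrightarrow{a}Y\xrightarrow{b}Z\xrightarrow{c}X[1]$ in $\mathcal{T}$ with $X,Y,Z\in\mathcal{Z}$, choose a morphism of triangles to the fixed triangle of $X$ that is the identity on $X$ and $X[1]$, with third component $d:Z\to X\langle1\rangle$; the triangles in $\mathcal{U}$ are the complexes isomorphic to $X\xrightarrow{\overline a}Y\xrightarrow{\overline b}Z\xrightarrow{\overline d}X\langle1\rangle$. *)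

theory Defs
  imports "Jordan_Normal_Form.Missing_VectorSpace"
begin

text \<open>
  Categories are given by a set of objects and disjoint Hom-sets; each Hom-set is a vector space
  record over the base field, so that its addition, zero and scalar multiplication are those of
  the library. Everything concerning objects is relativised to \<open>Obj\<close>. A full
  subcategory is represented by its set of objects.
\<close>

section \<open>Linear categories\<close>

record ('k, 'o, 'm) lin_cat =
  Obj :: "'o set"
  Hom :: "'o \<Rightarrow> 'o \<Rightarrow> ('k, 'm) module"
  ident :: "'o \<Rightarrow> 'm"
  cmp :: "'m \<Rightarrow> 'm \<Rightarrow> 'm"  (infixr "\<cdot>\<index>" 75)

abbreviation mor :: "('k, 'o, 'm, 'z) lin_cat_scheme \<Rightarrow> 'o \<Rightarrow> 'o \<Rightarrow> 'm set"
  where "mor C X Y \<equiv> carrier (Hom C X Y)"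

locale linear_category =
  fixes K :: "'k ring" and C :: "('k, 'o, 'm, 'z) lin_cat_scheme"
  assumes K_field: "field K"
    and Hom_vectorspace: "\<lbrakk>X \<in> Obj C; Y \<in> Obj C\<rbrakk> \<Longrightarrow> vectorspace K (Hom C X Y)"
    and Hom_disjoint:
      "\<lbrakk>X \<in> Obj C; Y \<in> Obj C; X' \<in> Obj C; Y' \<in> Obj C; f \<in> mor C X Y; f \<in> mor C X' Y'\<rbrakk>
        \<Longrightarrow> X = X' \<and> Y = Y'"
    and ident_mor: "X \<in> Obj C \<Longrightarrow> ident C X \<in> mor C X X"
    and cmp_mor:
      "\<lbrakk>X \<in> Obj C; Y \<in> Obj C; Z \<in> Obj C; f \<in> mor C X Y; g \<in> mor C Y Z\<rbrakk>
        \<Longrightarrow> g \<cdot>\<^bsub>C\<^esub> f \<in> mor C X Z"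
    and cmp_ident:
      "\<lbrakk>X \<in> Obj C; Y \<in> Obj C; f \<in> mor C X Y\<rbrakk>
        \<Longrightarrow> f \<cdot>\<^bsub>C\<^esub> ident C X = f \<and> ident C Y \<cdot>\<^bsub>C\<^esub> f = f"
    and cmp_assoc:
      "\<lbrakk>W \<in> Obj C; X \<in> Obj C; Y \<in> Obj C; Z \<in> Obj C;
        f \<in> mor C W X; g \<in> mor C X Y; h \<in> mor C Y Z\<rbrakk>
        \<Longrightarrow> (h \<cdot>\<^bsub>C\<^esub> g) \<cdot>\<^bsub>C\<^esub> f = h \<cdot>\<^bsub>C\<^esub> (g \<cdot>\<^bsub>C\<^esub> f)"
    and cmp_linear_left:
      "\<lbrakk>X \<in> Obj C; Y \<in> Obj C; Z \<in> Obj C; f \<in> mor C X Y\<rbrakk>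
        \<Longrightarrow> (\<lambda>g. g \<cdot>\<^bsub>C\<^esub> f) \<in> module_hom K (Hom C Y Z) (Hom C X Z)"
    and cmp_linear_right:
      "\<lbrakk>X \<in> Obj C; Y \<in> Obj C; Z \<in> Obj C; g \<in> mor C Y Z\<rbrakk>
        \<Longrightarrow> (\<lambda>f. g \<cdot>\<^bsub>C\<^esub> f) \<in> module_hom K (Hom C X Y) (Hom C X Z)"

definition hom_finite :: "'k ring \<Rightarrow> ('k, 'o, 'm, 'z) lin_cat_scheme \<Rightarrow> bool"
  where "hom_finite K C \<longleftrightarrow>
    (\<forall>X\<in>Obj C. \<forall>Y\<in>Obj C. vectorspace.fin_dim K (Hom C X Y))"

definition iso_mor :: "('k, 'o, 'm, 'z) lin_cat_scheme \<Rightarrow> 'o \<Rightarrow> 'o \<Rightarrow> 'm \<Rightarrow> bool"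
  where "iso_mor C X Y f \<longleftrightarrow> f \<in> mor C X Y \<and>
    (\<exists>g\<in>mor C Y X. g \<cdot>\<^bsub>C\<^esub> f = ident C X \<and> f \<cdot>\<^bsub>C\<^esub> g = ident C Y)"

definition isomorphic :: "('k, 'o, 'm, 'z) lin_cat_scheme \<Rightarrow> 'o \<Rightarrow> 'o \<Rightarrow> bool"
  where "isomorphic C X Y \<longleftrightarrow> (\<exists>f. iso_mor C X Y f)"

definition zero_object :: "('k, 'o, 'm, 'z) lin_cat_scheme \<Rightarrow> 'o \<Rightarrow> bool"
  where "zero_object C N \<longleftrightarrow> N \<in> Obj C \<and>
    (\<forall>X\<in>Obj C. mor C N X = {\<zero>\<^bsub>Hom C N X\<^esub>} \<and> mor C X N = {\<zero>\<^bsub>Hom C X N\<^esub>})"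

text \<open>The case of the empty list gives the zero objects, singleton lists give isomorphism.\<close>

definition direct_sum :: "('k, 'o, 'm, 'z) lin_cat_scheme \<Rightarrow> 'o list \<Rightarrow> 'o \<Rightarrow> bool"
  where "direct_sum C Xs S \<longleftrightarrow> set Xs \<subseteq> Obj C \<and> S \<in> Obj C \<and>
    (\<exists>\<iota> \<pi>.
      (\<forall>j<length Xs. \<iota> j \<in> mor C (Xs ! j) S \<and> \<pi> j \<in> mor C S (Xs ! j)) \<and>
      (\<forall>j<length Xs. \<forall>l<length Xs. \<pi> j \<cdot>\<^bsub>C\<^esub> \<iota> l =
        (if j = l then ident C (Xs ! j) else \<zero>\<^bsub>Hom C (Xs ! l) (Xs ! j)\<^esub>)) \<and>
      (\<Oplus>\<^bsub>Hom C S S\<^esub>j\<in>{..<length Xs}. \<iota> j \<cdot>\<^bsub>C\<^esub> \<pi> j) = ident C S)"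

definition additive :: "('k, 'o, 'm, 'z) lin_cat_scheme \<Rightarrow> bool"
  where "additive C \<longleftrightarrow> (\<forall>Xs. set Xs \<subseteq> Obj C \<longrightarrow> (\<exists>S. direct_sum C Xs S))"

text \<open>The endomorphism ring is local: it is nonzero and its non-units are closed under addition.\<close>

definition local_endomorphisms :: "('k, 'o, 'm, 'z) lin_cat_scheme \<Rightarrow> 'o \<Rightarrow> bool"
  where "local_endomorphisms C X \<longleftrightarrow> ident C X \<noteq> \<zero>\<^bsub>Hom C X X\<^esub> \<and>
    (\<forall>f\<in>mor C X X. \<forall>g\<in>mor C X X.
      iso_mor C X X (f \<oplus>\<^bsub>Hom C X X\<^esub> g) \<longrightarrow> iso_mor C X X f \<or> iso_mor C X X g)"

definition krull_schmidt :: "('k, 'o, 'm, 'z) lin_cat_scheme \<Rightarrow> bool"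
  where "krull_schmidt C \<longleftrightarrow>
    (\<forall>X\<in>Obj C. \<exists>Xs. direct_sum C Xs X \<and> (\<forall>Y\<in>set Xs. local_endomorphisms C Y))"


section \<open>Endofunctors\<close>

record ('o, 'm) endo =
  Fob :: "'o \<Rightarrow> 'o"
  Fmor :: "'m \<Rightarrow> 'm"

definition endofunctor :: "('k, 'o, 'm, 'z) lin_cat_scheme \<Rightarrow> ('o, 'm) endo \<Rightarrow> bool"
  where "endofunctor C F \<longleftrightarrow>
    (\<forall>X\<in>Obj C. Fob F X \<in> Obj C \<and> Fmor F (ident C X) = ident C (Fob F X)) \<and>
    (\<forall>X\<in>Obj C. \<forall>Y\<in>Obj C. \<forall>f\<in>mor C X Y. Fmor F f \<in> mor C (Fob F X) (Fob F Y)) \<and>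
    (\<forall>X\<in>Obj C. \<forall>Y\<in>Obj C. \<forall>Z\<in>Obj C. \<forall>f\<in>mor C X Y. \<forall>g\<in>mor C Y Z.
      Fmor F (g \<cdot>\<^bsub>C\<^esub> f) = Fmor F g \<cdot>\<^bsub>C\<^esub> Fmor F f)"

definition linear_endofunctor ::
    "'k ring \<Rightarrow> ('k, 'o, 'm, 'z) lin_cat_scheme \<Rightarrow> ('o, 'm) endo \<Rightarrow> bool"
  where "linear_endofunctor K C F \<longleftrightarrow> endofunctor C F \<and>
    (\<forall>X\<in>Obj C. \<forall>Y\<in>Obj C. Fmor F \<in> module_hom K (Hom C X Y) (Hom C (Fob F X) (Fob F Y)))"

definition id_functor :: "('o, 'm) endo"
  where "id_functor = \<lparr>Fob = (\<lambda>X. X), Fmor = (\<lambda>f. f)\<rparr>"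

definition comp_functor :: "('o, 'm) endo \<Rightarrow> ('o, 'm) endo \<Rightarrow> ('o, 'm) endo"
  where "comp_functor F G = \<lparr>Fob = Fob F \<circ> Fob G, Fmor = Fmor F \<circ> Fmor G\<rparr>"

definition naturally_isomorphic ::
    "('k, 'o, 'm, 'z) lin_cat_scheme \<Rightarrow> ('o, 'm) endo \<Rightarrow> ('o, 'm) endo \<Rightarrow> bool"
  where "naturally_isomorphic C F G \<longleftrightarrow>
    (\<exists>\<tau>. (\<forall>X\<in>Obj C. iso_mor C (Fob F X) (Fob G X) (\<tau> X)) \<and>
      (\<forall>X\<in>Obj C. \<forall>Y\<in>Obj C. \<forall>f\<in>mor C X Y.
        \<tau> Y \<cdot>\<^bsub>C\<^esub> Fmor F f = Fmor G f \<cdot>\<^bsub>C\<^esub> \<tau> X))"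

definition quasi_inverse ::
    "('k, 'o, 'm, 'z) lin_cat_scheme \<Rightarrow> ('o, 'm) endo \<Rightarrow> ('o, 'm) endo \<Rightarrow> bool"
  where "quasi_inverse C F G \<longleftrightarrow> endofunctor C G \<and>
    naturally_isomorphic C (comp_functor G F) id_functor \<and>
    naturally_isomorphic C (comp_functor F G) id_functor"

definition autoequivalence :: "('k, 'o, 'm, 'z) lin_cat_scheme \<Rightarrow> ('o, 'm) endo \<Rightarrow> bool"
  where "autoequivalence C F \<longleftrightarrow> endofunctor C F \<and> (\<exists>G. quasi_inverse C F G)"

text \<open>
  A quasi-inverse is unique only up to natural isomorphism. Negative powers below are used only
  through images closed under isomorphism, which do not depend on the choice.
\<close>

definition inverse_functor ::
    "('k, 'o, 'm, 'z) lin_cat_scheme \<Rightarrow> ('o, 'm) endo \<Rightarrow> ('o, 'm) endo"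
  where "inverse_functor C F = (SOME G. quasi_inverse C F G)"

definition functor_power ::
    "('k, 'o, 'm, 'z) lin_cat_scheme \<Rightarrow> ('o, 'm) endo \<Rightarrow> int \<Rightarrow> ('o, 'm) endo"
  where "functor_power C F i =
    (if 0 \<le> i then (comp_functor F ^^ nat i) id_functor
     else (comp_functor (inverse_functor C F) ^^ nat (- i)) id_functor)"

definition ess_image ::
    "('k, 'o, 'm, 'z) lin_cat_scheme \<Rightarrow> ('o, 'm) endo \<Rightarrow> 'o set \<Rightarrow> 'o set"
  where "ess_image C F A = {X \<in> Obj C. \<exists>Y\<in>A. isomorphic C X (Fob F Y)}"


section \<open>Subcategories\<close>

definition subcategory :: "('k, 'o, 'm, 'z) lin_cat_scheme \<Rightarrow> 'o set \<Rightarrow> bool"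
  where "subcategory C A \<longleftrightarrow> A \<subseteq> Obj C \<and>
    (\<forall>X\<in>A. \<forall>Y\<in>Obj C. isomorphic C X Y \<longrightarrow> Y \<in> A) \<and>
    (\<forall>Xs S. direct_sum C Xs S \<longrightarrow> (set Xs \<subseteq> A \<longleftrightarrow> S \<in> A))"

text \<open>\<open>stable_subcategory C F A\<close>: \<open>A = F A = F\<^sup>-\<^sup>1 A\<close>, images being closed under isomorphism.\<close>

definition stable_subcategory ::
    "('k, 'o, 'm, 'z) lin_cat_scheme \<Rightarrow> ('o, 'm) endo \<Rightarrow> 'o set \<Rightarrow> bool"
  where "stable_subcategory C F A \<longleftrightarrow> subcategory C A \<and>
    A = ess_image C F A \<and> A = ess_image C (inverse_functor C F) A"

definition right_approximation ::
    "('k, 'o, 'm, 'z) lin_cat_scheme \<Rightarrow> 'o set \<Rightarrow> 'o \<Rightarrow> 'o \<Rightarrow> 'm \<Rightarrow> bool"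
  where "right_approximation C A X W f \<longleftrightarrow> X \<in> A \<and> f \<in> mor C X W \<and>
    (\<forall>Y\<in>A. \<forall>g\<in>mor C Y W. \<exists>h\<in>mor C Y X. g = f \<cdot>\<^bsub>C\<^esub> h)"

definition left_approximation ::
    "('k, 'o, 'm, 'z) lin_cat_scheme \<Rightarrow> 'o set \<Rightarrow> 'o \<Rightarrow> 'o \<Rightarrow> 'm \<Rightarrow> bool"
  where "left_approximation C A W X f \<longleftrightarrow> X \<in> A \<and> f \<in> mor C W X \<and>
    (\<forall>Y\<in>A. \<forall>g\<in>mor C W Y. \<exists>h\<in>mor C X Y. g = h \<cdot>\<^bsub>C\<^esub> f)"

definition functorially_finite :: "('k, 'o, 'm, 'z) lin_cat_scheme \<Rightarrow> 'o set \<Rightarrow> bool"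
  where "functorially_finite C A \<longleftrightarrow>
    (\<forall>W\<in>Obj C. (\<exists>X f. right_approximation C A X W f) \<and> (\<exists>X f. left_approximation C A W X f))"

definition hom_vanishes ::
    "('k, 'o, 'm, 'z) lin_cat_scheme \<Rightarrow> 'o set \<Rightarrow> 'o set \<Rightarrow> bool"
  where "hom_vanishes C A B \<longleftrightarrow> (\<forall>X\<in>A. \<forall>Y\<in>B. mor C X Y = {\<zero>\<^bsub>Hom C X Y\<^esub>})"

definition right_perp :: "('k, 'o, 'm, 'z) lin_cat_scheme \<Rightarrow> 'o set \<Rightarrow> 'o set"
  where "right_perp C A = {W \<in> Obj C. hom_vanishes C A {W}}"

definition left_perp :: "('k, 'o, 'm, 'z) lin_cat_scheme \<Rightarrow> 'o set \<Rightarrow> 'o set"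
  where "left_perp C A = {W \<in> Obj C. hom_vanishes C {W} A}"


section \<open>Triangulated categories\<close>

record ('k, 'o, 'm) shift_cat = "('k, 'o, 'm) lin_cat" +
  Shift :: "('o, 'm) endo"

type_synonym ('o, 'm) sextuple = "'o \<times> 'o \<times> 'o \<times> 'm \<times> 'm \<times> 'm"

record ('k, 'o, 'm) tri_cat = "('k, 'o, 'm) shift_cat" +
  Tri :: "('o, 'm) sextuple set"

definition shift ::
    "('k, 'o, 'm, 'z) shift_cat_scheme \<Rightarrow> int \<Rightarrow> ('o, 'm) endo"
  where "shift C i = functor_power C (Shift C) i"

definition shifted ::
    "('k, 'o, 'm, 'z) shift_cat_scheme \<Rightarrow> 'o set \<Rightarrow> int \<Rightarrow> 'o set"
  where "shifted C A i = ess_image C (shift C i) A"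

text \<open>
  The tuple \<open>(X, Y, Z, a, b, c)\<close> stands for the diagram
  \<open>X \<rightarrow> Y \<rightarrow> Z \<rightarrow> X[1]\<close> with maps \<open>a\<close>, \<open>b\<close>, \<open>c\<close>.
\<close>

fun sextuple_in :: "('k, 'o, 'm, 'z) shift_cat_scheme \<Rightarrow> ('o, 'm) sextuple \<Rightarrow> bool"
  where "sextuple_in C (X, Y, Z, a, b, c) \<longleftrightarrow> X \<in> Obj C \<and> Y \<in> Obj C \<and> Z \<in> Obj C \<and>
    a \<in> mor C X Y \<and> b \<in> mor C Y Z \<and> c \<in> mor C Z (Fob (Shift C) X)"

fun sextuple_mor ::
    "('k, 'o, 'm, 'z) shift_cat_scheme \<Rightarrow> ('o, 'm) sextuple \<Rightarrow> ('o, 'm) sextuple \<Rightarrow>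
      'm \<Rightarrow> 'm \<Rightarrow> 'm \<Rightarrow> bool"
  where "sextuple_mor C (X, Y, Z, a, b, c) (X', Y', Z', a', b', c') u v w \<longleftrightarrow>
    u \<in> mor C X X' \<and> v \<in> mor C Y Y' \<and> w \<in> mor C Z Z' \<and>
    v \<cdot>\<^bsub>C\<^esub> a = a' \<cdot>\<^bsub>C\<^esub> u \<and>
    w \<cdot>\<^bsub>C\<^esub> b = b' \<cdot>\<^bsub>C\<^esub> v \<and>
    Fmor (Shift C) u \<cdot>\<^bsub>C\<^esub> c = c' \<cdot>\<^bsub>C\<^esub> w"

fun sextuple_iso ::
    "('k, 'o, 'm, 'z) shift_cat_scheme \<Rightarrow> ('o, 'm) sextuple \<Rightarrow> ('o, 'm) sextuple \<Rightarrow> bool"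
  where "sextuple_iso C (X, Y, Z, a, b, c) (X', Y', Z', a', b', c') \<longleftrightarrow>
    (\<exists>u v w. iso_mor C X X' u \<and> iso_mor C Y Y' v \<and> iso_mor C Z Z' w \<and>
      sextuple_mor C (X, Y, Z, a, b, c) (X', Y', Z', a', b', c') u v w)"

locale triangulated_category = linear_category K C
  for K :: "'k ring" and C :: "('k, 'o, 'm, 'z) tri_cat_scheme" +
  assumes additive: "additive C"
    and Shift_linear: "linear_endofunctor K C (Shift C)"
    and Shift_autoequivalence: "autoequivalence C (Shift C)"
    and Tri_sextuple: "t \<in> Tri C \<Longrightarrow> sextuple_in C t"
    and Tri_iso: "\<lbrakk>t \<in> Tri C; sextuple_in C t'; sextuple_iso C t t'\<rbrakk> \<Longrightarrow> t' \<in> Tri C"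
    and Tri_ident:
      "\<lbrakk>X \<in> Obj C; zero_object C N\<rbrakk>
        \<Longrightarrow> (X, X, N, ident C X, \<zero>\<^bsub>Hom C X N\<^esub>, \<zero>\<^bsub>Hom C N (Fob (Shift C) X)\<^esub>) \<in> Tri C"
    and Tri_cone:
      "\<lbrakk>X \<in> Obj C; Y \<in> Obj C; a \<in> mor C X Y\<rbrakk> \<Longrightarrow> \<exists>Z b c. (X, Y, Z, a, b, c) \<in> Tri C"
    and Tri_rotate:
      "sextuple_in C (X, Y, Z, a, b, c) \<Longrightarrow> (X, Y, Z, a, b, c) \<in> Tri C \<longleftrightarrow>
        (Y, Z, Fob (Shift C) X, b, c,
          \<ominus>\<^bsub>Hom C (Fob (Shift C) X) (Fob (Shift C) Y)\<^esub> Fmor (Shift C) a) \<in> Tri C"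
    and Tri_complete:
      "\<lbrakk>(X, Y, Z, a, b, c) \<in> Tri C; (X', Y', Z', a', b', c') \<in> Tri C;
        u \<in> mor C X X'; v \<in> mor C Y Y'; v \<cdot>\<^bsub>C\<^esub> a = a' \<cdot>\<^bsub>C\<^esub> u\<rbrakk>
        \<Longrightarrow> \<exists>w. sextuple_mor C (X, Y, Z, a, b, c) (X', Y', Z', a', b', c') u v w"
    and Tri_octahedron:
      "\<lbrakk>(X, Y, Z', f, i, i') \<in> Tri C; (Y, Z, X', g, j, j') \<in> Tri C;
        (X, Z, Y', g \<cdot>\<^bsub>C\<^esub> f, k, k') \<in> Tri C\<rbrakk>
        \<Longrightarrow> \<exists>u v. (Z', Y', X', u, v, Fmor (Shift C) i \<cdot>\<^bsub>C\<^esub> j') \<in> Tri C \<and>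
          u \<cdot>\<^bsub>C\<^esub> i = k \<cdot>\<^bsub>C\<^esub> g \<and> k' \<cdot>\<^bsub>C\<^esub> u = i' \<and>
          v \<cdot>\<^bsub>C\<^esub> k = j \<and> j' \<cdot>\<^bsub>C\<^esub> v = Fmor (Shift C) f \<cdot>\<^bsub>C\<^esub> k'"

definition n_rigid :: "('k, 'o, 'm, 'z) shift_cat_scheme \<Rightarrow> nat \<Rightarrow> 'o set \<Rightarrow> bool"
  where "n_rigid C n A \<longleftrightarrow> subcategory C A \<and>
    (\<forall>i::nat. 0 < i \<and> i < n \<longrightarrow> hom_vanishes C A (shifted C A (int i)))"

definition n_right_perp :: "('k, 'o, 'm, 'z) shift_cat_scheme \<Rightarrow> nat \<Rightarrow> 'o set \<Rightarrow> 'o set"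
  where "n_right_perp C n A = Obj C \<inter> (\<Inter>i\<in>{1..<n}. right_perp C (shifted C A (- int i)))"

definition n_left_perp :: "('k, 'o, 'm, 'z) shift_cat_scheme \<Rightarrow> nat \<Rightarrow> 'o set \<Rightarrow> 'o set"
  where "n_left_perp C n A = Obj C \<inter> (\<Inter>i\<in>{1..<n}. left_perp C (shifted C A (int i)))"

definition n_cluster_tilting :: "('k, 'o, 'm, 'z) shift_cat_scheme \<Rightarrow> nat \<Rightarrow> 'o set \<Rightarrow> bool"
  where "n_cluster_tilting C n A \<longleftrightarrow> subcategory C A \<and> functorially_finite C A \<and>
    A = n_right_perp C n A \<and> A = n_left_perp C n A"


section \<open>Serre functors\<close>

definition regular_module :: "'k ring \<Rightarrow> ('k, 'k) module"
  where "regular_module K = \<lparr>carrier = carrier K, monoid.mult = monoid.mult K, one = monoid.one K,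
    zero = ring.zero K, add = ring.add K, smult = monoid.mult K\<rparr>"

definition dual_space :: "'k ring \<Rightarrow> ('k, 'm) module \<Rightarrow> ('k, 'm \<Rightarrow> 'k) module"
  where "dual_space K V =
    (ring.func_space K (carrier V))
      \<lparr>carrier := module_hom K V (regular_module K) \<inter> extensional (carrier V)\<rparr>"

text \<open>
  The last condition is functoriality of \<open>\<eta>\<close> in both variables, the
  dual space carrying the transposed action.
\<close>

definition serre_functor ::
    "'k ring \<Rightarrow> ('k, 'o, 'm, 'z) lin_cat_scheme \<Rightarrow> ('o, 'm) endo \<Rightarrow> bool"
  where "serre_functor K C S \<longleftrightarrow> linear_endofunctor K C S \<and> autoequivalence C S \<and>
    (\<exists>\<eta>.
      (\<forall>X\<in>Obj C. \<forall>Y\<in>Obj C.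
        \<eta> X Y \<in> module_hom K (Hom C X Y) (dual_space K (Hom C Y (Fob S X))) \<and>
        bij_betw (\<eta> X Y) (mor C X Y) (carrier (dual_space K (Hom C Y (Fob S X))))) \<and>
      (\<forall>X\<in>Obj C. \<forall>X'\<in>Obj C. \<forall>Y\<in>Obj C. \<forall>Y'\<in>Obj C.
        \<forall>a\<in>mor C X' X. \<forall>f\<in>mor C X Y. \<forall>b\<in>mor C Y Y'. \<forall>g\<in>mor C Y' (Fob S X').
          \<eta> X' Y' (b \<cdot>\<^bsub>C\<^esub> f \<cdot>\<^bsub>C\<^esub> a) g = \<eta> X Y f (Fmor S a \<cdot>\<^bsub>C\<^esub> g \<cdot>\<^bsub>C\<^esub> b)))"

definition serre_n ::
    "('k, 'o, 'm, 'z) shift_cat_scheme \<Rightarrow> ('o, 'm) endo \<Rightarrow> nat \<Rightarrow> ('o, 'm) endo"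
  where "serre_n C S n = comp_functor S (shift C (- int n))"


section \<open>Ideal quotients and the reduction\<close>

text \<open>\<open>ideal_class C D f\<close> is the class of \<open>f\<close> modulo the ideal of morphisms factoring through \<open>D\<close>.\<close>

definition factors_through ::
    "('k, 'o, 'm, 'z) lin_cat_scheme \<Rightarrow> 'o set \<Rightarrow> 'o \<Rightarrow> 'o \<Rightarrow> 'm set"
  where "factors_through C D X Y = {v \<cdot>\<^bsub>C\<^esub> u | u v. \<exists>W\<in>D. u \<in> mor C X W \<and> v \<in> mor C W Y}"

definition ideal_class :: "('k, 'o, 'm, 'z) lin_cat_scheme \<Rightarrow> 'o set \<Rightarrow> 'm \<Rightarrow> 'm set"
  where "ideal_class C D f = {f'. \<exists>X\<in>Obj C. \<exists>Y\<in>Obj C. f \<in> mor C X Y \<and> f' \<in> mor C X Y \<and>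
    f' \<ominus>\<^bsub>Hom C X Y\<^esub> f \<in> factors_through C D X Y}"

text \<open>
  The quotient \<open>A/[D]\<close>. Operations on classes are unions over representatives of
  the resulting classes. The fields \<open>mult\<close> and \<open>one\<close> of a module record play no role.
\<close>

definition quotient_category ::
    "('k, 'o, 'm, 'z) lin_cat_scheme \<Rightarrow> 'o set \<Rightarrow> 'o set \<Rightarrow> ('k, 'o, 'm set) lin_cat"
  where "quotient_category C A D =
    \<lparr>Obj = A,
     Hom = (\<lambda>X Y.
       \<lparr>carrier = ideal_class C D ` mor C X Y,
        monoid.mult = undefined,
        one = undefined,
        zero = ideal_class C D \<zero>\<^bsub>Hom C X Y\<^esub>,
        add = (\<lambda>\<Phi> \<Psi>. \<Union>f\<in>\<Phi>. \<Union>g\<in>\<Psi>. ideal_class C D (f \<oplus>\<^bsub>Hom C X Y\<^esub> g)),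
        smult = (\<lambda>c \<Phi>. \<Union>f\<in>\<Phi>. ideal_class C D (c \<odot>\<^bsub>Hom C X Y\<^esub> f))\<rparr>),
     ident = (\<lambda>X. ideal_class C D (ident C X)),
     cmp = (\<lambda>\<Psi> \<Phi>. \<Union>g\<in>\<Psi>. \<Union>f\<in>\<Phi>. ideal_class C D (g \<cdot>\<^bsub>C\<^esub> f))\<rparr>"

definition quotient_functor ::
    "('k, 'o, 'm, 'z) lin_cat_scheme \<Rightarrow> 'o set \<Rightarrow> ('o, 'm) endo \<Rightarrow> ('o, 'm set) endo"
  where "quotient_functor C D F =
    \<lparr>Fob = Fob F, Fmor = (\<lambda>\<Phi>. \<Union>f\<in>\<Phi>. ideal_class C D (Fmor F f))\<rparr>"

text \<open>
  A choice of triangles \<open>A X = (X, D\<^sub>X, X\<langle>1\<rangle>, \<alpha>\<^sub>X, \<beta>\<^sub>X, \<gamma>\<^sub>X)\<close> for \<open>X\<close> in \<open>Z\<close>.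
\<close>

definition approximation_triangles ::
    "('k, 'o, 'm, 'z) tri_cat_scheme \<Rightarrow> 'o set \<Rightarrow> 'o set \<Rightarrow> ('o \<Rightarrow> ('o, 'm) sextuple) \<Rightarrow> bool"
  where "approximation_triangles T D Z A \<longleftrightarrow>
    (\<forall>X\<in>Z. A X \<in> Tri T \<and>
      (\<exists>DX X1 \<alpha> \<beta> \<gamma>. A X = (X, DX, X1, \<alpha>, \<beta>, \<gamma>) \<and> left_approximation T D X DX \<alpha>))"

definition reduction_shift ::
    "('k, 'o, 'm, 'z) tri_cat_scheme \<Rightarrow> 'o set \<Rightarrow> 'o set \<Rightarrow> ('o \<Rightarrow> ('o, 'm) sextuple) \<Rightarrow>
      ('o, 'm set) endo"
  where "reduction_shift T D Z A =
    \<lparr>Fob = (\<lambda>X. case A X of (_, _, X1, _, _, _) \<Rightarrow> X1),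
     Fmor = (\<lambda>\<Phi>. \<Union>{ideal_class T D h | h. \<exists>X\<in>Z. \<exists>X'\<in>Z. \<exists>f\<in>\<Phi>. \<exists>g.
       sextuple_mor T (A X) (A X') f g h})\<rparr>"

definition reduction_shift_cat ::
    "('k, 'o, 'm, 'z) tri_cat_scheme \<Rightarrow> 'o set \<Rightarrow> 'o set \<Rightarrow> ('o \<Rightarrow> ('o, 'm) sextuple) \<Rightarrow>
      ('k, 'o, 'm set) shift_cat"
  where "reduction_shift_cat T D Z A =
    lin_cat.extend (quotient_category T Z D) (shift_cat.fields (reduction_shift T D Z A))"

definition standard_triangles ::
    "('k, 'o, 'm, 'z) tri_cat_scheme \<Rightarrow> 'o set \<Rightarrow> 'o set \<Rightarrow> ('o \<Rightarrow> ('o, 'm) sextuple) \<Rightarrow>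
      ('o, 'm set) sextuple set"
  where "standard_triangles T D Z A =
    {(X, Y, W, ideal_class T D a, ideal_class T D b, ideal_class T D d) | X Y W a b d.
      X \<in> Z \<and> Y \<in> Z \<and> W \<in> Z \<and>
      (\<exists>c e. (X, Y, W, a, b, c) \<in> Tri T \<and>
        sextuple_mor T (X, Y, W, a, b, c) (A X) (ident T X) e d)}"

text \<open>
  The category \<open>U = Z/[D]\<close> with its shift and its triangles. The value of the shift on a class,
  and the map \<open>d\<close> of a standard triangle modulo the ideal, do not depend on the completions chosen.
\<close>

definition reduction ::
    "('k, 'o, 'm, 'z) tri_cat_scheme \<Rightarrow> 'o set \<Rightarrow> 'o set \<Rightarrow> ('o \<Rightarrow> ('o, 'm) sextuple) \<Rightarrow>
      ('k, 'o, 'm set) tri_cat"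
  where "reduction T D Z A =
    shift_cat.extend (reduction_shift_cat T D Z A)
      (tri_cat.fields
        {t. sextuple_in (reduction_shift_cat T D Z A) t \<and>
          (\<exists>s\<in>standard_triangles T D Z A. sextuple_iso (reduction_shift_cat T D Z A) s t)})"

definition reduction_serre ::
    "('k, 'o, 'm, 'z) tri_cat_scheme \<Rightarrow> ('o, 'm) endo \<Rightarrow> nat \<Rightarrow> 'o set \<Rightarrow> 'o set \<Rightarrow>
      ('o \<Rightarrow> ('o, 'm) sextuple) \<Rightarrow> ('o, 'm set) endo"
  where "reduction_serre T S n D Z A =
    comp_functor (quotient_functor T D (serre_n T S n)) (shift (reduction T D Z A) (int n))"

end

(*
  For X in Z let X<1> be the cone of a left D-approximation of X. Since (D, Z[i]) = 0 = (Z, D[i])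
  for 0 < i < n, the long exact sequences of that triangle identify (X, Y[i]) with the morphisms
  X -> Y<i> modulo those factoring through D, for all X, Y in Z and 0 < i < n. Hence rigidity and
  the two orthogonality conditions of a cluster tilting subcategory say the same about a subcategory
  C between D and Z in both categories. A subcategory of Z/[D] contains the zero objects, that is D;
  and an isomorphism modulo [D] makes one object a retract of the other plus an object of D, so
  closure under isomorphisms, sums and summands also agrees. Functorial finiteness passes from
  Z/[D] to T because Z itself is functorially finite: a Z-approximation of an arbitrary object is
  built by killing the morphisms from D[-j] (or to D[j]) for j = n-1, ..., 1 in turn. Consequently
  the two correspondences are identities on sets of objects.
*)
theory Submission
  imports Defs
begin

section \<open>Preadditive categories\<close>

text \<open>Every notion compared between \<open>T\<close> and \<open>U\<close> is expressed by
  vanishing Hom-groups, powers of the shift, direct sums and approximations. Both categories are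
  therefore made instances of one locale, preadditive categories whose shift is an autoequivalence,
  and the criteria for rigidity, orthogonality and stability are proved once. Two obstacles shape
  this. The quasi-inverse behind a negative shift is merely chosen, so \<open>(X[-i], Y)\<close> is
  traded for \<open>(X, Y[i])\<close>. And the shift of \<open>U\<close> is given by arbitrary
  completions to morphisms of triangles; it is handled through a relation between a morphism and its
  possible images, which respects congruence modulo \<open>[D]\<close> in both directions. Serre
  duality enters through one fact: \<open>(W, S_n Y [i])\<close> and \<open>(Y, W[n-i])\<close>
  vanish together. As i -> n-i permutes the indices 0 < i < n, stability of \<open>D\<close> under
  \<open>S_n\<close> makes the left and right descriptions of \<open>Z\<close> agree, and
  \<open>Z\<close> itself stable. In the second correspondence \<open>S'_n\<close> is
  \<open>S_n\<close> composed with \<open><n>\<close> and \<open><-n>\<close>, which cancel, so on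
  objects it is \<open>S_n\<close> up to isomorphism in \<open>U\<close>.\<close>

definition arrow :: "('k, 'o, 'm, 'z) lin_cat_scheme \<Rightarrow> 'm \<Rightarrow> 'o \<Rightarrow> 'o \<Rightarrow> bool"
    (\<open>(_ \<Colon>\<index>/ _ \<rightarrow> _)\<close> [51, 51, 51] 50)
  where "f \<Colon>\<^bsub>C\<^esub> X \<rightarrow> Y \<longleftrightarrow> X \<in> Obj C \<and> Y \<in> Obj C \<and> f \<in> mor C X Y"

text \<open>
  The total functions \<open>src\<close> and \<open>tgt\<close> (arbitrary outside the morphisms) turn
  the typing conditions of the category axioms into equations for the simplifier.
\<close>

definition arr :: "('k, 'o, 'm, 'z) lin_cat_scheme \<Rightarrow> 'm \<Rightarrow> bool"
  where "arr C f \<longleftrightarrow> (\<exists>X Y. f \<Colon>\<^bsub>C\<^esub> X \<rightarrow> Y)"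

definition src :: "('k, 'o, 'm, 'z) lin_cat_scheme \<Rightarrow> 'm \<Rightarrow> 'o"
  where "src C f = (THE X. \<exists>Y. f \<Colon>\<^bsub>C\<^esub> X \<rightarrow> Y)"

definition tgt :: "('k, 'o, 'm, 'z) lin_cat_scheme \<Rightarrow> 'm \<Rightarrow> 'o"
  where "tgt C f = (THE Y. \<exists>X. f \<Colon>\<^bsub>C\<^esub> X \<rightarrow> Y)"

text \<open>The Hom-group is read off the first argument. Equations between morphisms then carry no
  object indices, and the simplifier can treat addition like an operation on a single type.\<close>

definition add_mor :: "('k, 'o, 'm, 'z) lin_cat_scheme \<Rightarrow> 'm \<Rightarrow> 'm \<Rightarrow> 'm"
    (infixl \<open>\<boxplus>\<index>\<close> 65)
  where "f \<boxplus>\<^bsub>C\<^esub> g = f \<oplus>\<^bsub>Hom C (src C f) (tgt C f)\<^esub> g"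

definition neg_mor :: "('k, 'o, 'm, 'z) lin_cat_scheme \<Rightarrow> 'm \<Rightarrow> 'm"
    (\<open>\<boxminus>\<index> _\<close> [80] 80)
  where "\<boxminus>\<^bsub>C\<^esub> f = \<ominus>\<^bsub>Hom C (src C f) (tgt C f)\<^esub> f"

abbreviation zero_mor :: "('k, 'o, 'm, 'z) lin_cat_scheme \<Rightarrow> 'o \<Rightarrow> 'o \<Rightarrow> 'm"
  where "zero_mor C X Y \<equiv> \<zero>\<^bsub>Hom C X Y\<^esub>"

text \<open>The common ground of \<open>T\<close> and of its quotient: Hom-groups and biadditive
  composition. Scalars are left out, so that for the quotient only additive groups have to be
  checked.\<close>

locale preadditive_category =
  fixes C :: "('k, 'o, 'm, 'z) lin_cat_scheme" (structure)
  assumes Hom_abelian_group: "\<lbrakk>X \<in> Obj C; Y \<in> Obj C\<rbrakk> \<Longrightarrow> abelian_group (Hom C X Y)"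
    and arrow_unique: "\<lbrakk>f \<Colon> X \<rightarrow> Y; f \<Colon> X' \<rightarrow> Y'\<rbrakk> \<Longrightarrow> X = X' \<and> Y = Y'"
    and ident_arrow: "X \<in> Obj C \<Longrightarrow> ident C X \<Colon> X \<rightarrow> X"
    and cmp_arrow: "\<lbrakk>f \<Colon> X \<rightarrow> Y; g \<Colon> Y \<rightarrow> Z\<rbrakk> \<Longrightarrow> g \<cdot> f \<Colon> X \<rightarrow> Z"
    and arrow_cmp_ident: "f \<Colon> X \<rightarrow> Y \<Longrightarrow> f \<cdot> ident C X = f \<and> ident C Y \<cdot> f = f"
    and arrow_cmp_assoc:
      "\<lbrakk>f \<Colon> W \<rightarrow> X; g \<Colon> X \<rightarrow> Y; h \<Colon> Y \<rightarrow> Z\<rbrakk> \<Longrightarrow> (h \<cdot> g) \<cdot> f = h \<cdot> (g \<cdot> f)"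
    and arrow_cmp_add_left:
      "\<lbrakk>f \<Colon> X \<rightarrow> Y; g \<Colon> Y \<rightarrow> Z; g' \<Colon> Y \<rightarrow> Z\<rbrakk>
        \<Longrightarrow> (g \<oplus>\<^bsub>Hom C Y Z\<^esub> g') \<cdot> f = g \<cdot> f \<oplus>\<^bsub>Hom C X Z\<^esub> g' \<cdot> f"
    and arrow_cmp_add_right:
      "\<lbrakk>f \<Colon> X \<rightarrow> Y; f' \<Colon> X \<rightarrow> Y; g \<Colon> Y \<rightarrow> Z\<rbrakk>
        \<Longrightarrow> g \<cdot> (f \<oplus>\<^bsub>Hom C X Y\<^esub> f') = g \<cdot> f \<oplus>\<^bsub>Hom C X Z\<^esub> g \<cdot> f'"
begin

lemma src_eq: "f \<Colon> X \<rightarrow> Y \<Longrightarrow> src C f = X"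
  unfolding src_def by (blast dest: arrow_unique)

lemma tgt_eq: "f \<Colon> X \<rightarrow> Y \<Longrightarrow> tgt C f = Y"
  unfolding tgt_def by (blast dest: arrow_unique)

lemma arr_arrow: "arr C f \<Longrightarrow> f \<Colon> src C f \<rightarrow> tgt C f"
  unfolding arr_def by (metis src_eq tgt_eq)

text \<open>As a simp rule this dissolves each typing judgement into the equations that guard the
  rules below. Where a judgement has to survive as a unit, the rule is deleted.\<close>

lemma arrow_iff [simp]:
  "f \<Colon> X \<rightarrow> Y \<longleftrightarrow> arr C f \<and> src C f = X \<and> tgt C f = Y \<and> X \<in> Obj C \<and> Y \<in> Obj C"
  using arr_arrow src_eq tgt_eq by (metis arr_def arrow_def)

lemma src_Obj [simp]: "arr C f \<Longrightarrow> src C f \<in> Obj C"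
  and tgt_Obj [simp]: "arr C f \<Longrightarrow> tgt C f \<in> Obj C"
  using arr_arrow by (auto simp del: arrow_iff simp: arrow_def)

lemma mor_iff:
  "\<lbrakk>X \<in> Obj C; Y \<in> Obj C\<rbrakk> \<Longrightarrow> f \<in> mor C X Y \<longleftrightarrow> arr C f \<and> src C f = X \<and> tgt C f = Y"
  using arrow_iff[of f X Y] unfolding arrow_def by blast

lemma arr_ident [simp]:
  assumes "X \<in> Obj C"
  shows "arr C (ident C X)" "src C (ident C X) = X" "tgt C (ident C X) = X"
  using ident_arrow[OF assms] by auto

lemma arr_cmp [simp]:
  assumes "arr C f" "arr C g" "src C g = tgt C f"
  shows "arr C (g \<cdot> f)" "src C (g \<cdot> f) = src C f" "tgt C (g \<cdot> f) = tgt C g"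
  using cmp_arrow[of f "src C f" "tgt C f" g "tgt C g"] assms by auto

lemma cmp_ident_right [simp]: "\<lbrakk>arr C f; src C f = X\<rbrakk> \<Longrightarrow> f \<cdot> ident C X = f"
  and cmp_ident_left [simp]: "\<lbrakk>arr C f; tgt C f = X\<rbrakk> \<Longrightarrow> ident C X \<cdot> f = f"
  using arrow_cmp_ident[of f "src C f" "tgt C f"] by auto

lemma cmp_associative [simp]:
  "\<lbrakk>arr C f; arr C g; arr C h; src C g = tgt C f; src C h = tgt C g\<rbrakk>
    \<Longrightarrow> (h \<cdot> g) \<cdot> f = h \<cdot> (g \<cdot> f)"
  by (rule arrow_cmp_assoc[of f "src C f" "tgt C f" g "tgt C g" h "tgt C h"]) auto

lemma arr_zero [simp]:
  assumes "X \<in> Obj C" "Y \<in> Obj C"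
  shows "arr C (zero_mor C X Y)" "src C (zero_mor C X Y) = X" "tgt C (zero_mor C X Y) = Y"
proof -
  have "zero_mor C X Y \<in> mor C X Y"
    using Hom_abelian_group[OF assms] by (simp add: abelian_group_def abelian_monoid.zero_closed)
  with assms show "arr C (zero_mor C X Y)" "src C (zero_mor C X Y) = X" "tgt C (zero_mor C X Y) = Y"
    by (simp_all add: mor_iff)
qed

lemma arr_add [simp]:
  assumes "arr C f" "arr C g" "src C g = src C f" "tgt C g = tgt C f"
  shows "arr C (f \<boxplus> g)" "src C (f \<boxplus> g) = src C f" "tgt C (f \<boxplus> g) = tgt C f"
proof -
  interpret abelian_group "Hom C (src C f) (tgt C f)"
    using assms by (simp add: Hom_abelian_group)
  have "f \<boxplus> g \<in> mor C (src C f) (tgt C f)"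
    unfolding add_mor_def using assms by (intro a_closed) (simp_all add: mor_iff)
  with assms show "arr C (f \<boxplus> g)" "src C (f \<boxplus> g) = src C f" "tgt C (f \<boxplus> g) = tgt C f"
    by (simp_all add: mor_iff)
qed

lemma arr_neg [simp]:
  assumes "arr C f"
  shows "arr C (\<boxminus> f)" "src C (\<boxminus> f) = src C f" "tgt C (\<boxminus> f) = tgt C f"
proof -
  interpret abelian_group "Hom C (src C f) (tgt C f)"
    using assms by (simp add: Hom_abelian_group)
  have "\<boxminus> f \<in> mor C (src C f) (tgt C f)"
    unfolding neg_mor_def using assms by (intro a_inv_closed) (simp_all add: mor_iff)
  with assms show "arr C (\<boxminus> f)" "src C (\<boxminus> f) = src C f" "tgt C (\<boxminus> f) = tgt C f"
    by (simp_all add: mor_iff)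
qed

lemma Hom_add: "\<lbrakk>arr C f; X = src C f; Y = tgt C f\<rbrakk> \<Longrightarrow> f \<oplus>\<^bsub>Hom C X Y\<^esub> g = f \<boxplus> g"
  and Hom_neg: "\<lbrakk>arr C f; X = src C f; Y = tgt C f\<rbrakk> \<Longrightarrow> \<ominus>\<^bsub>Hom C X Y\<^esub> f = \<boxminus> f"
  unfolding add_mor_def neg_mor_def by simp_all

lemma add_assoc [simp]:
  assumes "arr C f" "arr C g" "src C g = src C f" "tgt C g = tgt C f"
    "arr C h" "src C h = src C f" "tgt C h = tgt C f"
  shows "f \<boxplus> g \<boxplus> h = f \<boxplus> (g \<boxplus> h)"
proof -
  interpret abelian_group "Hom C (src C f) (tgt C f)"
    using assms by (simp add: Hom_abelian_group)
  show ?thesis using a_assoc[of f g h] assms by (simp add: mor_iff Hom_add)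
qed

lemma add_commute:
  assumes "arr C f" "arr C g" "src C g = src C f" "tgt C g = tgt C f"
  shows "f \<boxplus> g = g \<boxplus> f"
proof -
  interpret abelian_group "Hom C (src C f) (tgt C f)"
    using assms by (simp add: Hom_abelian_group)
  show ?thesis using a_comm[of f g] assms by (simp add: mor_iff Hom_add)
qed

lemma add_left_commute:
  assumes "arr C f" "arr C g" "src C g = src C f" "tgt C g = tgt C f"
    "arr C h" "src C h = src C f" "tgt C h = tgt C f"
  shows "f \<boxplus> (g \<boxplus> h) = g \<boxplus> (f \<boxplus> h)"
  using assms by (metis add_assoc add_commute)

lemma add_zero_right [simp]:
    "\<lbrakk>arr C f; src C f = X; tgt C f = Y\<rbrakk> \<Longrightarrow> f \<boxplus> zero_mor C X Y = f"
  and add_zero_left [simp]: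
    "\<lbrakk>arr C f; src C f = X; tgt C f = Y\<rbrakk> \<Longrightarrow> zero_mor C X Y \<boxplus> f = f"
proof -
  assume f: "arr C f" "src C f = X" "tgt C f = Y"
  then interpret abelian_group "Hom C X Y"
    using f by (metis Hom_abelian_group src_Obj tgt_Obj)
  have "X \<in> Obj C" "Y \<in> Obj C" using f by auto
  with f show "f \<boxplus> zero_mor C X Y = f" "zero_mor C X Y \<boxplus> f = f"
    using l_zero[of f] r_zero[of f] by (simp_all add: mor_iff Hom_add)
qed

lemma add_neg_right [simp]: "arr C f \<Longrightarrow> f \<boxplus> \<boxminus> f = zero_mor C (src C f) (tgt C f)"
  and add_neg_left [simp]: "arr C f \<Longrightarrow> \<boxminus> f \<boxplus> f = zero_mor C (src C f) (tgt C f)"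
proof -
  assume f: "arr C f"
  then interpret abelian_group "Hom C (src C f) (tgt C f)"
    by (simp add: Hom_abelian_group)
  show "f \<boxplus> \<boxminus> f = zero_mor C (src C f) (tgt C f)" "\<boxminus> f \<boxplus> f = zero_mor C (src C f) (tgt C f)"
    using f r_neg[of f] l_neg[of f] by (simp_all add: mor_iff Hom_add Hom_neg)
qed

text \<open>Applied with \<open>g = f\<close>, it shows that a morphism equal to its own double is
  zero. This is how composition and additive functors are seen to preserve zero morphisms.\<close>

lemma add_cancel_zero:
  assumes "arr C f" "arr C g" "src C g = src C f" "tgt C g = tgt C f" "f \<boxplus> g = f"
  shows "g = zero_mor C (src C f) (tgt C f)"
proof -
  have "g = \<boxminus> f \<boxplus> f \<boxplus> g"
    using assms(1-4) by (simp del: add_assoc)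
  also have "\<dots> = \<boxminus> f \<boxplus> f"
    using assms by (simp del: add_neg_left)
  finally show ?thesis using assms by simp
qed

lemma neg_unique:
  assumes "arr C f" "arr C g" "src C g = src C f" "tgt C g = tgt C f"
    "f \<boxplus> g = zero_mor C (src C f) (tgt C f)"
  shows "g = \<boxminus> f"
proof -
  have "g = \<boxminus> f \<boxplus> f \<boxplus> g"
    using assms(1-4) by (simp del: add_assoc)
  also have "\<dots> = \<boxminus> f"
    using assms by (simp del: add_neg_left)
  finally show ?thesis .
qed

lemma neg_neg [simp]: "arr C f \<Longrightarrow> \<boxminus> \<boxminus> f = f"
  by (rule sym, rule neg_unique) auto

lemma neg_zero [simp]:
  "\<lbrakk>X \<in> Obj C; Y \<in> Obj C\<rbrakk> \<Longrightarrow> \<boxminus> zero_mor C X Y = zero_mor C X Y"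
  by (rule sym, rule neg_unique) auto

lemma eq_iff_diff_zero:
  assumes "arr C f" "arr C g" "src C g = src C f" "tgt C g = tgt C f"
  shows "f = g \<longleftrightarrow> f \<boxplus> \<boxminus> g = zero_mor C (src C f) (tgt C f)"
proof
  assume "f \<boxplus> \<boxminus> g = zero_mor C (src C f) (tgt C f)"
  with assms have "\<boxminus> g = \<boxminus> f" by (intro neg_unique) auto
  with assms show "f = g" by (metis neg_neg)
qed (use assms in simp)

lemma diff_add_cancel [simp]:
  assumes "arr C f" "arr C g" "src C g = src C f" "tgt C g = tgt C f"
  shows "f \<boxplus> (\<boxminus> g \<boxplus> g) = f" "g \<boxplus> (f \<boxplus> \<boxminus> g) = f" "g \<boxplus> (\<boxminus> g \<boxplus> f) = f"
    "\<boxminus> g \<boxplus> (g \<boxplus> f) = f"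
proof -
  show "f \<boxplus> (\<boxminus> g \<boxplus> g) = f" using assms by simp
  have "g \<boxplus> (f \<boxplus> \<boxminus> g) = f \<boxplus> (g \<boxplus> \<boxminus> g)" using assms by (intro add_left_commute) auto
  then show "g \<boxplus> (f \<boxplus> \<boxminus> g) = f" using assms by simp
  have "g \<boxplus> (\<boxminus> g \<boxplus> f) = g \<boxplus> \<boxminus> g \<boxplus> f" using assms by (simp del: add_neg_right)
  then show "g \<boxplus> (\<boxminus> g \<boxplus> f) = f" using assms by simp
  have "\<boxminus> g \<boxplus> (g \<boxplus> f) = \<boxminus> g \<boxplus> g \<boxplus> f" using assms by (simp del: add_neg_left)
  then show "\<boxminus> g \<boxplus> (g \<boxplus> f) = f" using assms by simp
qed

lemma cmp_add_left:
  assumes "arr C f" "arr C g" "src C g = tgt C f" "arr C g'" "src C g' = src C g" "tgt C g' = tgt C g"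
  shows "(g \<boxplus> g') \<cdot> f = g \<cdot> f \<boxplus> g' \<cdot> f"
  using arrow_cmp_add_left[of f "src C f" "tgt C f" g "tgt C g" g'] assms
  by (simp add: Hom_add)

lemma cmp_add_right:
  assumes "arr C f" "arr C g" "src C g = tgt C f" "arr C f'" "src C f' = src C f" "tgt C f' = tgt C f"
  shows "g \<cdot> (f \<boxplus> f') = g \<cdot> f \<boxplus> g \<cdot> f'"
  using arrow_cmp_add_right[of f "src C f" "tgt C f" f' g "tgt C g"] assms
  by (simp add: Hom_add)

lemma cmp_zero_right [simp]:
  assumes "arr C g" "src C g = Y" "X \<in> Obj C"
  shows "g \<cdot> zero_mor C X Y = zero_mor C X (tgt C g)"
proof -
  have Y: "Y \<in> Obj C" using assms by auto
  have "g \<cdot> zero_mor C X Y \<boxplus> g \<cdot> zero_mor C X Y = g \<cdot> zero_mor C X Y"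
    using assms Y by (subst cmp_add_right[symmetric]) auto
  from add_cancel_zero[OF _ _ _ _ this] assms Y show ?thesis by auto
qed

lemma cmp_zero_left [simp]:
  assumes "arr C f" "tgt C f = Y" "Z \<in> Obj C"
  shows "zero_mor C Y Z \<cdot> f = zero_mor C (src C f) Z"
proof -
  have Y: "Y \<in> Obj C" using assms by auto
  have "zero_mor C Y Z \<cdot> f \<boxplus> zero_mor C Y Z \<cdot> f = zero_mor C Y Z \<cdot> f"
    using assms Y by (subst cmp_add_left[symmetric]) auto
  from add_cancel_zero[OF _ _ _ _ this] assms Y show ?thesis by auto
qed

lemma cmp_neg_right [simp]:
  assumes "arr C f" "arr C g" "src C g = tgt C f"
  shows "g \<cdot> (\<boxminus> f) = \<boxminus> (g \<cdot> f)"
proof (rule neg_unique)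
  show "g \<cdot> f \<boxplus> g \<cdot> \<boxminus> f = zero_mor C (src C (g \<cdot> f)) (tgt C (g \<cdot> f))"
    using assms by (subst cmp_add_right[symmetric]) auto
qed (use assms in auto)

lemma cmp_neg_left [simp]:
  assumes "arr C f" "arr C g" "src C g = tgt C f"
  shows "(\<boxminus> g) \<cdot> f = \<boxminus> (g \<cdot> f)"
proof (rule neg_unique)
  show "g \<cdot> f \<boxplus> (\<boxminus> g) \<cdot> f = zero_mor C (src C (g \<cdot> f)) (tgt C (g \<cdot> f))"
    using assms by (subst cmp_add_left[symmetric]) auto
qed (use assms in auto)

text \<open>Once compositions are normalised to the right, a product \<open>g \<cdot> f\<close> of
  known value is hidden inside \<open>g \<cdot> (f \<cdot> h)\<close>. Instantiated with such a
  value, this becomes a rewrite rule that still fires.\<close>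

lemma cmp_reassoc:
  "\<lbrakk>g \<cdot> f = k; arr C f; arr C g; src C g = tgt C f; arr C h; tgt C h = src C f\<rbrakk>
    \<Longrightarrow> g \<cdot> (f \<cdot> h) = k \<cdot> h"
  by (auto simp flip: cmp_associative)

section \<open>Isomorphisms and vanishing Hom-groups\<close>

lemma iso_mor_iff:
  "\<lbrakk>X \<in> Obj C; Y \<in> Obj C\<rbrakk> \<Longrightarrow> iso_mor C X Y f \<longleftrightarrow> f \<Colon> X \<rightarrow> Y \<and>
    (\<exists>g. g \<Colon> Y \<rightarrow> X \<and> g \<cdot> f = ident C X \<and> f \<cdot> g = ident C Y)"
  unfolding iso_mor_def by (auto simp: mor_iff)

lemma isomorphicI:
  "\<lbrakk>f \<Colon> X \<rightarrow> Y; g \<Colon> Y \<rightarrow> X; g \<cdot> f = ident C X; f \<cdot> g = ident C Y\<rbrakk> \<Longrightarrow> isomorphic C X Y"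
  unfolding isomorphic_def using iso_mor_iff[of X Y f] by fastforce

lemma isomorphicE:
  assumes "isomorphic C X Y" "X \<in> Obj C" "Y \<in> Obj C"
  obtains f g where "f \<Colon> X \<rightarrow> Y" "g \<Colon> Y \<rightarrow> X" "g \<cdot> f = ident C X" "f \<cdot> g = ident C Y"
proof -
  obtain f where f: "iso_mor C X Y f" using assms(1) unfolding isomorphic_def ..
  show ?thesis using f unfolding iso_mor_iff[OF assms(2,3)] by (elim conjE exE) (rule that)
qed

lemma isomorphic_refl: "X \<in> Obj C \<Longrightarrow> isomorphic C X X"
  by (rule isomorphicI[of "ident C X" _ _ "ident C X"]) simp_all

lemma isomorphic_sym:
  "\<lbrakk>X \<in> Obj C; Y \<in> Obj C; isomorphic C X Y\<rbrakk> \<Longrightarrow> isomorphic C Y X"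
  by (erule isomorphicE) (assumption+, rule isomorphicI)

lemma isomorphic_trans:
  assumes "X \<in> Obj C" "Y \<in> Obj C" "Z \<in> Obj C" "isomorphic C X Y" "isomorphic C Y Z"
  shows "isomorphic C X Z"
proof -
  obtain f g where f: "f \<Colon> X \<rightarrow> Y" "g \<Colon> Y \<rightarrow> X" "g \<cdot> f = ident C X" "f \<cdot> g = ident C Y"
    using isomorphicE assms by blast
  obtain f' g' where f': "f' \<Colon> Y \<rightarrow> Z" "g' \<Colon> Z \<rightarrow> Y" "g' \<cdot> f' = ident C Y" "f' \<cdot> g' = ident C Z"
    using isomorphicE assms by blast
  show ?thesis
    by (rule isomorphicI[of "f' \<cdot> f" _ _ "g \<cdot> g'"])
      (use f f' in \<open>simp_all add: cmp_reassoc[OF f'(3)] cmp_reassoc[OF f(4)]\<close>)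
qed

definition hom_zero :: "'o \<Rightarrow> 'o \<Rightarrow> bool"
  where "hom_zero X Y \<longleftrightarrow> mor C X Y = {zero_mor C X Y}"

lemma hom_zeroD: "\<lbrakk>hom_zero X Y; f \<Colon> X \<rightarrow> Y\<rbrakk> \<Longrightarrow> f = zero_mor C X Y"
  unfolding hom_zero_def arrow_def by blast

lemma hom_zeroI:
  assumes "X \<in> Obj C" "Y \<in> Obj C" "\<And>f. f \<Colon> X \<rightarrow> Y \<Longrightarrow> f = zero_mor C X Y"
  shows "hom_zero X Y"
proof -
  have "zero_mor C X Y \<in> mor C X Y" using assms(1,2) by (simp add: mor_iff)
  with assms show ?thesis unfolding hom_zero_def arrow_def by blast
qed

text \<open>Conjugation by the two isomorphisms turns a morphism between the new objects into one
  between the old ones, and back.\<close>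

lemma hom_zero_iso:
  assumes "X \<in> Obj C" "Y \<in> Obj C" "X' \<in> Obj C" "Y' \<in> Obj C"
    and "isomorphic C X X'" "isomorphic C Y Y'" "hom_zero X Y"
  shows "hom_zero X' Y'"
proof (rule hom_zeroI[OF assms(3,4)])
  fix h assume h: "h \<Colon> X' \<rightarrow> Y'"
  obtain f g where f: "f \<Colon> X \<rightarrow> X'" "g \<Colon> X' \<rightarrow> X" "f \<cdot> g = ident C X'"
    using isomorphicE assms by blast
  obtain f' g' where f': "f' \<Colon> Y \<rightarrow> Y'" "g' \<Colon> Y' \<rightarrow> Y" "f' \<cdot> g' = ident C Y'"
    using isomorphicE assms by blast
  have "g' \<cdot> h \<cdot> f = zero_mor C X Y"
    using h f f' by (intro hom_zeroD[OF assms(7)]) simp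
  then have "f' \<cdot> (g' \<cdot> h \<cdot> f) \<cdot> g = zero_mor C X' Y'"
    using f f' by simp
  moreover have "f' \<cdot> (g' \<cdot> h \<cdot> f) \<cdot> g = h"
    using h f f' by (simp add: cmp_reassoc[OF f'(3)])
  ultimately show "h = zero_mor C X' Y'" by simp
qed

lemma hom_zero_cong:
  assumes "X \<in> Obj C" "Y \<in> Obj C" "X' \<in> Obj C" "Y' \<in> Obj C"
    and "isomorphic C X X'" "isomorphic C Y Y'"
  shows "hom_zero X Y \<longleftrightarrow> hom_zero X' Y'"
proof
  show "hom_zero X Y \<Longrightarrow> hom_zero X' Y'" using hom_zero_iso[OF assms] .
  show "hom_zero X' Y' \<Longrightarrow> hom_zero X Y"
    using hom_zero_iso[OF assms(3,4,1,2)] isomorphic_sym assms by blast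
qed

end

section \<open>Equivalences\<close>

context preadditive_category
begin

definition additive_functor :: "('o, 'm) endo \<Rightarrow> bool"
  where "additive_functor F \<longleftrightarrow> (\<forall>f g. arr C f \<and> arr C g \<and> src C g = src C f \<and> tgt C g = tgt C f
    \<longrightarrow> Fmor F (f \<boxplus> g) = Fmor F f \<boxplus> Fmor F g)"

definition faithful :: "('o, 'm) endo \<Rightarrow> bool"
  where "faithful F \<longleftrightarrow> (\<forall>f g. arr C f \<and> arr C g \<and> src C g = src C f \<and> tgt C g = tgt C f
    \<and> Fmor F f = Fmor F g \<longrightarrow> f = g)"

definition full :: "('o, 'm) endo \<Rightarrow> bool"
  where "full F \<longleftrightarrow> (\<forall>X\<in>Obj C. \<forall>Y\<in>Obj C. \<forall>h. h \<Colon> Fob F X \<rightarrow> Fob F Y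
    \<longrightarrow> (\<exists>f. f \<Colon> X \<rightarrow> Y \<and> Fmor F f = h))"

definition ess_surj :: "('o, 'm) endo \<Rightarrow> bool"
  where "ess_surj F \<longleftrightarrow> (\<forall>Y\<in>Obj C. \<exists>X\<in>Obj C. isomorphic C (Fob F X) Y)"

lemma functor_Obj [simp]: "\<lbrakk>endofunctor C F; X \<in> Obj C\<rbrakk> \<Longrightarrow> Fob F X \<in> Obj C"
  and functor_ident [simp]:
    "\<lbrakk>endofunctor C F; X \<in> Obj C\<rbrakk> \<Longrightarrow> Fmor F (ident C X) = ident C (Fob F X)"
  unfolding endofunctor_def by blast+

lemma functor_arrow: "\<lbrakk>endofunctor C F; f \<Colon> X \<rightarrow> Y\<rbrakk> \<Longrightarrow> Fmor F f \<Colon> Fob F X \<rightarrow> Fob F Y"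
  unfolding endofunctor_def arrow_def by blast

lemma functor_arr [simp]:
  assumes "endofunctor C F" "arr C f"
  shows "arr C (Fmor F f)" "src C (Fmor F f) = Fob F (src C f)" "tgt C (Fmor F f) = Fob F (tgt C f)"
  using functor_arrow[OF assms(1), of f "src C f" "tgt C f"] assms(2) by simp_all

lemma functor_cmp [simp]:
  assumes "endofunctor C F" "arr C f" "arr C g" "src C g = tgt C f"
  shows "Fmor F (g \<cdot> f) = Fmor F g \<cdot> Fmor F f"
proof -
  have "f \<in> mor C (src C f) (tgt C f)" "g \<in> mor C (tgt C f) (tgt C g)"
    using assms by (simp_all add: mor_iff)
  then show ?thesis
    using assms unfolding endofunctor_def by (metis src_Obj tgt_Obj)
qed

lemma endofunctorI:
  assumes "\<And>X. X \<in> Obj C \<Longrightarrow> Fob F X \<in> Obj C"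
    and "\<And>X. X \<in> Obj C \<Longrightarrow> Fmor F (ident C X) = ident C (Fob F X)"
    and "\<And>f. arr C f \<Longrightarrow> Fmor F f \<Colon> Fob F (src C f) \<rightarrow> Fob F (tgt C f)"
    and "\<And>f g. \<lbrakk>arr C f; arr C g; src C g = tgt C f\<rbrakk> \<Longrightarrow> Fmor F (g \<cdot> f) = Fmor F g \<cdot> Fmor F f"
  shows "endofunctor C F"
  unfolding endofunctor_def using assms by (auto simp: mor_iff)

lemma faithfulD:
  "\<lbrakk>faithful F; Fmor F f = Fmor F g; arr C f; arr C g; src C g = src C f; tgt C g = tgt C f\<rbrakk> \<Longrightarrow> f = g"
  unfolding faithful_def by blast

lemma fullE:
  assumes "full F" "h \<Colon> Fob F X \<rightarrow> Fob F Y" "X \<in> Obj C" "Y \<in> Obj C"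
  obtains f where "f \<Colon> X \<rightarrow> Y" "Fmor F f = h"
  using assms unfolding full_def by blast

lemma functor_add:
  "\<lbrakk>additive_functor F; arr C f; arr C g; src C g = src C f; tgt C g = tgt C f\<rbrakk>
    \<Longrightarrow> Fmor F (f \<boxplus> g) = Fmor F f \<boxplus> Fmor F g"
  unfolding additive_functor_def by blast

lemma functor_zero [simp]:
  assumes "endofunctor C F" "additive_functor F" "X \<in> Obj C" "Y \<in> Obj C"
  shows "Fmor F (zero_mor C X Y) = zero_mor C (Fob F X) (Fob F Y)"
proof -
  have "Fmor F (zero_mor C X Y \<boxplus> zero_mor C X Y) = Fmor F (zero_mor C X Y) \<boxplus> Fmor F (zero_mor C X Y)"
    by (rule functor_add[OF assms(2)]) (use assms in simp_all)
  then have "Fmor F (zero_mor C X Y) \<boxplus> Fmor F (zero_mor C X Y) = Fmor F (zero_mor C X Y)"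
    using assms by simp
  from add_cancel_zero[OF _ _ _ _ this] assms show ?thesis by simp
qed

lemma functor_neg [simp]:
  assumes "endofunctor C F" "additive_functor F" "arr C f"
  shows "Fmor F (\<boxminus> f) = \<boxminus> Fmor F f"
proof (rule neg_unique)
  have "Fmor F (f \<boxplus> \<boxminus> f) = Fmor F f \<boxplus> Fmor F (\<boxminus> f)"
    by (rule functor_add[OF assms(2)]) (use assms in simp_all)
  then show "Fmor F f \<boxplus> Fmor F (\<boxminus> f) = zero_mor C (src C (Fmor F f)) (tgt C (Fmor F f))"
    using assms by simp
qed (use assms in simp_all)

lemma functor_isomorphic:
  assumes "endofunctor C F" "X \<in> Obj C" "Y \<in> Obj C" "isomorphic C X Y"
  shows "isomorphic C (Fob F X) (Fob F Y)"
proof -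
  obtain f g where f: "f \<Colon> X \<rightarrow> Y" "g \<Colon> Y \<rightarrow> X" "g \<cdot> f = ident C X" "f \<cdot> g = ident C Y"
    using isomorphicE assms by blast
  show ?thesis
    by (rule isomorphicI[of "Fmor F f" _ _ "Fmor F g"])
      (use assms(1-3) f in \<open>simp_all flip: functor_cmp\<close>)
qed

section \<open>Quasi-inverses versus full, faithful and essentially surjective functors\<close>

lemma nat_iso_idE:
  assumes "naturally_isomorphic C H id_functor" "endofunctor C H"
  obtains \<tau> \<tau>' where "\<And>X. X \<in> Obj C \<Longrightarrow> \<tau> X \<Colon> Fob H X \<rightarrow> X"
    "\<And>X. X \<in> Obj C \<Longrightarrow> \<tau>' X \<Colon> X \<rightarrow> Fob H X"
    "\<And>X. X \<in> Obj C \<Longrightarrow> \<tau> X \<cdot> \<tau>' X = ident C X"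
    "\<And>X. X \<in> Obj C \<Longrightarrow> \<tau>' X \<cdot> \<tau> X = ident C (Fob H X)"
    "\<And>f. arr C f \<Longrightarrow> \<tau> (tgt C f) \<cdot> Fmor H f = f \<cdot> \<tau> (src C f)"
proof -
  obtain \<tau> where \<tau>: "\<forall>X\<in>Obj C. iso_mor C (Fob H X) X (\<tau> X)"
    "\<forall>X\<in>Obj C. \<forall>Y\<in>Obj C. \<forall>f\<in>mor C X Y. \<tau> Y \<cdot> Fmor H f = f \<cdot> \<tau> X"
    using assms(1) unfolding naturally_isomorphic_def id_functor_def by auto
  have iso: "\<exists>g. \<tau> X \<Colon> Fob H X \<rightarrow> X \<and> g \<Colon> X \<rightarrow> Fob H X \<and>
      \<tau> X \<cdot> g = ident C X \<and> g \<cdot> \<tau> X = ident C (Fob H X)" if "X \<in> Obj C" for X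
  proof -
    have "iso_mor C (Fob H X) X (\<tau> X)" using \<tau>(1) that by blast
    then show ?thesis using iso_mor_iff[of "Fob H X" X] that assms(2) by (metis functor_Obj)
  qed
  define \<tau>' where "\<tau>' X = (SOME g. \<tau> X \<Colon> Fob H X \<rightarrow> X \<and> g \<Colon> X \<rightarrow> Fob H X \<and>
      \<tau> X \<cdot> g = ident C X \<and> g \<cdot> \<tau> X = ident C (Fob H X))" for X
  have \<tau>': "\<tau> X \<Colon> Fob H X \<rightarrow> X \<and> \<tau>' X \<Colon> X \<rightarrow> Fob H X \<and>
      \<tau> X \<cdot> \<tau>' X = ident C X \<and> \<tau>' X \<cdot> \<tau> X = ident C (Fob H X)" if "X \<in> Obj C" for X
    unfolding \<tau>'_def by (rule someI_ex[OF iso[OF that]])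
  have nat: "\<tau> (tgt C f) \<cdot> Fmor H f = f \<cdot> \<tau> (src C f)" if f: "arr C f" for f
  proof -
    have "f \<in> mor C (src C f) (tgt C f)" using f by (simp add: mor_iff)
    then show ?thesis using \<tau>(2) src_Obj[OF f] tgt_Obj[OF f] by blast
  qed
  show ?thesis
    by (rule that[of \<tau> \<tau>']) (use \<tau>' nat in blast)+
qed

lemma nat_iso_idI:
  assumes "\<And>X. X \<in> Obj C \<Longrightarrow> \<tau> X \<Colon> Fob H X \<rightarrow> X" "\<And>X. X \<in> Obj C \<Longrightarrow> \<tau>' X \<Colon> X \<rightarrow> Fob H X"
    "\<And>X. X \<in> Obj C \<Longrightarrow> \<tau> X \<cdot> \<tau>' X = ident C X"
    "\<And>X. X \<in> Obj C \<Longrightarrow> \<tau>' X \<cdot> \<tau> X = ident C (Fob H X)"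
    "\<And>f. arr C f \<Longrightarrow> \<tau> (tgt C f) \<cdot> Fmor H f = f \<cdot> \<tau> (src C f)"
  shows "naturally_isomorphic C H id_functor"
  unfolding naturally_isomorphic_def id_functor_def
proof (intro exI[of _ \<tau>] conjI ballI)
  fix X assume X: "X \<in> Obj C"
  then have "Fob H X \<in> Obj C" using assms(1)[OF X] by simp
  show "iso_mor C (Fob H X) (Fob \<lparr>Fob = \<lambda>X. X, Fmor = \<lambda>f. f\<rparr> X) (\<tau> X)"
    unfolding endo.select_convs iso_mor_iff[OF \<open>Fob H X \<in> Obj C\<close> X]
    by (intro conjI exI[of _ "\<tau>' X"]) (fact assms(1-4)[OF X])+
qed (use assms(5) in \<open>auto simp: mor_iff\<close>)

lemma endofunctor_comp:
  assumes "endofunctor C F" "endofunctor C G"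
  shows "endofunctor C (comp_functor F G)"
  by (rule endofunctorI) (use assms in \<open>simp_all add: comp_functor_def\<close>)

lemma quasi_inverse_sym: "\<lbrakk>endofunctor C F; quasi_inverse C F G\<rbrakk> \<Longrightarrow> quasi_inverse C G F"
  unfolding quasi_inverse_def by blast

lemma quasi_inverse_isomorphic:
  assumes "endofunctor C F" "quasi_inverse C F G" "X \<in> Obj C"
  shows "isomorphic C (Fob G (Fob F X)) X"
proof -
  have G: "endofunctor C G" and n: "naturally_isomorphic C (comp_functor G F) id_functor"
    using assms(2) unfolding quasi_inverse_def by auto
  obtain \<tau> \<tau>' where t: "\<And>X. X \<in> Obj C \<Longrightarrow> \<tau> X \<Colon> Fob (comp_functor G F) X \<rightarrow> X"
    "\<And>X. X \<in> Obj C \<Longrightarrow> \<tau>' X \<Colon> X \<rightarrow> Fob (comp_functor G F) X"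
    "\<And>X. X \<in> Obj C \<Longrightarrow> \<tau> X \<cdot> \<tau>' X = ident C X"
    "\<And>X. X \<in> Obj C \<Longrightarrow> \<tau>' X \<cdot> \<tau> X = ident C (Fob (comp_functor G F) X)"
    "\<And>f. arr C f \<Longrightarrow> \<tau> (tgt C f) \<cdot> Fmor (comp_functor G F) f = f \<cdot> \<tau> (src C f)"
    by (rule nat_iso_idE[OF n endofunctor_comp[OF G assms(1)]]) (rule that; assumption)
  show ?thesis using isomorphicI[OF t(1,2,4,3)[OF assms(3)]] by (simp add: comp_functor_def)
qed

text \<open>By naturality a morphism is recovered from its image under \<open>F\<close>: apply
  \<open>G\<close> and conjugate with the components of the isomorphism from \<open>G F\<close> to
  the identity.\<close>

lemma quasi_inverse_faithful:
  assumes "endofunctor C F" "quasi_inverse C F G"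
  shows "faithful F"
  unfolding faithful_def
proof (intro allI impI, elim conjE)
  fix f g assume f: "arr C f" "arr C g" "src C g = src C f" "tgt C g = tgt C f" "Fmor F f = Fmor F g"
  have G: "endofunctor C G" and n: "naturally_isomorphic C (comp_functor G F) id_functor"
    using assms(2) unfolding quasi_inverse_def by auto
  obtain \<tau> \<tau>' where t: "\<And>X. X \<in> Obj C \<Longrightarrow> \<tau> X \<Colon> Fob (comp_functor G F) X \<rightarrow> X"
    "\<And>X. X \<in> Obj C \<Longrightarrow> \<tau>' X \<Colon> X \<rightarrow> Fob (comp_functor G F) X"
    "\<And>X. X \<in> Obj C \<Longrightarrow> \<tau> X \<cdot> \<tau>' X = ident C X"
    "\<And>X. X \<in> Obj C \<Longrightarrow> \<tau>' X \<cdot> \<tau> X = ident C (Fob (comp_functor G F) X)"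
    "\<And>f. arr C f \<Longrightarrow> \<tau> (tgt C f) \<cdot> Fmor (comp_functor G F) f = f \<cdot> \<tau> (src C f)"
    by (rule nat_iso_idE[OF n endofunctor_comp[OF G assms(1)]]) (rule that; assumption)
  have e: "h = \<tau> (tgt C h) \<cdot> Fmor G (Fmor F h) \<cdot> \<tau>' (src C h)" if h: "arr C h" for h
  proof -
    have "\<tau> (tgt C h) \<cdot> Fmor G (Fmor F h) = h \<cdot> \<tau> (src C h)"
      using t(5)[OF h] by (simp add: comp_functor_def)
    moreover have "(h \<cdot> \<tau> (src C h)) \<cdot> \<tau>' (src C h) = h"
      using h t(1,2)[of "src C h"] t(3)[of "src C h"] by simp
    moreover have "(\<tau> (tgt C h) \<cdot> Fmor G (Fmor F h)) \<cdot> \<tau>' (src C h)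
        = \<tau> (tgt C h) \<cdot> Fmor G (Fmor F h) \<cdot> \<tau>' (src C h)"
      using h t(1)[of "tgt C h"] t(2)[of "src C h"] G assms(1) by (simp add: comp_functor_def)
    ultimately show ?thesis by simp
  qed
  show "f = g" using e[OF f(1)] e[OF f(2)] f by simp
qed

text \<open>The preimage is \<open>G h\<close> conjugated by the natural isomorphism. That its image
  is \<open>h\<close> is checked after applying \<open>G\<close>, which is faithful because
  \<open>F\<close> is a quasi-inverse of it.\<close>

lemma quasi_inverse_full:
  assumes "endofunctor C F" "quasi_inverse C F G"
  shows "full F"
  unfolding full_def
proof (intro ballI allI impI)
  fix X Y h assume X: "X \<in> Obj C" "Y \<in> Obj C" and h: "h \<Colon> Fob F X \<rightarrow> Fob F Y"
  have G: "endofunctor C G" and n: "naturally_isomorphic C (comp_functor G F) id_functor"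
    using assms(2) unfolding quasi_inverse_def by auto
  note fG = quasi_inverse_faithful[OF G quasi_inverse_sym[OF assms]]
  obtain \<tau> \<tau>' where t: "\<And>X. X \<in> Obj C \<Longrightarrow> \<tau> X \<Colon> Fob (comp_functor G F) X \<rightarrow> X"
    "\<And>X. X \<in> Obj C \<Longrightarrow> \<tau>' X \<Colon> X \<rightarrow> Fob (comp_functor G F) X"
    "\<And>X. X \<in> Obj C \<Longrightarrow> \<tau> X \<cdot> \<tau>' X = ident C X"
    "\<And>X. X \<in> Obj C \<Longrightarrow> \<tau>' X \<cdot> \<tau> X = ident C (Fob (comp_functor G F) X)"
    "\<And>f. arr C f \<Longrightarrow> \<tau> (tgt C f) \<cdot> Fmor (comp_functor G F) f = f \<cdot> \<tau> (src C f)"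
    by (rule nat_iso_idE[OF n endofunctor_comp[OF G assms(1)]]) (rule that; assumption)
  note t = t[unfolded comp_functor_def endo.select_convs comp_def]
  define f where "f = \<tau> Y \<cdot> Fmor G h \<cdot> \<tau>' X"
  have f: "f \<Colon> X \<rightarrow> Y"
    unfolding f_def using t(1)[OF X(2)] t(2)[OF X(1)] h G by simp
  have "\<tau> Y \<cdot> Fmor G (Fmor F f) = f \<cdot> \<tau> X"
    using t(5)[of f] f by simp
  also have "\<dots> = \<tau> Y \<cdot> Fmor G h"
    unfolding f_def using t(1)[OF X(2)] t(1,2)[OF X(1)] t(4)[OF X(1)] h G by simp
  finally have "\<tau>' Y \<cdot> \<tau> Y \<cdot> Fmor G (Fmor F f) = \<tau>' Y \<cdot> \<tau> Y \<cdot> Fmor G h"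
    by simp
  then have "Fmor G (Fmor F f) = Fmor G h"
    using t(1,2)[OF X(2)] f h G assms(1) by (simp add: cmp_reassoc[OF t(4)[OF X(2)]])
  then have "Fmor F f = h"
    by (rule faithfulD[OF fG]) (use f h assms(1) in simp_all)
  with f show "\<exists>f. f \<Colon> X \<rightarrow> Y \<and> Fmor F f = h" by blast
qed

text \<open>Objects get a chosen preimage up to isomorphism. The value on morphisms is then forced
  by conjugation: fullness provides it, and faithfulness gives the functor laws.\<close>

lemma quasi_inverse_exists:
  assumes F: "endofunctor C F" and ff: "faithful F" and fl: "full F" and es: "ess_surj F"
  shows "\<exists>G. quasi_inverse C F G"
proof -
  have "\<forall>Y\<in>Obj C. \<exists>X \<phi> \<psi>. X \<in> Obj C \<and> \<phi> \<Colon> Fob F X \<rightarrow> Y \<and> \<psi> \<Colon> Y \<rightarrow> Fob F X \<and>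
      \<psi> \<cdot> \<phi> = ident C (Fob F X) \<and> \<phi> \<cdot> \<psi> = ident C Y"
  proof
    fix Y assume Y: "Y \<in> Obj C"
    then obtain X where X: "X \<in> Obj C" "isomorphic C (Fob F X) Y"
      using es unfolding ess_surj_def by blast
    show "\<exists>X \<phi> \<psi>. X \<in> Obj C \<and> \<phi> \<Colon> Fob F X \<rightarrow> Y \<and> \<psi> \<Colon> Y \<rightarrow> Fob F X \<and>
      \<psi> \<cdot> \<phi> = ident C (Fob F X) \<and> \<phi> \<cdot> \<psi> = ident C Y"
      by (rule isomorphicE[OF X(2) functor_Obj[OF F X(1)] Y]) (use X(1) in blast)
  qed
  then obtain Go \<phi> \<psi> where
    Go: "\<And>Y. Y \<in> Obj C \<Longrightarrow> Go Y \<in> Obj C" and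
    \<phi>: "\<And>Y. Y \<in> Obj C \<Longrightarrow> \<phi> Y \<Colon> Fob F (Go Y) \<rightarrow> Y" and
    \<psi>: "\<And>Y. Y \<in> Obj C \<Longrightarrow> \<psi> Y \<Colon> Y \<rightarrow> Fob F (Go Y)" and
    \<psi>\<phi>: "\<And>Y. Y \<in> Obj C \<Longrightarrow> \<psi> Y \<cdot> \<phi> Y = ident C (Fob F (Go Y))" and
    \<phi>\<psi>: "\<And>Y. Y \<in> Obj C \<Longrightarrow> \<phi> Y \<cdot> \<psi> Y = ident C Y"
    by metis
  have "\<exists>g. g \<Colon> Go (src C f) \<rightarrow> Go (tgt C f) \<and> Fmor F g = \<psi> (tgt C f) \<cdot> f \<cdot> \<phi> (src C f)"
    if f: "arr C f" for f
  proof (rule fullE[OF fl])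
    show "\<psi> (tgt C f) \<cdot> f \<cdot> \<phi> (src C f) \<Colon> Fob F (Go (src C f)) \<rightarrow> Fob F (Go (tgt C f))"
      using f \<phi>[of "src C f"] \<psi>[of "tgt C f"] Go F by simp
  qed (use f Go in auto)
  then obtain Gm where
    Gm: "\<And>f. arr C f \<Longrightarrow> Gm f \<Colon> Go (src C f) \<rightarrow> Go (tgt C f)" and
    FGm: "\<And>f. arr C f \<Longrightarrow> Fmor F (Gm f) = \<psi> (tgt C f) \<cdot> f \<cdot> \<phi> (src C f)"
    by metis
  define G where "G = \<lparr>Fob = Go, Fmor = Gm\<rparr>"
  have G: "endofunctor C G"
  proof (rule endofunctorI)
    fix X assume X: "X \<in> Obj C"
    show "Fob G X \<in> Obj C" using Go X by (simp add: G_def)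
    show "Fmor G (ident C X) = ident C (Fob G X)"
      by (rule faithfulD[OF ff])
        (use X Go[OF X] Gm[of "ident C X"] \<phi>[OF X] \<psi>[OF X] F in
          \<open>simp_all add: G_def FGm \<psi>\<phi>\<close>)
  next
    fix f assume "arr C f"
    then show "Fmor G f \<Colon> Fob G (src C f) \<rightarrow> Fob G (tgt C f)" using Gm by (simp add: G_def)
  next
    fix f g assume f: "arr C f" "arr C g" "src C g = tgt C f"
    note t = Gm[OF f(1)] Gm[OF f(2)] Gm[of "g \<cdot> f"] \<phi>[of "src C f"] \<phi>[of "tgt C f"] \<psi>[of "tgt C f"]
      \<psi>[of "tgt C g"]
    show "Fmor G (g \<cdot> f) = Fmor G g \<cdot> Fmor G f"
      by (rule faithfulD[OF ff])
        (use f t F in \<open>simp_all add: G_def FGm cmp_reassoc[OF \<phi>\<psi>]\<close>)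
  qed
  have FG: "naturally_isomorphic C (comp_functor F G) id_functor"
    by (rule nat_iso_idI[of \<phi> _ \<psi>])
      (use \<phi> \<psi> \<phi>\<psi> \<psi>\<phi> in \<open>simp_all add: comp_functor_def G_def FGm cmp_reassoc[OF \<phi>\<psi>]\<close>)
  \<comment> \<open>The second natural isomorphism is obtained by pulling the first one, taken at
    \<open>F X\<close>, back along \<open>F\<close>.\<close>
  have "\<exists>t t'. t \<Colon> Go (Fob F X) \<rightarrow> X \<and> t' \<Colon> X \<rightarrow> Go (Fob F X) \<and> Fmor F t = \<phi> (Fob F X) \<and>
      Fmor F t' = \<psi> (Fob F X)" if X: "X \<in> Obj C" for X
  proof -
    have FX: "Fob F X \<in> Obj C" using F X by simp
    show ?thesis
      using fullE[OF fl \<phi>[OF FX] Go[OF FX] X] fullE[OF fl \<psi>[OF FX] X Go[OF FX]] by metis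
  qed
  then obtain \<theta> \<theta>' where
    \<theta>: "\<And>X. X \<in> Obj C \<Longrightarrow> \<theta> X \<Colon> Go (Fob F X) \<rightarrow> X" and
    \<theta>': "\<And>X. X \<in> Obj C \<Longrightarrow> \<theta>' X \<Colon> X \<rightarrow> Go (Fob F X)" and
    F\<theta>: "\<And>X. X \<in> Obj C \<Longrightarrow> Fmor F (\<theta> X) = \<phi> (Fob F X)" and
    F\<theta>': "\<And>X. X \<in> Obj C \<Longrightarrow> Fmor F (\<theta>' X) = \<psi> (Fob F X)"
    by metis
  have GF: "naturally_isomorphic C (comp_functor G F) id_functor"
  proof (rule nat_iso_idI[of \<theta> _ \<theta>'])
    fix X assume X: "X \<in> Obj C"
    note t = X \<theta>[OF X] \<theta>'[OF X] F F\<theta>[OF X] F\<theta>'[OF X]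
    show "\<theta> X \<Colon> Fob (comp_functor G F) X \<rightarrow> X" "\<theta>' X \<Colon> X \<rightarrow> Fob (comp_functor G F) X"
      using \<theta>[OF X] \<theta>'[OF X] by (simp_all add: comp_functor_def G_def)
    show "\<theta> X \<cdot> \<theta>' X = ident C X"
      by (rule faithfulD[OF ff]) (use t in \<open>simp_all add: \<phi>\<psi>\<close>)
    have "\<theta>' X \<cdot> \<theta> X = ident C (Go (Fob F X))"
      by (rule faithfulD[OF ff]) (use t in \<open>simp_all add: \<psi>\<phi>\<close>)
    then show "\<theta>' X \<cdot> \<theta> X = ident C (Fob (comp_functor G F) X)"
      by (simp add: comp_functor_def G_def)
  next
    fix f assume f: "arr C f"
    have "\<theta> (tgt C f) \<cdot> Gm (Fmor F f) = f \<cdot> \<theta> (src C f)"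
      by (rule faithfulD[OF ff])
        (use f F \<theta>[of "src C f"] \<theta>[of "tgt C f"] Gm[of "Fmor F f"] \<phi>[of "Fob F (tgt C f)"]
          \<psi>[of "Fob F (tgt C f)"] \<phi>[of "Fob F (src C f)"]
         in \<open>simp_all add: FGm F\<theta> cmp_reassoc[OF \<phi>\<psi>]\<close>)
    then show "\<theta> (tgt C f) \<cdot> Fmor (comp_functor G F) f = f \<cdot> \<theta> (src C f)"
      by (simp add: comp_functor_def G_def)
  qed
  show ?thesis using G FG GF unfolding quasi_inverse_def by blast
qed

text \<open>This criterion allows the shift of the quotient to be shown an autoequivalence without
  writing down a quasi-inverse.\<close>

lemma autoequivalence_iff:
  "autoequivalence C F \<longleftrightarrow> endofunctor C F \<and> faithful F \<and> full F \<and> ess_surj F"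
proof
  assume "autoequivalence C F"
  then obtain G where F: "endofunctor C F" and q: "quasi_inverse C F G"
    unfolding autoequivalence_def by blast
  have G: "endofunctor C G" using q unfolding quasi_inverse_def by blast
  have "ess_surj F"
    unfolding ess_surj_def
  proof
    fix Y assume "Y \<in> Obj C"
    then show "\<exists>X\<in>Obj C. isomorphic C (Fob F X) Y"
      using quasi_inverse_isomorphic[OF G quasi_inverse_sym[OF F q]] G
      by (intro bexI[of _ "Fob G Y"]) simp_all
  qed
  then show "endofunctor C F \<and> faithful F \<and> full F \<and> ess_surj F"
    using F quasi_inverse_faithful[OF F q] quasi_inverse_full[OF F q] by blast
qed (auto simp: autoequivalence_def quasi_inverse_exists)

lemma autoequivalenceD:
  assumes "autoequivalence C F"
  shows "endofunctor C F" "faithful F" "full F" "ess_surj F"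
  using assms unfolding autoequivalence_iff by auto

lemma inverse_functor:
  assumes "autoequivalence C F"
  shows "quasi_inverse C F (inverse_functor C F)"
  using assms unfolding autoequivalence_def inverse_functor_def by (metis someI_ex)

lemma autoequivalence_inverse:
  assumes "autoequivalence C F"
  shows "autoequivalence C (inverse_functor C F)"
  using inverse_functor[OF assms] quasi_inverse_sym[OF _ inverse_functor[OF assms]] assms
  unfolding autoequivalence_def quasi_inverse_def by blast

lemma isomorphic_inverse_functor:
  assumes "autoequivalence C F" "X \<in> Obj C"
  shows "isomorphic C (Fob (inverse_functor C F) (Fob F X)) X"
    "isomorphic C (Fob F (Fob (inverse_functor C F) X)) X"
proof -
  have F: "endofunctor C F" and G: "endofunctor C (inverse_functor C F)"
    using assms(1) autoequivalence_inverse by (auto simp: autoequivalence_iff)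
  note q = inverse_functor[OF assms(1)]
  show "isomorphic C (Fob (inverse_functor C F) (Fob F X)) X"
    by (rule quasi_inverse_isomorphic[OF F q assms(2)])
  show "isomorphic C (Fob F (Fob (inverse_functor C F) X)) X"
    by (rule quasi_inverse_isomorphic[OF G quasi_inverse_sym[OF F q] assms(2)])
qed

lemma autoequivalence_id: "autoequivalence C id_functor"
  unfolding autoequivalence_iff
proof (intro conjI)
  show "endofunctor C id_functor" by (rule endofunctorI) (simp_all add: id_functor_def)
  show "ess_surj id_functor"
    unfolding ess_surj_def id_functor_def using isomorphic_refl by auto
qed (simp_all add: faithful_def full_def id_functor_def)

lemma autoequivalence_comp:
  assumes "autoequivalence C F" "autoequivalence C G"
  shows "autoequivalence C (comp_functor F G)"
  unfolding autoequivalence_iff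
proof (intro conjI)
  note F = autoequivalenceD[OF assms(1)] and G = autoequivalenceD[OF assms(2)]
  show "endofunctor C (comp_functor F G)" using F(1) G(1) by (rule endofunctor_comp)
  show "faithful (comp_functor F G)"
    unfolding faithful_def
  proof (intro allI impI, elim conjE)
    fix f g assume f: "arr C f" "arr C g" "src C g = src C f" "tgt C g = tgt C f"
      "Fmor (comp_functor F G) f = Fmor (comp_functor F G) g"
    have "Fmor G f = Fmor G g"
      by (rule faithfulD[OF F(2)]) (use f G in \<open>simp_all add: comp_functor_def\<close>)
    then show "f = g" by (rule faithfulD[OF G(2)]) (use f in simp_all)
  qed
  show "full (comp_functor F G)"
    unfolding full_def
  proof (intro ballI allI impI)
    fix X Y h assume X: "X \<in> Obj C" "Y \<in> Obj C" "h \<Colon> Fob (comp_functor F G) X \<rightarrow> Fob (comp_functor F G) Y"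
    obtain k where k: "k \<Colon> Fob G X \<rightarrow> Fob G Y" "Fmor F k = h"
      using fullE[OF F(3), of h "Fob G X" "Fob G Y"] X G by (auto simp: comp_functor_def simp del: arrow_iff)
    obtain f where "f \<Colon> X \<rightarrow> Y" "Fmor G f = k"
      using fullE[OF G(3) k(1)] X by blast
    with k show "\<exists>f. f \<Colon> X \<rightarrow> Y \<and> Fmor (comp_functor F G) f = h"
      by (auto simp: comp_functor_def simp del: arrow_iff)
  qed
  show "ess_surj (comp_functor F G)"
    unfolding ess_surj_def
  proof
    fix Y assume Y: "Y \<in> Obj C"
    obtain X where X: "X \<in> Obj C" "isomorphic C (Fob F X) Y"
      using F(4) Y unfolding ess_surj_def by blast
    obtain W where W: "W \<in> Obj C" "isomorphic C (Fob G W) X"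
      using G(4) X unfolding ess_surj_def by blast
    have "isomorphic C (Fob F (Fob G W)) (Fob F X)"
      using functor_isomorphic[OF F(1)] W X G by simp
    then have "isomorphic C (Fob F (Fob G W)) Y"
      using isomorphic_trans[OF _ _ Y _ X(2)] W(1) X(1) F G by simp
    then show "\<exists>X\<in>Obj C. isomorphic C (Fob (comp_functor F G) X) Y"
      using W(1) by (auto simp: comp_functor_def)
  qed
qed

lemma Fob_funpow: "Fob ((comp_functor F ^^ i) id_functor) X = (Fob F ^^ i) X"
  by (induction i) (simp_all add: comp_functor_def id_functor_def)

lemma autoequivalence_funpow:
  "autoequivalence C F \<Longrightarrow> autoequivalence C ((comp_functor F ^^ i) id_functor)"
  by (induction i) (simp_all add: autoequivalence_comp autoequivalence_id)

lemma additive_functor_id: "additive_functor id_functor"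
  unfolding additive_functor_def id_functor_def by simp

lemma additive_functor_comp:
  "\<lbrakk>endofunctor C G; additive_functor F; additive_functor G\<rbrakk> \<Longrightarrow> additive_functor (comp_functor F G)"
  unfolding additive_functor_def comp_functor_def by simp

lemma additive_functor_funpow:
  assumes "autoequivalence C F" "additive_functor F"
  shows "additive_functor ((comp_functor F ^^ i) id_functor)"
  by (induction i)
    (use assms in \<open>simp_all add: additive_functor_id additive_functor_comp autoequivalenceD(1) autoequivalence_funpow\<close>)

text \<open>\<open>F (G (f + g))\<close> and \<open>F (G f + G g)\<close> agree after composition
  with the isomorphism from \<open>F G\<close> to the identity, by its naturality. Cancelling it,
  faithfulness of \<open>F\<close> gives the claim.\<close>

lemma additive_functor_inverse:
  assumes "autoequivalence C F" "additive_functor F"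
  shows "additive_functor (inverse_functor C F)"
  unfolding additive_functor_def
proof (intro allI impI, elim conjE)
  define G where "G = inverse_functor C F"
  fix f g assume f: "arr C f" "arr C g" "src C g = src C f" "tgt C g = tgt C f"
  note F = autoequivalenceD[OF assms(1)] and G = autoequivalenceD[OF autoequivalence_inverse[OF assms(1)], folded G_def]
  have n: "naturally_isomorphic C (comp_functor F G) id_functor"
    using inverse_functor[OF assms(1)] unfolding quasi_inverse_def G_def by auto
  obtain \<tau> \<tau>' where t: "\<And>X. X \<in> Obj C \<Longrightarrow> \<tau> X \<Colon> Fob (comp_functor F G) X \<rightarrow> X"
    "\<And>X. X \<in> Obj C \<Longrightarrow> \<tau>' X \<Colon> X \<rightarrow> Fob (comp_functor F G) X"
    "\<And>X. X \<in> Obj C \<Longrightarrow> \<tau> X \<cdot> \<tau>' X = ident C X"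
    "\<And>X. X \<in> Obj C \<Longrightarrow> \<tau>' X \<cdot> \<tau> X = ident C (Fob (comp_functor F G) X)"
    "\<And>f. arr C f \<Longrightarrow> \<tau> (tgt C f) \<cdot> Fmor (comp_functor F G) f = f \<cdot> \<tau> (src C f)"
    by (rule nat_iso_idE[OF n endofunctor_comp[OF F(1) G(1)]]) (rule that; assumption)
  note t = t[unfolded comp_functor_def endo.select_convs comp_def]
  define X Y where "X = src C f" and "Y = tgt C f"
  have X: "src C f = X" "src C g = X" "tgt C f = Y" "tgt C g = Y" "X \<in> Obj C" "Y \<in> Obj C"
    using f by (simp_all add: X_def Y_def)
  have "\<tau> Y \<cdot> Fmor F (Fmor G (f \<boxplus> g)) = (f \<boxplus> g) \<cdot> \<tau> X"
    using t(5)[of "f \<boxplus> g"] f X by simp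
  also have "\<dots> = f \<cdot> \<tau> X \<boxplus> g \<cdot> \<tau> X"
    using t(1)[OF X(5)] f X by (simp add: cmp_add_left)
  also have "\<dots> = \<tau> Y \<cdot> Fmor F (Fmor G f) \<boxplus> \<tau> Y \<cdot> Fmor F (Fmor G g)"
    using t(5)[of f] t(5)[of g] f X by simp
  also have "\<dots> = \<tau> Y \<cdot> Fmor F (Fmor G f \<boxplus> Fmor G g)"
    using t(1)[OF X(6)] f X F(1) G(1) by (simp add: cmp_add_right functor_add[OF assms(2)])
  finally have "\<tau>' Y \<cdot> \<tau> Y \<cdot> Fmor F (Fmor G (f \<boxplus> g)) = \<tau>' Y \<cdot> \<tau> Y \<cdot> Fmor F (Fmor G f \<boxplus> Fmor G g)"
    by simp
  then have "Fmor F (Fmor G (f \<boxplus> g)) = Fmor F (Fmor G f \<boxplus> Fmor G g)"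
    using t(1,2)[OF X(6)] f X F(1) G(1) by (simp add: cmp_reassoc[OF t(4)[OF X(6)]])
  then have "Fmor G (f \<boxplus> g) = Fmor G f \<boxplus> Fmor G g"
    by (rule faithfulD[OF F(2)]) (use f X F(1) G(1) in simp_all)
  then show "Fmor (inverse_functor C F) (f \<boxplus> g) = Fmor (inverse_functor C F) f \<boxplus> Fmor (inverse_functor C F) g"
    by (simp add: G_def)
qed

lemma linear_endofunctor_additive:
  assumes "linear_endofunctor R C F"
  shows "additive_functor F"
  unfolding additive_functor_def
proof (intro allI impI, elim conjE)
  fix f g assume f: "arr C f" "arr C g" "src C g = src C f" "tgt C g = tgt C f"
  have F: "endofunctor C F"
    "Fmor F \<in> module_hom R (Hom C (src C f) (tgt C f)) (Hom C (Fob F (src C f)) (Fob F (tgt C f)))"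
    using assms f(1) unfolding linear_endofunctor_def by auto
  have "f \<in> mor C (src C f) (tgt C f)" "g \<in> mor C (src C f) (tgt C f)"
    using f by (simp_all add: mor_iff)
  from module_hom_add[OF F(2) this] show "Fmor F (f \<boxplus> g) = Fmor F f \<boxplus> Fmor F g"
    using f F(1) by (simp add: Hom_add)
qed

text \<open>\<open>hom_zero\<close> says that a Hom-set is a singleton, and a full and faithful
  functor is bijective on Hom-sets.\<close>

lemma hom_zero_autoequivalence:
  assumes "autoequivalence C F" "X \<in> Obj C" "Y \<in> Obj C"
  shows "hom_zero (Fob F X) (Fob F Y) \<longleftrightarrow> hom_zero X Y"
proof
  note F = autoequivalenceD[OF assms(1)]
  assume h: "hom_zero (Fob F X) (Fob F Y)"
  show "hom_zero X Y"
  proof (rule hom_zeroI[OF assms(2,3)])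
    fix f assume f: "f \<Colon> X \<rightarrow> Y"
    have "Fmor F f = zero_mor C (Fob F X) (Fob F Y)"
      using f F(1) by (intro hom_zeroD[OF h]) simp
    also have "\<dots> = Fmor F (zero_mor C X Y)"
      by (rule hom_zeroD[OF h, symmetric]) (use assms(2,3) F(1) in simp)
    finally show "f = zero_mor C X Y"
      by (rule faithfulD[OF F(2)]) (use f in simp_all)
  qed
next
  note F = autoequivalenceD[OF assms(1)]
  assume h: "hom_zero X Y"
  obtain z where z: "z \<Colon> X \<rightarrow> Y" "Fmor F z = zero_mor C (Fob F X) (Fob F Y)"
    by (rule fullE[OF F(3), of "zero_mor C (Fob F X) (Fob F Y)" X Y]) (use F(1) assms in simp_all)
  show "hom_zero (Fob F X) (Fob F Y)"
  proof (rule hom_zeroI)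
    fix k assume "k \<Colon> Fob F X \<rightarrow> Fob F Y"
    then obtain f where f: "f \<Colon> X \<rightarrow> Y" "Fmor F f = k"
      using fullE[OF F(3)] assms(2,3) by blast
    show "k = zero_mor C (Fob F X) (Fob F Y)"
      using hom_zeroD[OF h z(1)] hom_zeroD[OF h f(1)] f(2) z(2) by simp
  qed (use assms F(1) in simp_all)
qed

text \<open>The quasi-inverse, determined only up to isomorphism, is moved to the other argument,
  where it becomes \<open>F\<close> itself. Negative shifts in orthogonality conditions are removed
  in this way.\<close>

lemma hom_zero_inverse_functor:
  assumes "autoequivalence C F" "X \<in> Obj C" "Y \<in> Obj C"
  shows "hom_zero (Fob (inverse_functor C F) X) Y \<longleftrightarrow> hom_zero X (Fob F Y)"
proof -
  note F = autoequivalenceD(1)[OF assms(1)] and G = autoequivalenceD(1)[OF autoequivalence_inverse[OF assms(1)]]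
  have "hom_zero (Fob (inverse_functor C F) X) Y
      \<longleftrightarrow> hom_zero (Fob F (Fob (inverse_functor C F) X)) (Fob F Y)"
    using hom_zero_autoequivalence[OF assms(1)] assms(2,3) G by simp
  also have "\<dots> \<longleftrightarrow> hom_zero X (Fob F Y)"
    using assms F G isomorphic_inverse_functor(2)[OF assms(1,2)]
    by (intro hom_zero_cong isomorphic_refl) simp_all
  finally show ?thesis .
qed

lemma funpow_Obj:
  assumes "endofunctor C F" "X \<in> Obj C"
  shows "(Fob F ^^ i) X \<in> Obj C"
  using assms by (induction i) simp_all

lemma hom_zero_inverse_funpow:
  assumes F: "autoequivalence C F" and "X \<in> Obj C" "Y \<in> Obj C"
  shows "hom_zero ((Fob (inverse_functor C F) ^^ i) X) Y \<longleftrightarrow> hom_zero X ((Fob F ^^ i) Y)"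
  using assms(2,3)
proof (induction i arbitrary: Y)
  case (Suc i)
  note F1 = autoequivalenceD(1)[OF F] and G1 = autoequivalenceD(1)[OF autoequivalence_inverse[OF F]]
  have "hom_zero ((Fob (inverse_functor C F) ^^ Suc i) X) Y
      \<longleftrightarrow> hom_zero ((Fob (inverse_functor C F) ^^ i) X) (Fob F Y)"
    using hom_zero_inverse_functor[OF F funpow_Obj[OF G1 Suc.prems(1)] Suc.prems(2)] by simp
  also have "\<dots> \<longleftrightarrow> hom_zero X ((Fob F ^^ i) (Fob F Y))"
    using Suc.prems F1 by (intro Suc.IH) simp_all
  finally show ?case by (simp add: funpow_swap1)
qed simp

section \<open>Integer powers and subcategories stable under an autoequivalence\<close>

lemma functor_power_nonneg: "functor_power C F (int j) = (comp_functor F ^^ j) id_functor"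
  unfolding functor_power_def by simp

lemma functor_power_minus:
  "functor_power C F (- int j) = (comp_functor (inverse_functor C F) ^^ j) id_functor"
  \<comment> \<open>For \<open>j = 0\<close> the definition takes its nonnegative branch; both
    branches then give the identity functor.\<close>
  unfolding functor_power_def by (cases "j = 0") simp_all

lemma autoequivalence_power:
  assumes "autoequivalence C F"
  shows "autoequivalence C (functor_power C F i)"
  unfolding functor_power_def
  using autoequivalence_funpow[OF assms] autoequivalence_funpow[OF autoequivalence_inverse[OF assms]]
  by simp

lemma additive_functor_power:
  assumes "autoequivalence C F" "additive_functor F"
  shows "additive_functor (functor_power C F i)"
  unfolding functor_power_def
  using additive_functor_funpow[OF assms]
    additive_functor_funpow[OF autoequivalence_inverse[OF assms(1)] additive_functor_inverse[OF assms]]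
  by simp

lemma isomorphic_power_minus:
  assumes "autoequivalence C F" "X \<in> Obj C"
  shows "isomorphic C (Fob (functor_power C F (int j)) (Fob (functor_power C F (- int j)) X)) X"
proof -
  define G where "G = inverse_functor C F"
  note F = autoequivalenceD(1)[OF assms(1)] and G = autoequivalenceD(1)[OF autoequivalence_inverse[OF assms(1)], folded G_def]
  have "isomorphic C ((Fob F ^^ j) ((Fob G ^^ j) X)) X"
  proof (induction j)
    case (Suc j)
    \<comment> \<open>The innermost pair of \<open>F\<close> and \<open>G\<close> is cancelled
      first; the isomorphism is then carried through the remaining \<open>j\<close> applications of
      \<open>F\<close>.\<close>
    have "isomorphic C (Fob F (Fob G ((Fob G ^^ j) X))) ((Fob G ^^ j) X)"
      unfolding G_def
      using assms(1) funpow_Obj[OF G assms(2)] unfolding G_def by (rule isomorphic_inverse_functor(2))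
    moreover have "isomorphic C ((Fob F ^^ j) V) ((Fob F ^^ j) W)"
      if "isomorphic C V W" "V \<in> Obj C" "W \<in> Obj C" for V W
      using that by (induction j) (simp_all add: functor_isomorphic[OF F] funpow_Obj[OF F])
    ultimately have "isomorphic C ((Fob F ^^ j) (Fob F (Fob G ((Fob G ^^ j) X)))) ((Fob F ^^ j) ((Fob G ^^ j) X))"
      using assms(2) F G by (simp add: funpow_Obj)
    then have "isomorphic C ((Fob F ^^ j) (Fob F (Fob G ((Fob G ^^ j) X)))) X"
      using isomorphic_trans[OF _ _ _ _ Suc.IH] assms(2) F G by (simp add: funpow_Obj)
    then show ?case by (simp add: funpow_swap1)
  qed (simp add: isomorphic_refl assms)
  then show ?thesis
    by (simp add: functor_power_minus functor_power_nonneg Fob_funpow G_def)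
qed

lemma subcategory_iso:
  "\<lbrakk>subcategory C B; X \<in> B; Y \<in> Obj C; isomorphic C X Y\<rbrakk> \<Longrightarrow> Y \<in> B"
  unfolding subcategory_def by blast

lemma subcategory_iso_iff:
  "\<lbrakk>subcategory C B; X \<in> Obj C; Y \<in> Obj C; isomorphic C X Y\<rbrakk> \<Longrightarrow> X \<in> B \<longleftrightarrow> Y \<in> B"
  using subcategory_iso isomorphic_sym by blast

text \<open>Closure under isomorphism absorbs the choice of the quasi-inverse, so both equalities of
  images reduce to a test on single objects. In this form stability is compared between
  \<open>T\<close> and \<open>U\<close>.\<close>

lemma stable_subcategory_iff:
  assumes F: "autoequivalence C F"
  shows "stable_subcategory C F B \<longleftrightarrow> subcategory C B \<and> (\<forall>X\<in>Obj C. X \<in> B \<longleftrightarrow> Fob F X \<in> B)"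
proof (cases "subcategory C B")
  case True
  define G where "G = inverse_functor C F"
  note F1 = autoequivalenceD(1)[OF F] and G1 = autoequivalenceD(1)[OF autoequivalence_inverse[OF F], folded G_def]
  have B: "B \<subseteq> Obj C" using True unfolding subcategory_def by blast
  have GF: "isomorphic C (Fob G (Fob F X)) X" and FG: "isomorphic C (Fob F (Fob G X)) X"
    if "X \<in> Obj C" for X
    using isomorphic_inverse_functor[OF F that] by (simp_all add: G_def)
  have "(\<forall>X\<in>Obj C. X \<in> B \<longleftrightarrow> Fob F X \<in> B)" if "B = ess_image C F B" "B = ess_image C G B"
  proof
    fix X assume X: "X \<in> Obj C"
    have "X \<in> B \<Longrightarrow> Fob F X \<in> B"
      using that(1) X F1 isomorphic_refl[of "Fob F X"] unfolding ess_image_def by auto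
    moreover have "Fob F X \<in> B \<Longrightarrow> X \<in> B"
      using that(2) X F1 G1 isomorphic_sym[OF _ _ GF[OF X]] unfolding ess_image_def by auto
    ultimately show "X \<in> B \<longleftrightarrow> Fob F X \<in> B" by blast
  qed
  moreover have "B = ess_image C F B \<and> B = ess_image C G B"
    if st: "\<forall>X\<in>Obj C. X \<in> B \<longleftrightarrow> Fob F X \<in> B"
  proof (intro conjI equalityI subsetI)
    fix X assume X: "X \<in> B"
    then have XO: "X \<in> Obj C" using B by blast
    have "Fob F (Fob G X) \<in> B"
      using subcategory_iso[OF True X _ isomorphic_sym[OF _ XO FG[OF XO]]] XO F1 G1 by simp
    then have "Fob G X \<in> B" using st XO G1 by simp
    then show "X \<in> ess_image C F B"
      using XO isomorphic_sym[OF _ XO FG[OF XO]] F1 G1 unfolding ess_image_def by auto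
  next
    fix X assume X: "X \<in> B"
    then have XO: "X \<in> Obj C" using B by blast
    have "Fob F X \<in> B" using X XO st by blast
    then show "X \<in> ess_image C G B"
      using XO isomorphic_sym[OF _ XO GF[OF XO]] F1 G1 unfolding ess_image_def by auto
  next
    fix X assume "X \<in> ess_image C F B"
    then obtain Y where Y: "X \<in> Obj C" "Y \<in> B" "isomorphic C X (Fob F Y)"
      unfolding ess_image_def by blast
    have YO: "Y \<in> Obj C" "Fob F Y \<in> Obj C" using Y B F1 by auto
    have "Fob F Y \<in> B" using st Y YO by blast
    then show "X \<in> B"
      using subcategory_iso[OF True _ Y(1) isomorphic_sym[OF Y(1) YO(2) Y(3)]] by blast
  next
    fix X assume "X \<in> ess_image C G B"
    then obtain Y where Y: "X \<in> Obj C" "Y \<in> B" "isomorphic C X (Fob G Y)"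
      unfolding ess_image_def by blast
    have YO: "Y \<in> Obj C" "Fob G Y \<in> Obj C" using Y B G1 by auto
    have "Fob F (Fob G Y) \<in> B"
      using subcategory_iso[OF True Y(2) _ isomorphic_sym[OF _ YO(1) FG[OF YO(1)]]] YO F1 by simp
    then have "Fob G Y \<in> B" using st YO by simp
    then show "X \<in> B"
      using subcategory_iso[OF True _ Y(1) isomorphic_sym[OF Y(1) YO(2) Y(3)]] by blast
  qed
  ultimately show ?thesis unfolding stable_subcategory_def G_def using True by blast
qed (simp add: stable_subcategory_def)

end

section \<open>Categories with shift: rigidity and orthogonality in terms of positive shifts\<close>

locale preadditive_shift_category = preadditive_category C
  for C :: "('k, 'o, 'm, 'z) shift_cat_scheme" (structure) +
  assumes Shift_auto: "autoequivalence C (Shift C)"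
begin

abbreviation shift_pow :: "nat \<Rightarrow> 'o \<Rightarrow> 'o" (\<open>\<Sigma>\<^bsup>_\<^esup>\<close> [0] 1000)
  where "\<Sigma>\<^bsup>i\<^esup> \<equiv> Fob (Shift C) ^^ i"

lemma Shift_functor [simp]: "endofunctor C (Shift C)"
  using Shift_auto by (rule autoequivalenceD)

lemma shift_pow_Obj [simp]: "X \<in> Obj C \<Longrightarrow> \<Sigma>\<^bsup>i\<^esup> X \<in> Obj C"
  by (rule funpow_Obj) simp_all

text \<open>An object of the essential image is isomorphic to some \<open>Fob F Y\<close>, and
  vanishing of Hom is invariant under isomorphism, so the strict images suffice for the
  test.\<close>

lemma hom_zero_ess_image:
  assumes "autoequivalence C F" "B \<subseteq> Obj C" "W \<in> Obj C"
  shows "hom_vanishes C (ess_image C F B) {W} \<longleftrightarrow> (\<forall>Y\<in>B. hom_zero (Fob F Y) W)"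
    "hom_vanishes C {W} (ess_image C F B) \<longleftrightarrow> (\<forall>Y\<in>B. hom_zero W (Fob F Y))"
proof -
  note F = autoequivalenceD(1)[OF assms(1)]
  have mem: "Fob F Y \<in> ess_image C F B" if "Y \<in> B" for Y
    unfolding ess_image_def using that assms(2) F isomorphic_refl[of "Fob F Y"]
    by (auto intro!: bexI[of _ Y])
  have iso: "\<exists>Y\<in>B. X \<in> Obj C \<and> Fob F Y \<in> Obj C \<and> isomorphic C (Fob F Y) X"
    if X: "X \<in> ess_image C F B" for X
  proof -
    obtain Y where Y: "Y \<in> B" "X \<in> Obj C" "isomorphic C X (Fob F Y)"
      using X unfolding ess_image_def by blast
    have "Fob F Y \<in> Obj C" using Y(1) assms(2) F by auto
    with Y isomorphic_sym show ?thesis by blast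
  qed
  show "hom_vanishes C (ess_image C F B) {W} \<longleftrightarrow> (\<forall>Y\<in>B. hom_zero (Fob F Y) W)"
    unfolding hom_vanishes_def hom_zero_def[symmetric]
    using mem iso hom_zero_iso[OF _ assms(3) _ assms(3) _ isomorphic_refl[OF assms(3)]] by blast
  show "hom_vanishes C {W} (ess_image C F B) \<longleftrightarrow> (\<forall>Y\<in>B. hom_zero W (Fob F Y))"
    unfolding hom_vanishes_def hom_zero_def[symmetric]
    using mem iso hom_zero_iso[OF assms(3) _ assms(3) _ isomorphic_refl[OF assms(3)]] by blast
qed

lemma Fob_shift: "Fob (shift C (int i)) = \<Sigma>\<^bsup>i\<^esup>"
  by (rule ext) (simp add: shift_def functor_power_nonneg Fob_funpow)

text \<open>\<open>(X[-i], W)\<close> and \<open>(X, W[i])\<close> vanish together, so the chosen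
  inverse of the shift disappears from the condition.\<close>

lemma n_right_perp_eq:
  assumes "B \<subseteq> Obj C"
  shows "n_right_perp C n B = {W \<in> Obj C. \<forall>i\<in>{1..<n}. \<forall>X\<in>B. hom_zero X (\<Sigma>\<^bsup>i\<^esup> W)}"
proof -
  have "W \<in> right_perp C (shifted C B (- int i)) \<longleftrightarrow> (\<forall>X\<in>B. hom_zero X (\<Sigma>\<^bsup>i\<^esup> W))"
    if W: "W \<in> Obj C" for W i
  proof -
    have "W \<in> right_perp C (shifted C B (- int i))
        \<longleftrightarrow> (\<forall>X\<in>B. hom_zero (Fob (shift C (- int i)) X) W)"
      unfolding right_perp_def shifted_def
      using W hom_zero_ess_image(1)[OF autoequivalence_power[OF Shift_auto] assms W]
      by (simp add: shift_def)
    also have "\<dots> \<longleftrightarrow> (\<forall>X\<in>B. hom_zero X (\<Sigma>\<^bsup>i\<^esup> W))"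
      unfolding shift_def functor_power_minus Fob_funpow
      using hom_zero_inverse_funpow[OF Shift_auto _ W] assms by blast
    finally show ?thesis .
  qed
  then show ?thesis unfolding n_right_perp_def by blast
qed

lemma n_left_perp_eq:
  assumes "B \<subseteq> Obj C"
  shows "n_left_perp C n B = {W \<in> Obj C. \<forall>i\<in>{1..<n}. \<forall>X\<in>B. hom_zero W (\<Sigma>\<^bsup>i\<^esup> X)}"
proof -
  have "W \<in> left_perp C (shifted C B (int i)) \<longleftrightarrow> (\<forall>X\<in>B. hom_zero W (\<Sigma>\<^bsup>i\<^esup> X))"
    if W: "W \<in> Obj C" for W i
    unfolding left_perp_def shifted_def
    using W hom_zero_ess_image(2)[OF autoequivalence_power[OF Shift_auto] assms W]
    by (simp add: shift_def flip: Fob_shift)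
  then show ?thesis unfolding n_left_perp_def by blast
qed

lemma n_rigid_iff:
  "n_rigid C n B \<longleftrightarrow> subcategory C B \<and> (\<forall>i\<in>{1..<n}. \<forall>X\<in>B. \<forall>Y\<in>B. hom_zero X (\<Sigma>\<^bsup>i\<^esup> Y))"
proof (cases "subcategory C B")
  case True
  then have B: "B \<subseteq> Obj C" unfolding subcategory_def by blast
  have "hom_vanishes C B (shifted C B (int i)) \<longleftrightarrow> (\<forall>X\<in>B. \<forall>Y\<in>B. hom_zero X (\<Sigma>\<^bsup>i\<^esup> Y))" for i
  proof -
    have "hom_vanishes C B (shifted C B (int i)) \<longleftrightarrow> (\<forall>X\<in>B. hom_vanishes C {X} (shifted C B (int i)))"
      unfolding hom_vanishes_def by blast
    also have "\<dots> \<longleftrightarrow> (\<forall>X\<in>B. \<forall>Y\<in>B. hom_zero X (\<Sigma>\<^bsup>i\<^esup> Y))"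
      unfolding shifted_def Fob_shift[symmetric] shift_def
      using hom_zero_ess_image(2)[OF autoequivalence_power[OF Shift_auto] B] B by blast
    finally show ?thesis .
  qed
  with True show ?thesis unfolding n_rigid_def by (auto simp: Suc_le_eq)
qed (simp add: n_rigid_def)

end

section \<open>Biproducts and ideals\<close>

lemma all_less_two: "(\<forall>j<Suc (Suc 0). P j) \<longleftrightarrow> P 0 \<and> P (Suc 0)"
  by (auto simp: less_Suc_eq)

context preadditive_category
begin

lemma finsum_pair:
  assumes "h 0 \<Colon> S \<rightarrow> S" "h (Suc 0) \<Colon> S \<rightarrow> S"
  shows "(\<Oplus>\<^bsub>Hom C S S\<^esub>j\<in>{..<Suc (Suc 0)}. h j) = h 0 \<boxplus> h (Suc 0)"
proof -
  interpret abelian_group "Hom C S S" using assms by (simp add: Hom_abelian_group)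
  have "h 0 \<in> mor C S S" "h (Suc 0) \<in> mor C S S" using assms by (simp_all add: mor_iff)
  then have "(\<Oplus>\<^bsub>Hom C S S\<^esub>j\<in>{..<Suc (Suc 0)}. h j) = h (Suc 0) \<oplus>\<^bsub>Hom C S S\<^esub> h 0"
    by (simp add: lessThan_Suc finsum_insert)
  then show ?thesis using assms add_commute[of "h 0" "h (Suc 0)"] by (simp add: Hom_add)
qed

lemma direct_sum_pair_iff:
  assumes "X \<in> Obj C" "Y \<in> Obj C" "S \<in> Obj C"
  shows "direct_sum C [X, Y] S \<longleftrightarrow> (\<exists>i j p q.
    i \<Colon> X \<rightarrow> S \<and> j \<Colon> Y \<rightarrow> S \<and> p \<Colon> S \<rightarrow> X \<and> q \<Colon> S \<rightarrow> Y \<and>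
    p \<cdot> i = ident C X \<and> q \<cdot> j = ident C Y \<and> p \<cdot> j = zero_mor C Y X \<and> q \<cdot> i = zero_mor C X Y \<and>
    i \<cdot> p \<boxplus> j \<cdot> q = ident C S)"
proof
  assume "direct_sum C [X, Y] S"
  then obtain \<iota> \<pi> where i:
    "\<iota> 0 \<in> mor C X S" "\<pi> 0 \<in> mor C S X" "\<iota> (Suc 0) \<in> mor C Y S" "\<pi> (Suc 0) \<in> mor C S Y"
    "\<pi> 0 \<cdot> \<iota> 0 = ident C X" "\<pi> (Suc 0) \<cdot> \<iota> (Suc 0) = ident C Y"
    "\<pi> 0 \<cdot> \<iota> (Suc 0) = zero_mor C Y X" "\<pi> (Suc 0) \<cdot> \<iota> 0 = zero_mor C X Y"
    "(\<Oplus>\<^bsub>Hom C S S\<^esub>j\<in>{..<Suc (Suc 0)}. \<iota> j \<cdot> \<pi> j) = ident C S"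
    unfolding direct_sum_def by (auto simp: all_less_two simp del: lessThan_Suc)
  have t: "\<iota> 0 \<Colon> X \<rightarrow> S" "\<iota> (Suc 0) \<Colon> Y \<rightarrow> S" "\<pi> 0 \<Colon> S \<rightarrow> X" "\<pi> (Suc 0) \<Colon> S \<rightarrow> Y"
    using i(1-4) assms by (simp_all add: mor_iff)
  have "\<iota> 0 \<cdot> \<pi> 0 \<boxplus> \<iota> (Suc 0) \<cdot> \<pi> (Suc 0) = ident C S"
    using i(9) finsum_pair[of "\<lambda>j. \<iota> j \<cdot> \<pi> j"] t by simp
  with t i(5-8) show "\<exists>i j p q.
    i \<Colon> X \<rightarrow> S \<and> j \<Colon> Y \<rightarrow> S \<and> p \<Colon> S \<rightarrow> X \<and> q \<Colon> S \<rightarrow> Y \<and>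
    p \<cdot> i = ident C X \<and> q \<cdot> j = ident C Y \<and> p \<cdot> j = zero_mor C Y X \<and> q \<cdot> i = zero_mor C X Y \<and>
    i \<cdot> p \<boxplus> j \<cdot> q = ident C S"
    by blast
next
  assume "\<exists>i j p q.
    i \<Colon> X \<rightarrow> S \<and> j \<Colon> Y \<rightarrow> S \<and> p \<Colon> S \<rightarrow> X \<and> q \<Colon> S \<rightarrow> Y \<and>
    p \<cdot> i = ident C X \<and> q \<cdot> j = ident C Y \<and> p \<cdot> j = zero_mor C Y X \<and> q \<cdot> i = zero_mor C X Y \<and>
    i \<cdot> p \<boxplus> j \<cdot> q = ident C S"
  then obtain i j p q where t: "i \<Colon> X \<rightarrow> S" "j \<Colon> Y \<rightarrow> S" "p \<Colon> S \<rightarrow> X" "q \<Colon> S \<rightarrow> Y"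
    and e: "p \<cdot> i = ident C X" "q \<cdot> j = ident C Y" "p \<cdot> j = zero_mor C Y X" "q \<cdot> i = zero_mor C X Y"
    and s: "i \<cdot> p \<boxplus> j \<cdot> q = ident C S"
    by blast
  define \<iota> \<pi> where "\<iota> = (\<lambda>l::nat. if l = 0 then i else j)" and "\<pi> = (\<lambda>l::nat. if l = 0 then p else q)"
  have "(\<Oplus>\<^bsub>Hom C S S\<^esub>l\<in>{..<Suc (Suc 0)}. \<iota> l \<cdot> \<pi> l) = ident C S"
    using finsum_pair[of "\<lambda>l. \<iota> l \<cdot> \<pi> l" S] t s by (simp add: \<iota>_def \<pi>_def)
  then show "direct_sum C [X, Y] S"
    unfolding direct_sum_def using t e assms
    by (intro conjI exI[of _ \<iota>] exI[of _ \<pi>])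
      (simp_all add: all_less_two mor_iff \<iota>_def \<pi>_def del: lessThan_Suc)
qed

lemma direct_sum_Nil_iff:
  "S \<in> Obj C \<Longrightarrow> direct_sum C [] S \<longleftrightarrow> ident C S = zero_mor C S S"
proof -
  assume S: "S \<in> Obj C"
  then interpret abelian_group "Hom C S S" by (simp add: Hom_abelian_group)
  show ?thesis using S by (auto simp: direct_sum_def)
qed

lemma ident_zero_imp_zero_object:
  assumes "N \<in> Obj C" "ident C N = zero_mor C N N"
  shows "zero_object C N"
proof -
  have "hom_zero N X" "hom_zero X N" if X: "X \<in> Obj C" for X
  proof -
    show "hom_zero N X"
    proof (rule hom_zeroI[OF assms(1) X])
      fix f assume f: "f \<Colon> N \<rightarrow> X"
      have "f = f \<cdot> ident C N" using f by simp
      also have "\<dots> = zero_mor C N X" unfolding assms(2) using f by simp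
      finally show "f = zero_mor C N X" .
    qed
    show "hom_zero X N"
    proof (rule hom_zeroI[OF X assms(1)])
      fix f assume f: "f \<Colon> X \<rightarrow> N"
      have "f = ident C N \<cdot> f" using f by simp
      also have "\<dots> = zero_mor C X N" unfolding assms(2) using f by simp
      finally show "f = zero_mor C X N" .
    qed
  qed
  then show ?thesis using assms(1) unfolding zero_object_def hom_zero_def by blast
qed

text \<open>A zero object is the direct sum of the empty list, so closure under direct sums already
  puts it into \<open>B\<close>.\<close>

lemma subcategory_zero:
  assumes "subcategory C B" "N \<in> Obj C" "ident C N = zero_mor C N N"
  shows "N \<in> B"
  using assms direct_sum_Nil_iff[OF assms(2)] unfolding subcategory_def by fastforce

lemma subcategory_sum:
  "\<lbrakk>subcategory C B; direct_sum C [X, Y] S\<rbrakk> \<Longrightarrow> S \<in> B \<longleftrightarrow> X \<in> B \<and> Y \<in> B"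
  unfolding subcategory_def by (metis empty_set insert_subset list.simps(15) empty_subsetI)

text \<open>Membership in the ideal \<open>[B]\<close> with both ends read off the morphism, to
  match the index-free addition. \<open>factors_through_iff\<close> ties it to the set of factoring
  morphisms used in the definition of the quotient.\<close>

definition factors :: "'o set \<Rightarrow> 'm \<Rightarrow> bool"
  where "factors B f \<longleftrightarrow> (\<exists>W u v. W \<in> B \<and> u \<Colon> src C f \<rightarrow> W \<and> v \<Colon> W \<rightarrow> tgt C f \<and> f = v \<cdot> u)"

lemma factorsI:
  "\<lbrakk>W \<in> B; u \<Colon> X \<rightarrow> W; v \<Colon> W \<rightarrow> Y; v \<cdot> u = f\<rbrakk> \<Longrightarrow> factors B f"
  unfolding factors_def by (rule exI[of _ W], rule exI[of _ u], rule exI[of _ v]) auto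

lemma factorsE:
  assumes "factors B f" "f \<Colon> X \<rightarrow> Y"
  obtains W u v where "W \<in> B" "W \<in> Obj C" "u \<Colon> X \<rightarrow> W" "v \<Colon> W \<rightarrow> Y" "v \<cdot> u = f"
proof -
  obtain W u v where w: "W \<in> B" "u \<Colon> src C f \<rightarrow> W" "v \<Colon> W \<rightarrow> tgt C f" "f = v \<cdot> u"
    using assms(1) unfolding factors_def by blast
  have "src C f = X" "tgt C f = Y" "W \<in> Obj C" using assms(2) w(2) by simp_all
  with w show ?thesis by (intro that[of W u v]) (simp_all del: arrow_iff)
qed

lemma factors_arr: "factors B f \<Longrightarrow> arr C f"
  unfolding factors_def
proof (elim exE conjE)
  fix W u v assume w: "u \<Colon> src C f \<rightarrow> W" "v \<Colon> W \<rightarrow> tgt C f" "f = v \<cdot> u"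
  have "arr C (v \<cdot> u)" using cmp_arrow[OF w(1,2)] unfolding arrow_iff by blast
  then show "arr C f" by (simp only: w(3))
qed

lemma factors_through_iff:
  assumes "X \<in> Obj C" "Y \<in> Obj C" "B \<subseteq> Obj C"
  shows "f \<in> factors_through C B X Y \<longleftrightarrow> f \<Colon> X \<rightarrow> Y \<and> factors B f"
proof
  assume "f \<in> factors_through C B X Y"
  then obtain W u v where w: "W \<in> B" "u \<in> mor C X W" "v \<in> mor C W Y" "v \<cdot> u = f"
    unfolding factors_through_def by blast
  have "W \<in> Obj C" using w(1) assms(3) by blast
  then have uv: "u \<Colon> X \<rightarrow> W" "v \<Colon> W \<rightarrow> Y" using w(2,3) assms by (simp_all only: arrow_def)
  show "f \<Colon> X \<rightarrow> Y \<and> factors B f"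
    using factorsI[OF w(1) uv w(4)] uv w(4)[symmetric] by simp
next
  assume "f \<Colon> X \<rightarrow> Y \<and> factors B f"
  then obtain W u v where w: "W \<in> B" "u \<Colon> X \<rightarrow> W" "v \<Colon> W \<rightarrow> Y" "v \<cdot> u = f"
    by (elim conjE) (rule factorsE)
  then have "u \<in> mor C X W" "v \<in> mor C W Y" by (simp_all only: arrow_def)
  with w(1) w(4)[symmetric] show "f \<in> factors_through C B X Y" unfolding factors_through_def by blast
qed

lemma factors_cmp_left:
  assumes "factors B f" "arr C g" "src C g = tgt C f"
  shows "factors B (g \<cdot> f)"
proof -
  note f = arr_arrow[OF factors_arr[OF assms(1)]]
  obtain W u v where w: "W \<in> B" "W \<in> Obj C" "u \<Colon> src C f \<rightarrow> W" "v \<Colon> W \<rightarrow> tgt C f" "v \<cdot> u = f"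
    by (rule factorsE[OF assms(1) f])
  show ?thesis
    by (rule factorsI[OF w(1,3), of "g \<cdot> v" "tgt C g"]) (use w(3-5) assms(2,3) in simp_all)
qed

lemma factors_cmp_right:
  assumes "factors B f" "arr C g" "tgt C g = src C f"
  shows "factors B (f \<cdot> g)"
proof -
  note f = arr_arrow[OF factors_arr[OF assms(1)]]
  obtain W u v where w: "W \<in> B" "W \<in> Obj C" "u \<Colon> src C f \<rightarrow> W" "v \<Colon> W \<rightarrow> tgt C f" "v \<cdot> u = f"
    by (rule factorsE[OF assms(1) f])
  show ?thesis
    by (rule factorsI[OF w(1) _ w(4), of "u \<cdot> g" "src C g"])
      (use w(3,4) assms(2,3) in \<open>simp_all add: cmp_reassoc[OF w(5)]\<close>)
qed

lemma factors_neg: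
  assumes "factors B f"
  shows "factors B (\<boxminus> f)"
proof -
  note f = arr_arrow[OF factors_arr[OF assms(1)]]
  obtain W u v where w: "W \<in> B" "W \<in> Obj C" "u \<Colon> src C f \<rightarrow> W" "v \<Colon> W \<rightarrow> tgt C f" "v \<cdot> u = f"
    by (rule factorsE[OF assms(1) f])
  show ?thesis
    by (rule factorsI[OF w(1,3), of "\<boxminus> v" "tgt C f"]) (use w(3-5) f in simp_all)
qed

lemma factors_ident: "\<lbrakk>W \<in> B; W \<in> Obj C\<rbrakk> \<Longrightarrow> factors B (ident C W)"
  by (rule factorsI[of W _ "ident C W" W "ident C W" W]) simp_all

lemma factors_mono: "\<lbrakk>factors B f; B \<subseteq> B'\<rbrakk> \<Longrightarrow> factors B' f"
  unfolding factors_def by blast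

end

section \<open>Triangulated categories\<close>

lemma (in linear_category) preadditive: "preadditive_category C"
proof (rule preadditive_category.intro)
  fix X Y assume "X \<in> Obj C" "Y \<in> Obj C"
  then have "module K (Hom C X Y)" using Hom_vectorspace unfolding vectorspace_def by blast
  then show "abelian_group (Hom C X Y)" unfolding module_def by blast
next
  fix f X Y X' Y' assume "f \<Colon>\<^bsub>C\<^esub> X \<rightarrow> Y" "f \<Colon>\<^bsub>C\<^esub> X' \<rightarrow> Y'"
  then show "X = X' \<and> Y = Y'" unfolding arrow_def using Hom_disjoint by blast
next
  fix X assume "X \<in> Obj C"
  then show "ident C X \<Colon>\<^bsub>C\<^esub> X \<rightarrow> X" unfolding arrow_def using ident_mor by blast
next
  fix f g X Y Z assume "f \<Colon>\<^bsub>C\<^esub> X \<rightarrow> Y" "g \<Colon>\<^bsub>C\<^esub> Y \<rightarrow> Z"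
  then show "g \<cdot>\<^bsub>C\<^esub> f \<Colon>\<^bsub>C\<^esub> X \<rightarrow> Z" unfolding arrow_def using cmp_mor by blast
next
  fix f X Y assume "f \<Colon>\<^bsub>C\<^esub> X \<rightarrow> Y"
  then show "f \<cdot>\<^bsub>C\<^esub> ident C X = f \<and> ident C Y \<cdot>\<^bsub>C\<^esub> f = f" unfolding arrow_def using cmp_ident by blast
next
  fix f g h W X Y Z assume "f \<Colon>\<^bsub>C\<^esub> W \<rightarrow> X" "g \<Colon>\<^bsub>C\<^esub> X \<rightarrow> Y" "h \<Colon>\<^bsub>C\<^esub> Y \<rightarrow> Z"
  then show "(h \<cdot>\<^bsub>C\<^esub> g) \<cdot>\<^bsub>C\<^esub> f = h \<cdot>\<^bsub>C\<^esub> (g \<cdot>\<^bsub>C\<^esub> f)" unfolding arrow_def using cmp_assoc by blast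
next
  fix f g g' X Y Z assume "f \<Colon>\<^bsub>C\<^esub> X \<rightarrow> Y" "g \<Colon>\<^bsub>C\<^esub> Y \<rightarrow> Z" "g' \<Colon>\<^bsub>C\<^esub> Y \<rightarrow> Z"
  then show "(g \<oplus>\<^bsub>Hom C Y Z\<^esub> g') \<cdot>\<^bsub>C\<^esub> f = g \<cdot>\<^bsub>C\<^esub> f \<oplus>\<^bsub>Hom C X Z\<^esub> g' \<cdot>\<^bsub>C\<^esub> f"
    unfolding arrow_def using module_hom_add[OF cmp_linear_left] by blast
next
  fix f f' g X Y Z assume "f \<Colon>\<^bsub>C\<^esub> X \<rightarrow> Y" "f' \<Colon>\<^bsub>C\<^esub> X \<rightarrow> Y" "g \<Colon>\<^bsub>C\<^esub> Y \<rightarrow> Z"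
  then show "g \<cdot>\<^bsub>C\<^esub> (f \<oplus>\<^bsub>Hom C X Y\<^esub> f') = g \<cdot>\<^bsub>C\<^esub> f \<oplus>\<^bsub>Hom C X Z\<^esub> g \<cdot>\<^bsub>C\<^esub> f'"
    unfolding arrow_def using module_hom_add[OF cmp_linear_right] by blast
qed

text \<open>The given locale with its category declared as a structure, so that index-free notation
  refers to \<open>T\<close>.\<close>

locale triangulated = triangulated_category K T
  for K :: "'k ring" and T :: "('k, 'o, 'm, 'z) tri_cat_scheme" (structure)

sublocale triangulated \<subseteq> preadditive_shift_category T
  using preadditive Shift_autoequivalence
  by (simp add: preadditive_shift_category_def preadditive_shift_category_axioms_def)

context triangulated
begin

lemma Shift_additive [simp]: "additive_functor (Shift T)"
  using Shift_linear by (rule linear_endofunctor_additive)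

abbreviation sh :: "'o \<Rightarrow> 'o" (\<open>\<Sigma>\<close>)
  where "\<Sigma> \<equiv> Fob (Shift T)"

abbreviation shm :: "'m \<Rightarrow> 'm" (\<open>\<sigma>\<close>)
  where "\<sigma> \<equiv> Fmor (Shift T)"

lemma shift_fullE:
  assumes "h \<Colon> \<Sigma> X \<rightarrow> \<Sigma> Y" "X \<in> Obj T" "Y \<in> Obj T"
  obtains f where "f \<Colon> X \<rightarrow> Y" "\<sigma> f = h"
  using fullE[OF autoequivalenceD(3)[OF Shift_auto] assms] .

lemma shift_faithful:
  "\<lbrakk>\<sigma> f = \<sigma> g; arr T f; arr T g; src T g = src T f; tgt T g = tgt T f\<rbrakk> \<Longrightarrow> f = g"
  using faithfulD[OF autoequivalenceD(2)[OF Shift_auto]] .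

lemma sextuple_in_iff:
  "sextuple_in T (X, Y, Z, a, b, c) \<longleftrightarrow> a \<Colon> X \<rightarrow> Y \<and> b \<Colon> Y \<rightarrow> Z \<and> c \<Colon> Z \<rightarrow> \<Sigma> X"
  unfolding sextuple_in.simps by (metis Shift_functor arrow_def functor_Obj)

lemma tri_arrow:
  assumes "(X, Y, Z, a, b, c) \<in> Tri T"
  shows "a \<Colon> X \<rightarrow> Y" "b \<Colon> Y \<rightarrow> Z" "c \<Colon> Z \<rightarrow> \<Sigma> X"
  using Tri_sextuple[OF assms] unfolding sextuple_in_iff by blast+

lemma tri_rotate_iff:
  assumes "a \<Colon> X \<rightarrow> Y" "b \<Colon> Y \<rightarrow> Z" "c \<Colon> Z \<rightarrow> \<Sigma> X"
  shows "(X, Y, Z, a, b, c) \<in> Tri T \<longleftrightarrow> (Y, Z, \<Sigma> X, b, c, \<boxminus> \<sigma> a) \<in> Tri T"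
  using Tri_rotate[of X Y Z a b c] assms by (simp add: Hom_neg mor_iff)

lemma tri_rotate:
  "(X, Y, Z, a, b, c) \<in> Tri T \<Longrightarrow> (Y, Z, \<Sigma> X, b, c, \<boxminus> \<sigma> a) \<in> Tri T"
  using tri_rotate_iff[OF tri_arrow] by blast

lemma tri_complete:
  assumes "(X, Y, Z, a, b, c) \<in> Tri T" "(X', Y', Z', a', b', c') \<in> Tri T"
    "u \<Colon> X \<rightarrow> X'" "v \<Colon> Y \<rightarrow> Y'" "v \<cdot> a = a' \<cdot> u"
  obtains w where "w \<Colon> Z \<rightarrow> Z'" "w \<cdot> b = b' \<cdot> v" "\<sigma> u \<cdot> c = c' \<cdot> w"
proof -
  have Z: "Z \<in> Obj T" "Z' \<in> Obj T"
    using tri_arrow[OF assms(1)] tri_arrow[OF assms(2)] by simp_all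
  have "u \<in> mor T X X'" "v \<in> mor T Y Y'" using assms(3,4) by (simp_all only: arrow_def)
  from Tri_complete[OF assms(1,2) this assms(5)] obtain w where
    "w \<in> mor T Z Z'" "w \<cdot> b = b' \<cdot> v" "\<sigma> u \<cdot> c = c' \<cdot> w"
    by auto
  with Z show ?thesis by (intro that[of w]) (simp_all add: mor_iff)
qed

lemma zero_object_exists:
  obtains N where "zero_object T N" "N \<in> Obj T"
proof -
  obtain N where N: "direct_sum T [] N" using additive unfolding additive_def by fastforce
  then have "N \<in> Obj T" unfolding direct_sum_def by blast
  with N that ident_zero_imp_zero_object direct_sum_Nil_iff show ?thesis by blast
qed

lemma binary_sum_exists:
  assumes "X \<in> Obj T" "Y \<in> Obj T"
  obtains S i j p q where "direct_sum T [X, Y] S" "S \<in> Obj T"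
    "i \<Colon> X \<rightarrow> S" "j \<Colon> Y \<rightarrow> S" "p \<Colon> S \<rightarrow> X" "q \<Colon> S \<rightarrow> Y"
    "p \<cdot> i = ident T X" "q \<cdot> j = ident T Y" "p \<cdot> j = zero_mor T Y X" "q \<cdot> i = zero_mor T X Y"
    "i \<cdot> p \<boxplus> j \<cdot> q = ident T S"
proof -
  obtain S where S: "direct_sum T [X, Y] S"
    using additive assms unfolding additive_def by (metis empty_set insert_subset list.simps(15) empty_subsetI)
  then have SO: "S \<in> Obj T" unfolding direct_sum_def by blast
  show ?thesis using S[unfolded direct_sum_pair_iff[OF assms SO]] that[OF S SO] by blast
qed

text \<open>Complete the square from the identity triangle on \<open>X\<close> to the given one. The
  third component starts at a zero object, and \<open>b \<cdot> a\<close> passes through it.\<close>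

lemma tri_cmp_zero:
  assumes "(X, Y, Z, a, b, c) \<in> Tri T"
  shows "b \<cdot> a = zero_mor T X Z"
proof -
  note t = tri_arrow[OF assms]
  obtain N where N: "zero_object T N" "N \<in> Obj T" by (rule zero_object_exists)
  have X: "X \<in> Obj T" using t by simp
  have u: "ident T X \<Colon> X \<rightarrow> X" "a \<cdot> ident T X = a \<cdot> ident T X" using X by simp_all
  obtain w where w: "w \<Colon> N \<rightarrow> Z" "w \<cdot> zero_mor T X N = b \<cdot> a"
    by (rule tri_complete[OF Tri_ident[OF X N(1)] assms u(1) t(1) u(2)])
  with X show ?thesis by simp
qed

text \<open>Exactness of the functor \<open>(V, -)\<close> at \<open>Y\<close>. The rotated identity
  triangle of \<open>V\<close> is mapped to the rotated given triangle; the third component is the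
  shift of the lift, and the two rotation signs cancel.\<close>

lemma tri_lift:
  assumes "(X, Y, Z, a, b, c) \<in> Tri T" "g \<Colon> V \<rightarrow> Y" "b \<cdot> g = zero_mor T V Z"
  obtains h where "h \<Colon> V \<rightarrow> X" "g = a \<cdot> h"
proof -
  note t = tri_arrow[OF assms(1)]
  obtain N where N: "zero_object T N" "N \<in> Obj T" by (rule zero_object_exists)
  have V: "V \<in> Obj T" using assms by simp
  have X: "X \<in> Obj T" using t by simp
  have u: "zero_mor T N Z \<Colon> N \<rightarrow> Z" "zero_mor T N Z \<cdot> zero_mor T V N = b \<cdot> g"
    using t assms(2,3) N V by simp_all
  obtain w where w: "w \<Colon> \<Sigma> V \<rightarrow> \<Sigma> X" "\<sigma> g \<cdot> \<boxminus> \<sigma> (ident T V) = \<boxminus> \<sigma> a \<cdot> w"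
    by (rule tri_complete[OF tri_rotate[OF Tri_ident[OF V N(1)]] tri_rotate[OF assms(1)] assms(2) u])
  obtain h where h: "h \<Colon> V \<rightarrow> X" "\<sigma> h = w"
    by (rule shift_fullE[OF w(1) V X])
  have "\<boxminus> \<sigma> g = \<boxminus> (\<sigma> a \<cdot> w)" using w t assms(2) by simp
  then have "\<boxminus> \<boxminus> \<sigma> g = \<boxminus> \<boxminus> (\<sigma> a \<cdot> w)" by simp
  then have "\<sigma> g = \<sigma> (a \<cdot> h)" using w t assms(2) h by simp
  then have "g = a \<cdot> h" by (rule shift_faithful) (use assms(2) t h in simp_all)
  with h show ?thesis by (intro that)
qed

lemma tri_extend:
  assumes "(X, Y, Z, a, b, c) \<in> Tri T" "g \<Colon> Y \<rightarrow> V" "g \<cdot> a = zero_mor T X V"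
  obtains h where "h \<Colon> Z \<rightarrow> V" "g = h \<cdot> b"
proof -
  note t = tri_arrow[OF assms(1)]
  obtain N where N: "zero_object T N" "N \<in> Obj T" by (rule zero_object_exists)
  have V: "V \<in> Obj T" using assms by simp
  have iN: "ident T N = zero_mor T N N"
    using N by (intro hom_zeroD[of N N]) (simp_all add: zero_object_def hom_zero_def)
  \<comment> \<open>The triangle on \<open>N -> V -> V\<close> arises by rotating the identity
    triangle of \<open>V\<close> backwards. Its third vertex must then be the shift of
    \<open>N\<close>, which has to be a zero object too.\<close>
  have "zero_object T (\<Sigma> N)"
  proof (rule ident_zero_imp_zero_object)
    show "ident T (\<Sigma> N) = zero_mor T (\<Sigma> N) (\<Sigma> N)"
      using arg_cong[OF iN, of \<sigma>] N by simp
  qed (use N in simp)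
  then have "(V, V, \<Sigma> N, ident T V, zero_mor T V (\<Sigma> N), zero_mor T (\<Sigma> N) (\<Sigma> V)) \<in> Tri T"
    by (rule Tri_ident[OF V])
  then have "(N, V, V, zero_mor T N V, ident T V, zero_mor T V (\<Sigma> N)) \<in> Tri T"
    using N V by (subst tri_rotate_iff) simp_all
  note tN = this
  have u: "zero_mor T X N \<Colon> X \<rightarrow> N" "g \<cdot> a = zero_mor T N V \<cdot> zero_mor T X N"
    using t assms(2,3) N V by simp_all
  obtain w where "w \<Colon> Z \<rightarrow> V" "w \<cdot> b = ident T V \<cdot> g"
    by (rule tri_complete[OF assms(1) tN u(1) assms(2) u(2)])
  then show ?thesis using assms(2) by (intro that[of w]) simp_all
qed

text \<open>Rotations of \<open>tri_lift\<close> and \<open>tri_extend\<close> give exactness of the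
  long Hom sequences at their remaining positions.\<close>

lemma tri_lift2:
  assumes "(X, Y, Z, a, b, c) \<in> Tri T" "g \<Colon> V \<rightarrow> Z" "c \<cdot> g = zero_mor T V (\<Sigma> X)"
  obtains h where "h \<Colon> V \<rightarrow> Y" "g = b \<cdot> h"
  using tri_lift[OF tri_rotate[OF assms(1)] assms(2,3)] .

lemma tri_lift3:
  assumes "(X, Y, Z, a, b, c) \<in> Tri T" "g \<Colon> V \<rightarrow> \<Sigma> X" "\<sigma> a \<cdot> g = zero_mor T V (\<Sigma> Y)"
  obtains h where "h \<Colon> V \<rightarrow> Z" "g = c \<cdot> h"
proof (rule tri_lift2[OF tri_rotate[OF assms(1)] assms(2)])
  show "\<boxminus> \<sigma> a \<cdot> g = zero_mor T V (\<Sigma> Y)"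
    using assms(2,3) tri_arrow[OF assms(1)] by simp
qed (rule that)

lemma tri_extend2:
  assumes "(X, Y, Z, a, b, c) \<in> Tri T" "g \<Colon> Z \<rightarrow> V" "g \<cdot> b = zero_mor T Y V"
  obtains h where "h \<Colon> \<Sigma> X \<rightarrow> V" "g = h \<cdot> c"
  using tri_extend[OF tri_rotate[OF assms(1)] assms(2,3)] .

lemma tri_extend3:
  assumes "(X, Y, Z, a, b, c) \<in> Tri T" "g \<Colon> \<Sigma> X \<rightarrow> V" "g \<cdot> c = zero_mor T Z V"
  obtains h where "h \<Colon> \<Sigma> Y \<rightarrow> V" "g = h \<cdot> \<sigma> a"
proof (rule tri_extend2[OF tri_rotate[OF assms(1)] assms(2,3)])
  fix h assume h: "h \<Colon> \<Sigma> Y \<rightarrow> V" "g = h \<cdot> \<boxminus> \<sigma> a"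
  show ?thesis
    by (rule that[of "\<boxminus> h"]) (use h tri_arrow[OF assms(1)] in simp_all)
qed

lemma tri_cmp_zero2: "(X, Y, Z, a, b, c) \<in> Tri T \<Longrightarrow> c \<cdot> b = zero_mor T Y (\<Sigma> X)"
  using tri_cmp_zero[OF tri_rotate] .

lemma tri_cmp_zero3:
  assumes "(X, Y, Z, a, b, c) \<in> Tri T"
  shows "\<sigma> a \<cdot> c = zero_mor T Z (\<Sigma> Y)"
proof -
  have "\<boxminus> (\<sigma> a \<cdot> c) = zero_mor T Z (\<Sigma> Y)"
    using tri_cmp_zero2[OF tri_rotate[OF assms]] tri_arrow[OF assms] by simp
  then have "\<boxminus> \<boxminus> (\<sigma> a \<cdot> c) = \<boxminus> zero_mor T Z (\<Sigma> Y)" by simp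
  then show ?thesis using tri_arrow[OF assms] by simp
qed

text \<open>The cone of \<open>b\<close> is only isomorphic to a shift. The triangle is transported
  along that isomorphism and then rotated backwards.\<close>

lemma tri_cocone:
  assumes "b \<Colon> Y \<rightarrow> Z"
  obtains X a c where "(X, Y, Z, a, b, c) \<in> Tri T"
proof -
  have b: "Y \<in> Obj T" "Z \<in> Obj T" "b \<in> mor T Y Z" using assms by (simp_all only: arrow_def)
  obtain W c' e where t: "(Y, Z, W, b, c', e) \<in> Tri T" using Tri_cone[OF b] by blast
  note ta = tri_arrow[OF t]
  obtain X where X: "X \<in> Obj T" "isomorphic T (\<Sigma> X) W"
    using autoequivalenceD(4)[OF Shift_auto] ta unfolding ess_surj_def by fastforce
  have XO: "\<Sigma> X \<in> Obj T" "W \<in> Obj T" using X ta by simp_all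
  obtain f g where f: "f \<Colon> \<Sigma> X \<rightarrow> W" "g \<Colon> W \<rightarrow> \<Sigma> X" "g \<cdot> f = ident T (\<Sigma> X)" "f \<cdot> g = ident T W"
    by (rule isomorphicE[OF X(2) XO])
  \<comment> \<open>The sign anticipates the one that rotation will introduce.\<close>
  have ef: "\<boxminus> (e \<cdot> f) \<Colon> \<Sigma> X \<rightarrow> \<Sigma> Y" using ta f by simp
  obtain a where a: "a \<Colon> X \<rightarrow> Y" "\<sigma> a = \<boxminus> (e \<cdot> f)"
    by (rule shift_fullE[OF ef X(1) b(1)])
  have isog: "iso_mor T W (\<Sigma> X) g" using f unfolding iso_mor_iff[OF XO(2,1)] by blast
  have isoid: "iso_mor T V V (ident T V)" if "V \<in> Obj T" for V
    unfolding iso_mor_iff[OF that that] using that by (intro conjI exI[of _ "ident T V"]) simp_all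
  have "(Y, Z, \<Sigma> X, b, g \<cdot> c', e \<cdot> f) \<in> Tri T"
  proof (rule Tri_iso[OF t])
    show "sextuple_in T (Y, Z, \<Sigma> X, b, g \<cdot> c', e \<cdot> f)"
      unfolding sextuple_in_iff using f ta by simp
    show "sextuple_iso T (Y, Z, W, b, c', e) (Y, Z, \<Sigma> X, b, g \<cdot> c', e \<cdot> f)"
      unfolding sextuple_iso.simps sextuple_mor.simps
      by (rule exI[of _ "ident T Y"], rule exI[of _ "ident T Z"], rule exI[of _ g])
        (use isog isoid b f ta in \<open>simp add: mor_iff cmp_reassoc[OF f(4)]\<close>)
  qed
  moreover have "e \<cdot> f = \<boxminus> \<sigma> a" using a(2) ta f by simp
  ultimately have "(X, Y, Z, a, b, g \<cdot> c') \<in> Tri T"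
    using a(1) assms f ta by (subst tri_rotate_iff) simp_all
  then show ?thesis by (rule that)
qed

text \<open>Closure under summands is formulated with direct sums, so a retract needs a complement.
  For a split monomorphism \<open>f\<close> the connecting morphism \<open>c\<close> of its cone
  vanishes; hence \<open>b\<close> is right cancellable, and 1 - \<open>f \<cdot> g\<close>, which
  kills \<open>f\<close>, factors as \<open>s \<cdot> b\<close> with \<open>s\<close> the missing
  injection.\<close>

lemma retract_direct_sum:
  assumes "f \<Colon> X \<rightarrow> P" "g \<Colon> P \<rightarrow> X" "g \<cdot> f = ident T X"
  obtains Q where "direct_sum T [X, Q] P"
proof -
  have XP: "X \<in> Obj T" "P \<in> Obj T" "f \<in> mor T X P" using assms(1) by (simp_all only: arrow_def)
  obtain Q b c where t: "(X, P, Q, f, b, c) \<in> Tri T" using Tri_cone[OF XP] by blast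
  note ta = tri_arrow[OF t]
  have Q: "Q \<in> Obj T" using ta by simp
  have "c = (\<sigma> g \<cdot> \<sigma> f) \<cdot> c"
    using assms XP ta by (simp flip: functor_cmp del: cmp_associative)
  also have "\<dots> = \<sigma> g \<cdot> \<sigma> f \<cdot> c" using assms ta by simp
  also have "\<dots> = zero_mor T Q (\<Sigma> X)"
    using tri_cmp_zero3[OF t] assms ta by simp
  finally have c0: "c = zero_mor T Q (\<Sigma> X)" .
  have epi: "p = q" if p: "p \<Colon> Q \<rightarrow> V" "q \<Colon> Q \<rightarrow> V" "p \<cdot> b = q \<cdot> b" for p q V
  proof -
    have pq: "p \<boxplus> \<boxminus> q \<Colon> Q \<rightarrow> V" "(p \<boxplus> \<boxminus> q) \<cdot> b = zero_mor T P V"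
      using p ta by (simp_all add: cmp_add_left)
    obtain k where k: "k \<Colon> \<Sigma> X \<rightarrow> V" "p \<boxplus> \<boxminus> q = k \<cdot> c"
      by (rule tri_extend2[OF t pq])
    then have "p \<boxplus> \<boxminus> q = zero_mor T Q V" using c0 Q by simp
    then show ?thesis using p eq_iff_diff_zero[of p q] by simp
  qed
  define k where "k = ident T P \<boxplus> \<boxminus> (f \<cdot> g)"
  have k: "k \<Colon> P \<rightarrow> P" unfolding k_def using assms by simp
  have "k \<cdot> f = zero_mor T X P"
    unfolding k_def using assms XP by (simp add: cmp_add_left)
  then obtain s where s: "s \<Colon> Q \<rightarrow> P" "k = s \<cdot> b"
    by (rule tri_extend[OF t k])
  have bf: "b \<cdot> f = zero_mor T X Q" by (rule tri_cmp_zero[OF t])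
  have "b \<cdot> k = b \<boxplus> \<boxminus> (b \<cdot> f \<cdot> g)"
    unfolding k_def using assms XP ta by (simp add: cmp_add_right)
  also have "\<dots> = b" using assms XP ta by (simp add: cmp_reassoc[OF bf])
  finally have bk: "b \<cdot> k = b" .
  have bs: "b \<cdot> s = ident T Q"
    by (rule epi[of _ Q]) (use s ta bk in simp_all)
  have "g \<cdot> k = g \<boxplus> \<boxminus> (g \<cdot> f \<cdot> g)"
    unfolding k_def using assms XP ta by (simp add: cmp_add_right)
  also have "\<dots> = zero_mor T P X" using assms by (simp add: cmp_reassoc[OF assms(3)])
  finally have gk: "g \<cdot> k = zero_mor T P X" .
  have gs: "g \<cdot> s = zero_mor T Q X"
    by (rule epi[of _ X]) (use s ta gk assms in simp_all)
  have "f \<cdot> g \<boxplus> s \<cdot> b = ident T P"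
    unfolding s(2)[symmetric] k_def using assms XP by simp
  then have "direct_sum T [X, Q] P"
    unfolding direct_sum_pair_iff[OF XP(1) Q XP(2)] using assms s(1) ta bf bs gs by blast
  then show ?thesis by (rule that)
qed

lemma subcategory_retract:
  assumes "subcategory T B" "P \<in> B" "f \<Colon> X \<rightarrow> P" "g \<Colon> P \<rightarrow> X" "g \<cdot> f = ident T X"
  shows "X \<in> B"
  using retract_direct_sum[OF assms(3-5)] subcategory_sum[OF assms(1)] assms(2) by blast

text \<open>The sum factors through a biproduct of the two intermediate objects, which lies in
  \<open>B\<close> again.\<close>

lemma factors_add:
  assumes B: "subcategory T B" and "factors B f" "factors B g" "src T g = src T f" "tgt T g = tgt T f"
  shows "factors B (f \<boxplus> g)"
proof -
  define X Y where "X = src T f" and "Y = tgt T f"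
  have f: "f \<Colon> X \<rightarrow> Y" "g \<Colon> X \<rightarrow> Y"
    using factors_arr[OF assms(2)] factors_arr[OF assms(3)] assms(4,5) by (simp_all add: X_def Y_def)
  obtain W u v where w: "W \<in> B" "W \<in> Obj T" "u \<Colon> X \<rightarrow> W" "v \<Colon> W \<rightarrow> Y" "v \<cdot> u = f"
    by (rule factorsE[OF assms(2) f(1)])
  obtain W' u' v' where w': "W' \<in> B" "W' \<in> Obj T" "u' \<Colon> X \<rightarrow> W'" "v' \<Colon> W' \<rightarrow> Y" "v' \<cdot> u' = g"
    by (rule factorsE[OF assms(3) f(2)])
  obtain S i j p q where S: "direct_sum T [W, W'] S" "S \<in> Obj T"
    "i \<Colon> W \<rightarrow> S" "j \<Colon> W' \<rightarrow> S" "p \<Colon> S \<rightarrow> W" "q \<Colon> S \<rightarrow> W'"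
    "p \<cdot> i = ident T W" "q \<cdot> j = ident T W'" "p \<cdot> j = zero_mor T W' W" "q \<cdot> i = zero_mor T W W'"
    by (rule binary_sum_exists[OF w(2) w'(2)])
  have SB: "S \<in> B" using subcategory_sum[OF B S(1)] w w' by blast
  have u: "i \<cdot> u \<boxplus> j \<cdot> u' \<Colon> X \<rightarrow> S" and v: "v \<cdot> p \<boxplus> v' \<cdot> q \<Colon> S \<rightarrow> Y"
    using w(3,4) w'(3,4) S(2-6) by simp_all
  have "(v \<cdot> p \<boxplus> v' \<cdot> q) \<cdot> (i \<cdot> u \<boxplus> j \<cdot> u') = f \<boxplus> g"
    using w(3-5) w'(3-5) S(2-6) f
    by (simp add: cmp_add_left cmp_add_right cmp_reassoc[OF S(7)] cmp_reassoc[OF S(8)]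
        cmp_reassoc[OF S(9)] cmp_reassoc[OF S(10)])
  then show ?thesis by (rule factorsI[OF SB u v])
qed

lemma factors_zero:
  assumes "subcategory T B" "X \<in> Obj T" "Y \<in> Obj T"
  shows "factors B (zero_mor T X Y)"
proof -
  obtain N where N: "zero_object T N" "N \<in> Obj T" by (rule zero_object_exists)
  have "ident T N = zero_mor T N N"
    using N by (intro hom_zeroD[of N N]) (simp_all add: zero_object_def hom_zero_def)
  then have "N \<in> B" using subcategory_zero[OF assms(1)] N by blast
  then show ?thesis
    by (rule factorsI[of _ _ "zero_mor T X N" X "zero_mor T N Y" Y]) (use N assms in simp_all)
qed

text \<open>Membership becomes a property of a morphism: the factorisation exhibits \<open>X\<close>
  as a retract of an object of \<open>B\<close>. In this form it can be transported along
  congruences of morphisms.\<close>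

lemma factors_ident_imp_mem:
  assumes "subcategory T B" "X \<in> Obj T" "factors B (ident T X)"
  shows "X \<in> B"
proof -
  have X: "ident T X \<Colon> X \<rightarrow> X" using assms(2) by simp
  obtain W u v where w: "W \<in> B" "W \<in> Obj T" "u \<Colon> X \<rightarrow> W" "v \<Colon> W \<rightarrow> X" "v \<cdot> u = ident T X"
    by (rule factorsE[OF assms(3) X])
  show ?thesis by (rule subcategory_retract[OF assms(1) w(1,3,4,5)])
qed

end

section \<open>Serre duality\<close>

text \<open>Some coordinate of \<open>v\<close> in a finite basis is nonzero; the functional is that
  coordinate.\<close>

lemma nonzero_functional:
  fixes K :: "'k ring" and V :: "('k, 'm) module"
  assumes "vectorspace K V" and fd: "vectorspace.fin_dim K V" and v: "v \<in> carrier V" "v \<noteq> \<zero>\<^bsub>V\<^esub>"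
  shows "\<exists>\<phi>\<in>module_hom K V (regular_module K). \<phi> v \<noteq> \<zero>\<^bsub>K\<^esub>"
proof -
  interpret vectorspace K V by fact
  obtain B where B: "finite B" "basis B" using finite_basis_exists[OF fd] by blast
  then have BV: "B \<subseteq> carrier V" unfolding basis_def by blast
  have uniq: "\<exists>!a. a \<in> B \<rightarrow>\<^sub>E carrier K \<and> lincomb a B = w" if "w \<in> carrier V" for w
    using basis_criterion[OF B(1) BV] B(2) that by blast
  define co where "co w = (THE a. a \<in> B \<rightarrow>\<^sub>E carrier K \<and> lincomb a B = w)" for w
  have co: "co w \<in> B \<rightarrow>\<^sub>E carrier K" "lincomb (co w) B = w" if "w \<in> carrier V" for w
    using theI'[OF uniq[OF that]] unfolding co_def by blast+
  have coK: "co w b \<in> carrier K" if "w \<in> carrier V" "b \<in> B" for w b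
    using co(1)[OF that(1)] that(2) by auto
  \<comment> \<open>Coordinates are unique among extensional functions on \<open>B\<close>, so a
    general family of coefficients is restricted before it is compared.\<close>
  have co_eq: "co w b = a b" if "a \<in> B \<rightarrow> carrier K" "lincomb a B = w" "w \<in> carrier V" "b \<in> B" for a w b
  proof -
    have "lincomb (restrict a B) B = lincomb a B"
      by (rule lincomb_cong) (simp_all add: BV that(1))
    moreover have "restrict a B \<in> B \<rightarrow>\<^sub>E carrier K" using that(1) by auto
    ultimately have "co w = restrict a B"
      unfolding co_def using that(2) by (intro the1_equality[OF uniq[OF that(3)]]) simp
    then show ?thesis using that(4) by simp
  qed
  have "\<exists>b\<in>B. co v b \<noteq> \<zero>\<^bsub>K\<^esub>"
  proof (rule ccontr)
    assume "\<not> (\<exists>b\<in>B. co v b \<noteq> \<zero>\<^bsub>K\<^esub>)"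
    then have z: "co v b = \<zero>\<^bsub>K\<^esub>" if "b \<in> B" for b using that by blast
    have "v = lincomb (co v) B" using co(2)[OF v(1)] by simp
    also have "\<dots> = \<zero>\<^bsub>V\<^esub>" by (rule lincomb_zero[OF BV]) (simp add: z)
    finally show False using v(2) by blast
  qed
  then obtain b where b: "b \<in> B" "co v b \<noteq> \<zero>\<^bsub>K\<^esub>" by blast
  have "(\<lambda>w. co w b) \<in> module_hom K V (regular_module K)"
    unfolding module_hom_def regular_module_def
  proof (simp, intro conjI allI impI, goal_cases)
    case 1
    then show ?case using coK b(1) by blast
  next
    case (2 u w)
    have co': "co u \<in> B \<rightarrow> carrier K" "co w \<in> B \<rightarrow> carrier K" using coK 2 by auto
    then have "lincomb (\<lambda>x. co u x \<oplus>\<^bsub>K\<^esub> co w x) B = u \<oplus>\<^bsub>V\<^esub> w"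
      using lincomb_sum[OF B(1) BV] co(2) 2 by simp
    then show ?case
      by (rule co_eq[rotated]) (use co' 2 b(1) in auto)
  next
    case (3 r w)
    have co': "co w \<in> B \<rightarrow> carrier K" using coK 3 by auto
    then have "lincomb (\<lambda>x. r \<otimes>\<^bsub>K\<^esub> co w x) B = r \<odot>\<^bsub>V\<^esub> w"
      using lincomb_smult[OF BV] co(2) 3 by simp
    then show ?case
      by (rule co_eq[rotated]) (use co' 3 b(1) in auto)
  qed
  then show ?thesis by (rule bexI[rotated]) (rule b(2))
qed

text \<open>Together with \<open>dual_space_nontrivial\<close>, this detects a zero space by its
  dual being a singleton, a condition that any bijection transports.\<close>

lemma dual_space_eqI:
  fixes K :: "'k ring" and V :: "('k, 'm) module"
  assumes "vectorspace K V" and a: "\<phi> \<in> carrier (dual_space K V)" "\<psi> \<in> carrier (dual_space K V)" "carrier V = {\<zero>\<^bsub>V\<^esub>}"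
  shows "\<phi> = \<psi>"
proof -
  interpret vectorspace K V by fact
  have z: "\<chi> \<zero>\<^bsub>V\<^esub> = \<zero>\<^bsub>K\<^esub>" if "\<chi> \<in> carrier (dual_space K V)" for \<chi>
  proof -
    have c: "\<chi> \<in> module_hom K V (regular_module K)" using that unfolding dual_space_def by simp
    have k: "\<chi> \<zero>\<^bsub>V\<^esub> \<in> carrier K"
      using module_hom_closed[OF c] by (auto simp: regular_module_def)
    have "\<chi> (\<zero>\<^bsub>V\<^esub> \<oplus>\<^bsub>V\<^esub> \<zero>\<^bsub>V\<^esub>) = \<chi> \<zero>\<^bsub>V\<^esub> \<oplus>\<^bsub>K\<^esub> \<chi> \<zero>\<^bsub>V\<^esub>"
      using module_hom_add[OF c, of "\<zero>\<^bsub>V\<^esub>" "\<zero>\<^bsub>V\<^esub>"] by (simp add: regular_module_def)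
    then have "\<chi> \<zero>\<^bsub>V\<^esub> \<oplus>\<^bsub>K\<^esub> \<chi> \<zero>\<^bsub>V\<^esub> = \<chi> \<zero>\<^bsub>V\<^esub>" by simp
    with k show ?thesis by (metis R.add.l_cancel_one)
  qed
  have "\<phi> \<in> extensional (carrier V)" "\<psi> \<in> extensional (carrier V)"
    using a unfolding dual_space_def by simp_all
  then show ?thesis
    by (rule extensionalityI) (use a(3) z[OF a(1)] z[OF a(2)] in auto)
qed

lemma dual_space_nontrivial:
  fixes K :: "'k ring" and V :: "('k, 'm) module"
  assumes "vectorspace K V" and fd: "vectorspace.fin_dim K V" and nz: "carrier V \<noteq> {\<zero>\<^bsub>V\<^esub>}"
  shows "\<exists>\<phi>\<in>carrier (dual_space K V). \<exists>\<psi>\<in>carrier (dual_space K V). \<phi> \<noteq> \<psi>"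
proof -
  interpret vectorspace K V by fact
  obtain v where v: "v \<in> carrier V" "v \<noteq> \<zero>\<^bsub>V\<^esub>" using nz by auto
  obtain \<phi> where \<phi>: "\<phi> \<in> module_hom K V (regular_module K)" "\<phi> v \<noteq> \<zero>\<^bsub>K\<^esub>"
    using nonzero_functional[OF assms(1) fd v] by blast
  have "restrict \<phi> (carrier V) \<in> carrier (dual_space K V)"
    using \<phi>(1) unfolding dual_space_def by (auto simp: module_hom_def)
  moreover have "(\<lambda>w\<in>carrier V. \<zero>\<^bsub>K\<^esub>) \<in> carrier (dual_space K V)"
    unfolding dual_space_def by (auto simp: module_hom_def regular_module_def)
  moreover have "restrict \<phi> (carrier V) \<noteq> (\<lambda>w\<in>carrier V. \<zero>\<^bsub>K\<^esub>)"
    using v \<phi>(2) by (metis restrict_apply')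
  ultimately show ?thesis by blast
qed

text \<open>The Serre pairing is a bijection from \<open>(X, Y)\<close> onto the dual of
  \<open>(Y, S X)\<close>, and a finite-dimensional space and its dual are singletons at the same
  time.\<close>

lemma (in triangulated) serre_hom_zero:
  assumes "hom_finite K T" "serre_functor K T S" "X \<in> Obj T" "Y \<in> Obj T"
  shows "hom_zero X Y \<longleftrightarrow> hom_zero Y (Fob S X)"
proof -
  have S: "endofunctor T S"
    using assms(2) unfolding serre_functor_def linear_endofunctor_def by blast
  then have SX: "Fob S X \<in> Obj T" using assms(3) by simp
  interpret V: vectorspace K "Hom T Y (Fob S X)" by (rule Hom_vectorspace[OF assms(4) SX])
  have fd: "V.fin_dim" using assms(1,4) SX unfolding hom_finite_def by blast
  obtain \<eta> where \<eta>: "bij_betw \<eta> (mor T X Y) (carrier (dual_space K (Hom T Y (Fob S X))))"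
    using assms(2-4) unfolding serre_functor_def by blast
  have z: "zero_mor T X Y \<in> mor T X Y" using assms(3,4) by (simp add: mor_iff)
  show ?thesis
  proof
    assume h: "hom_zero X Y"
    show "hom_zero Y (Fob S X)"
      unfolding hom_zero_def
    proof (rule ccontr)
      assume "mor T Y (Fob S X) \<noteq> {zero_mor T Y (Fob S X)}"
      then obtain \<phi> \<psi> where p: "\<phi> \<in> \<eta> ` mor T X Y" "\<psi> \<in> \<eta> ` mor T X Y" "\<phi> \<noteq> \<psi>"
        using dual_space_nontrivial[OF V.vectorspace_axioms fd] \<eta> unfolding bij_betw_def by blast
      then show False using h unfolding hom_zero_def by auto
    qed
  next
    assume h: "hom_zero Y (Fob S X)"
    have "f = zero_mor T X Y" if f: "f \<in> mor T X Y" for f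
    proof -
      have "\<eta> f = \<eta> (zero_mor T X Y)"
        using \<eta> f z h unfolding bij_betw_def hom_zero_def
        by (intro dual_space_eqI[OF V.vectorspace_axioms]) blast+
      then show ?thesis using \<eta> f z unfolding bij_betw_def inj_on_def by blast
    qed
    then show "hom_zero X Y" using z unfolding hom_zero_def by blast
  qed
qed

section \<open>The orthogonal subcategory\<close>

context preadditive_category
begin

text \<open>Meant for the decomposition of the identity of a direct sum: a property of endomorphisms
  that is closed under addition passes from the summands to the identity.\<close>

lemma finsum_induct:
  assumes "S \<in> Obj C" "finite J" "\<And>j. j \<in> J \<Longrightarrow> h j \<Colon> S \<rightarrow> S"
    and "P (zero_mor C S S)" "\<And>j. j \<in> J \<Longrightarrow> P (h j)"
    and add: "\<And>u v. \<lbrakk>u \<Colon> S \<rightarrow> S; v \<Colon> S \<rightarrow> S; P u; P v\<rbrakk> \<Longrightarrow> P (u \<boxplus> v)"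
  shows "P (\<Oplus>\<^bsub>Hom C S S\<^esub>j\<in>J. h j)"
proof -
  interpret abelian_group "Hom C S S" using assms(1) by (simp add: Hom_abelian_group)
  have m: "u \<in> mor C S S \<longleftrightarrow> u \<Colon> S \<rightarrow> S" for u using assms(1) unfolding arrow_def by blast
  have "(\<Oplus>\<^bsub>Hom C S S\<^esub>j\<in>J. h j) \<in> mor C S S \<and> P (\<Oplus>\<^bsub>Hom C S S\<^esub>j\<in>J. h j)"
    using assms(2,3,5)
  proof (induction J)
    case empty
    then show ?case using assms(4) by simp
  next
    case (insert j J)
    have hj: "h \<in> J \<rightarrow> mor C S S" "h j \<in> mor C S S" using insert.prems(1) m by blast+
    let ?s = "\<Oplus>\<^bsub>Hom C S S\<^esub>j\<in>J. h j"
    have s: "?s \<in> mor C S S" "P ?s" using insert by blast+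
    have "(\<Oplus>\<^bsub>Hom C S S\<^esub>j\<in>insert j J. h j) = h j \<oplus>\<^bsub>Hom C S S\<^esub> ?s"
      by (rule finsum_insert[OF insert.hyps hj])
    moreover have "h j \<oplus>\<^bsub>Hom C S S\<^esub> ?s = h j \<boxplus> ?s"
      using hj(2)[unfolded m] by (intro Hom_add) simp_all
    moreover have "P (h j \<boxplus> ?s)"
      using add[OF _ _ _ s(2)] hj(2) s(1) insert.prems(2) unfolding m by blast
    moreover have "h j \<oplus>\<^bsub>Hom C S S\<^esub> ?s \<in> mor C S S" using hj(2) s(1) by (rule a_closed)
    ultimately show ?case by simp
  qed
  then show ?thesis ..
qed

lemma direct_sumE:
  assumes "direct_sum C Xs S"
  obtains \<iota> \<pi> where "S \<in> Obj C" "set Xs \<subseteq> Obj C"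
    "\<And>j. j < length Xs \<Longrightarrow> \<iota> j \<Colon> Xs ! j \<rightarrow> S" "\<And>j. j < length Xs \<Longrightarrow> \<pi> j \<Colon> S \<rightarrow> Xs ! j"
    "\<And>j l. \<lbrakk>j < length Xs; l < length Xs\<rbrakk> \<Longrightarrow>
      \<pi> j \<cdot> \<iota> l = (if j = l then ident C (Xs ! j) else zero_mor C (Xs ! l) (Xs ! j))"
    "(\<Oplus>\<^bsub>Hom C S S\<^esub>j\<in>{..<length Xs}. \<iota> j \<cdot> \<pi> j) = ident C S"
proof -
  obtain \<iota> \<pi> where i:
    "\<forall>j<length Xs. \<iota> j \<in> mor C (Xs ! j) S \<and> \<pi> j \<in> mor C S (Xs ! j)"
    "\<forall>j<length Xs. \<forall>l<length Xs. \<pi> j \<cdot> \<iota> l =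
        (if j = l then ident C (Xs ! j) else zero_mor C (Xs ! l) (Xs ! j))"
    "(\<Oplus>\<^bsub>Hom C S S\<^esub>j\<in>{..<length Xs}. \<iota> j \<cdot> \<pi> j) = ident C S"
    using assms unfolding direct_sum_def by blast
  have S: "S \<in> Obj C" "set Xs \<subseteq> Obj C" using assms unfolding direct_sum_def by blast+
  have X: "Xs ! j \<in> Obj C" if "j < length Xs" for j using S(2) that by auto
  show ?thesis
  proof (rule that[of \<iota> \<pi>, OF S])
    fix j assume "j < length Xs"
    then show "\<iota> j \<Colon> Xs ! j \<rightarrow> S" "\<pi> j \<Colon> S \<rightarrow> Xs ! j"
      unfolding arrow_def using i(1) S(1) X by blast+
  next
    fix j l assume "j < length Xs" "l < length Xs"
    then show "\<pi> j \<cdot> \<iota> l = (if j = l then ident C (Xs ! j) else zero_mor C (Xs ! l) (Xs ! j))"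
      using i(2) by blast
  qed (rule i(3))
qed

text \<open>A morphism into the sum is the sum of its components, by the decomposition of the
  identity; conversely each injection is split.\<close>

lemma hom_zero_direct_sum:
  assumes "direct_sum C Xs S" "V \<in> Obj C"
  shows "hom_zero V S \<longleftrightarrow> (\<forall>X\<in>set Xs. hom_zero V X)"
proof -
  obtain \<iota> \<pi> where S: "S \<in> Obj C" "set Xs \<subseteq> Obj C"
    and \<iota>: "\<And>j. j < length Xs \<Longrightarrow> \<iota> j \<Colon> Xs ! j \<rightarrow> S"
    and \<pi>: "\<And>j. j < length Xs \<Longrightarrow> \<pi> j \<Colon> S \<rightarrow> Xs ! j"
    and \<pi>\<iota>: "\<And>j l. \<lbrakk>j < length Xs; l < length Xs\<rbrakk> \<Longrightarrow>
      \<pi> j \<cdot> \<iota> l = (if j = l then ident C (Xs ! j) else zero_mor C (Xs ! l) (Xs ! j))"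
    and sum: "(\<Oplus>\<^bsub>Hom C S S\<^esub>j\<in>{..<length Xs}. \<iota> j \<cdot> \<pi> j) = ident C S"
    by (rule direct_sumE[OF assms(1)]) (rule that; assumption)
  show ?thesis
  proof (intro iffI ballI)
    fix X assume z: "hom_zero V S" and X: "X \<in> set Xs"
    then obtain j where j: "j < length Xs" "X = Xs ! j" by (metis in_set_conv_nth)
    have XO: "X \<in> Obj C" using X S by blast
    have e: "\<pi> j \<cdot> \<iota> j = ident C X" using \<pi>\<iota>[OF j(1) j(1)] j(2) by simp
    note t = \<iota>[OF j(1), folded j(2)] \<pi>[OF j(1), folded j(2)]
    show "hom_zero V X"
    proof (rule hom_zeroI[OF assms(2) XO])
      fix f assume f: "f \<Colon> V \<rightarrow> X"
      have "\<iota> j \<cdot> f = zero_mor C V S" using f t by (intro hom_zeroD[OF z]) simp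
      then have "\<pi> j \<cdot> \<iota> j \<cdot> f = zero_mor C V X" using t assms(2) by simp
      then show "f = zero_mor C V X" using f t by (simp add: cmp_reassoc[OF e])
    qed
  next
    assume z: "\<forall>X\<in>set Xs. hom_zero V X"
    show "hom_zero V S"
    proof (rule hom_zeroI[OF assms(2) S(1)])
      fix f assume f: "f \<Colon> V \<rightarrow> S"
      have "(\<Oplus>\<^bsub>Hom C S S\<^esub>j\<in>{..<length Xs}. \<iota> j \<cdot> \<pi> j) \<cdot> f = zero_mor C V S"
      proof (rule finsum_induct[OF S(1)])
        fix j assume "j \<in> {..<length Xs}"
        then have j: "j < length Xs" by simp
        show "\<iota> j \<cdot> \<pi> j \<Colon> S \<rightarrow> S" using \<iota>[OF j] \<pi>[OF j] by simp
        have "\<pi> j \<cdot> f = zero_mor C V (Xs ! j)"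
          by (rule hom_zeroD) (use z f \<pi>[OF j] j in simp_all)
        then show "(\<iota> j \<cdot> \<pi> j) \<cdot> f = zero_mor C V S"
          using f \<pi>[OF j] \<iota>[OF j] assms(2) by simp
      qed (use f S in \<open>simp_all add: cmp_add_left\<close>)
      then show "f = zero_mor C V S" using sum f by simp
    qed
  qed
qed

end

context preadditive_shift_category
begin

lemma shift_pow_cong:
  assumes "X \<in> Obj C" "Y \<in> Obj C" "isomorphic C X Y"
  shows "isomorphic C (\<Sigma>\<^bsup>i\<^esup> X) (\<Sigma>\<^bsup>i\<^esup> Y)"
  using assms by (induction i) (simp_all add: functor_isomorphic)

lemma hom_zero_shift_pow:
  assumes "X \<in> Obj C" "Y \<in> Obj C"
  shows "hom_zero (\<Sigma>\<^bsup>i\<^esup> X) (\<Sigma>\<^bsup>i\<^esup> Y) \<longleftrightarrow> hom_zero X Y"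
  using assms by (induction i) (simp_all add: hom_zero_autoequivalence[OF Shift_auto])

abbreviation unshift :: "nat \<Rightarrow> 'o \<Rightarrow> 'o"
  where "unshift i \<equiv> Fob (inverse_functor C (Shift C)) ^^ i"

lemma unshift_Obj [simp]: "X \<in> Obj C \<Longrightarrow> unshift i X \<in> Obj C"
  by (rule funpow_Obj[OF autoequivalenceD(1)[OF autoequivalence_inverse[OF Shift_auto]]])

lemma hom_zero_unshift:
  "\<lbrakk>X \<in> Obj C; Y \<in> Obj C\<rbrakk> \<Longrightarrow> hom_zero (unshift i X) Y \<longleftrightarrow> hom_zero X (\<Sigma>\<^bsup>i\<^esup> Y)"
  using hom_zero_inverse_funpow[OF Shift_auto] .

lemma shift_unshift_isomorphic:
  "X \<in> Obj C \<Longrightarrow> isomorphic C (\<Sigma>\<^bsup>i\<^esup> (unshift i X)) X"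
  using isomorphic_power_minus[OF Shift_auto, of X i]
  by (simp add: functor_power_minus functor_power_nonneg Fob_funpow)

text \<open>The condition is rewritten as \<open>(X[-i], W) = 0\<close>, so that \<open>W\<close>
  itself, and not a shift of it, is decomposed into summands.\<close>

lemma subcategory_n_right_perp:
  assumes "B \<subseteq> Obj C"
  shows "subcategory C (n_right_perp C n B)"
proof -
  let ?P = "n_right_perp C n B"
  have P: "W \<in> ?P \<longleftrightarrow> (\<forall>i\<in>{1..<n}. \<forall>X\<in>B. hom_zero (unshift i X) W)" if "W \<in> Obj C" for W
    using that assms unfolding n_right_perp_eq[OF assms] by (auto simp: hom_zero_unshift subset_iff)
  show ?thesis
    unfolding subcategory_def
  proof (intro conjI ballI impI allI)
    show "?P \<subseteq> Obj C" unfolding n_right_perp_def by blast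
    fix X Y assume X: "X \<in> ?P" "Y \<in> Obj C" "isomorphic C X Y"
    then have XO: "X \<in> Obj C" unfolding n_right_perp_def by blast
    have "hom_zero (unshift i V) Y" if V: "i \<in> {1..<n}" "V \<in> B" for i V
    proof -
      have VO: "unshift i V \<in> Obj C" using V assms by auto
      have "hom_zero (unshift i V) X" using X(1) P[OF XO] V by blast
      then show ?thesis by (rule hom_zero_iso[OF VO XO VO X(2) isomorphic_refl[OF VO] X(3)])
    qed
    then show "Y \<in> ?P" using P[OF X(2)] by blast
  next
    fix Xs S assume S: "direct_sum C Xs S"
    have SO: "S \<in> Obj C" "set Xs \<subseteq> Obj C" using S unfolding direct_sum_def by blast+
    have "hom_zero (unshift i V) S \<longleftrightarrow> (\<forall>X\<in>set Xs. hom_zero (unshift i V) X)"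
      if V: "V \<in> B" for i V
      by (rule hom_zero_direct_sum[OF S]) (use V assms in auto)
    then show "set Xs \<subseteq> ?P \<longleftrightarrow> S \<in> ?P"
      using P[OF SO(1)] P SO(2) by (auto simp: subset_iff)
  qed
qed

end

notation (in triangulated) shift_pow (\<open>\<Sigma>\<^bsup>_\<^esup>\<close> [0] 1000)

text \<open>\<open>Z\<close> is fixed by its right-hand description; agreement with the left-hand
  one is derived from Serre duality. The choice \<open>A\<close> of approximation triangles is a
  parameter, so the results hold for every choice.\<close>

locale reduction_setting = triangulated K T
  for K :: "'k ring" and T :: "('k, 'o, 'm) tri_cat" (structure) +
  fixes S :: "('o, 'm) endo" and n :: nat and D Z :: "'o set" and A :: "'o \<Rightarrow> ('o, 'm) sextuple"
  assumes hom_finite: "hom_finite K T"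
    and serre: "serre_functor K T S"
    and n_ge_2: "n \<ge> 2"
    and D_ff: "functorially_finite T D"
    and D_rigid: "n_rigid T n D"
    and D_stable: "stable_subcategory T (serre_n T S n) D"
    and Z_def: "Z = n_right_perp T n D"
    and A_triangles: "approximation_triangles T D Z A"
begin

lemma D_sub: "subcategory T D"
  using D_rigid unfolding n_rigid_def by blast

lemma D_Obj: "D \<subseteq> Obj T"
  using D_sub unfolding subcategory_def by blast

lemma Z_sub: "subcategory T Z"
  unfolding Z_def by (rule subcategory_n_right_perp[OF D_Obj])

lemma Z_Obj: "Z \<subseteq> Obj T"
  using Z_sub unfolding subcategory_def by blast

lemma D_ObjD: "X \<in> D \<Longrightarrow> X \<in> Obj T"
  using D_Obj by blast

lemma Z_ObjD: "X \<in> Z \<Longrightarrow> X \<in> Obj T"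
  using Z_Obj by blast

abbreviation Sn :: "('o, 'm) endo"
  where "Sn \<equiv> serre_n T S n"

lemma Sn_auto: "autoequivalence T Sn"
  using serre unfolding serre_n_def shift_def serre_functor_def
  by (intro autoequivalence_comp autoequivalence_power Shift_auto) blast

lemma Sn_functor [simp]: "endofunctor T Sn"
  using Sn_auto by (rule autoequivalenceD)

lemma Sn_additive [simp]: "additive_functor Sn"
proof -
  have "additive_functor S"
    using serre linear_endofunctor_additive unfolding serre_functor_def by blast
  then show ?thesis
    unfolding serre_n_def shift_def
    using autoequivalenceD(1)[OF autoequivalence_power[OF Shift_auto]]
    by (intro additive_functor_comp additive_functor_power Shift_auto Shift_additive)
qed

text \<open>Serre duality pairs \<open>(Y[-n], W[-i])\<close> with
  \<open>(W[-i], S (Y[-n]))\<close>, and these are \<open>(Y, W[n-i])\<close> and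
  \<open>(W, S_n Y [i])\<close> after shifting. Since i -> n-i permutes the indices 0 < i < n, this
  exchanges left and right orthogonality conditions.\<close>

lemma serre_n_hom_zero:
  assumes W: "W \<in> Obj T" and Y: "Y \<in> Obj T" and i: "i \<le> n"
  shows "hom_zero W (\<Sigma>\<^bsup>i\<^esup> (Fob Sn Y)) \<longleftrightarrow> hom_zero Y (\<Sigma>\<^bsup>n - i\<^esup> W)"
proof -
  have SnY: "Fob Sn Y = Fob S (unshift n Y)"
    by (simp add: serre_n_def comp_functor_def shift_def functor_power_minus Fob_funpow)
  have "hom_zero W (\<Sigma>\<^bsup>i\<^esup> (Fob Sn Y)) \<longleftrightarrow> hom_zero (unshift i W) (Fob Sn Y)"
    using hom_zero_unshift W Y by simp
  also have "\<dots> \<longleftrightarrow> hom_zero (unshift n Y) (unshift i W)"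
    unfolding SnY using serre_hom_zero[OF hom_finite serre] W Y by simp
  also have "\<dots> \<longleftrightarrow> hom_zero Y (\<Sigma>\<^bsup>n\<^esup> (unshift i W))"
    using hom_zero_unshift W Y by simp
  also have "\<Sigma>\<^bsup>n\<^esup> (unshift i W) = \<Sigma>\<^bsup>n - i\<^esup> (\<Sigma>\<^bsup>i\<^esup> (unshift i W))"
    using i by (metis comp_apply funpow_add le_add_diff_inverse2)
  also have "hom_zero Y (\<Sigma>\<^bsup>n - i\<^esup> (\<Sigma>\<^bsup>i\<^esup> (unshift i W))) \<longleftrightarrow> hom_zero Y (\<Sigma>\<^bsup>n - i\<^esup> W)"
    using W Y shift_unshift_isomorphic[OF W]
    by (intro hom_zero_cong shift_pow_cong isomorphic_refl) simp_all
  finally show ?thesis .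
qed

lemma D_Sn: "X \<in> Obj T \<Longrightarrow> X \<in> D \<longleftrightarrow> Fob Sn X \<in> D"
  using D_stable unfolding stable_subcategory_iff[OF Sn_auto] by blast

lemma D_Sn_preimage:
  assumes "W \<in> D"
  obtains V where "V \<in> D" "isomorphic T (Fob Sn V) W"
proof -
  obtain V where V: "V \<in> Obj T" "isomorphic T (Fob Sn V) W"
    using autoequivalenceD(4)[OF Sn_auto] D_ObjD[OF assms] unfolding ess_surj_def by blast
  have "Fob Sn V \<in> D"
    using subcategory_iso_iff[OF D_sub _ D_ObjD[OF assms] V(2)] V(1) assms by simp
  then show ?thesis using V D_Sn that by blast
qed

lemma Z_right: "W \<in> Obj T \<Longrightarrow> W \<in> Z \<longleftrightarrow> (\<forall>i\<in>{1..<n}. \<forall>X\<in>D. hom_zero X (\<Sigma>\<^bsup>i\<^esup> W))"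
  unfolding Z_def n_right_perp_eq[OF D_Obj] by blast

text \<open>Each \<open>X\<close> in \<open>D\<close> is up to isomorphism \<open>S_n V\<close> with
  \<open>V\<close> in \<open>D\<close>, so duality turns the left condition at \<open>i\<close> into
  the right condition at \<open>n - i\<close>.\<close>

lemma Z_left: 
  assumes W: "W \<in> Obj T"
  shows "W \<in> Z \<longleftrightarrow> (\<forall>i\<in>{1..<n}. \<forall>X\<in>D. hom_zero W (\<Sigma>\<^bsup>i\<^esup> X))"
proof
  assume Z: "W \<in> Z"
  show "\<forall>i\<in>{1..<n}. \<forall>X\<in>D. hom_zero W (\<Sigma>\<^bsup>i\<^esup> X)"
  proof (intro ballI)
    fix i X assume i: "i \<in> {1..<n}" and X: "X \<in> D"
    obtain V where V: "V \<in> D" "isomorphic T (Fob Sn V) X" by (rule D_Sn_preimage[OF X])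
    have VO: "V \<in> Obj T" "X \<in> Obj T" using V X D_ObjD by blast+
    have "hom_zero V (\<Sigma>\<^bsup>n - i\<^esup> W)" using Z Z_right[OF W] i V by auto
    then have "hom_zero W (\<Sigma>\<^bsup>i\<^esup> (Fob Sn V))" using serre_n_hom_zero[OF W VO(1)] i by simp
    then show "hom_zero W (\<Sigma>\<^bsup>i\<^esup> X)"
      by (rule hom_zero_iso[rotated -1])
        (use W VO V(2) in \<open>simp_all add: isomorphic_refl shift_pow_cong\<close>)
  qed
next
  assume l: "\<forall>i\<in>{1..<n}. \<forall>X\<in>D. hom_zero W (\<Sigma>\<^bsup>i\<^esup> X)"
  have "hom_zero X (\<Sigma>\<^bsup>i\<^esup> W)" if i: "i \<in> {1..<n}" and X: "X \<in> D" for i X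
  proof -
    have XO: "X \<in> Obj T" using X by (rule D_ObjD)
    have "hom_zero W (\<Sigma>\<^bsup>n - i\<^esup> (Fob Sn X))" using l i X D_Sn[OF XO] by auto
    moreover have "n - (n - i) = i" using i by auto
    ultimately show ?thesis using serre_n_hom_zero[OF W XO, of "n - i"] by simp
  qed
  then show "W \<in> Z" using Z_right[OF W] by blast
qed

lemma Z_eq_left_perp: "Z = n_left_perp T n D"
  unfolding n_left_perp_eq[OF D_Obj] using Z_left Z_Obj by blast

lemma D_subset_Z: "D \<subseteq> Z"
proof
  fix X assume X: "X \<in> D"
  then show "X \<in> Z"
    using Z_right[OF D_ObjD[OF X]] D_rigid unfolding n_rigid_iff by blast
qed

lemma D_ZD: "X \<in> D \<Longrightarrow> X \<in> Z"
  using D_subset_Z by blast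

lemma hom_zero_D_Z: "\<lbrakk>W \<in> D; X \<in> Z; 0 < i; i < n\<rbrakk> \<Longrightarrow> hom_zero W (\<Sigma>\<^bsup>i\<^esup> X)"
  using Z_right[OF Z_ObjD] by (simp add: Suc_le_eq)

lemma hom_zero_Z_D: "\<lbrakk>W \<in> D; X \<in> Z; 0 < i; i < n\<rbrakk> \<Longrightarrow> hom_zero X (\<Sigma>\<^bsup>i\<^esup> W)"
  using Z_left[OF Z_ObjD] by (simp add: Suc_le_eq)

lemma hom_zero_D_Z1: "\<lbrakk>W \<in> D; X \<in> Z\<rbrakk> \<Longrightarrow> hom_zero W (\<Sigma> X)"
  using hom_zero_D_Z[of W X 1] n_ge_2 by simp

lemma hom_zero_Z_D1: "\<lbrakk>W \<in> D; X \<in> Z\<rbrakk> \<Longrightarrow> hom_zero X (\<Sigma> W)"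
  using hom_zero_Z_D[of W X 1] n_ge_2 by simp

text \<open>Duality matches the left description of \<open>Z\<close> at \<open>X\<close> with the
  right description at \<open>S_n X\<close>. Hence \<open>S_n\<close> acts on the objects of the
  quotient.\<close>

lemma Z_Sn:
  assumes X: "X \<in> Obj T"
  shows "X \<in> Z \<longleftrightarrow> Fob Sn X \<in> Z"
proof -
  have "(\<forall>i\<in>{1..<n}. \<forall>W\<in>D. hom_zero X (\<Sigma>\<^bsup>i\<^esup> W))
      \<longleftrightarrow> (\<forall>i\<in>{1..<n}. \<forall>W\<in>D. hom_zero W (\<Sigma>\<^bsup>n - i\<^esup> (Fob Sn X)))"
  proof (intro ball_cong refl)
    fix i W assume i: "i \<in> {1..<n}" and W: "W \<in> D"
    then have "n - (n - i) = i" by auto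
    then show "hom_zero X (\<Sigma>\<^bsup>i\<^esup> W) = hom_zero W (\<Sigma>\<^bsup>n - i\<^esup> (Fob Sn X))"
      using serre_n_hom_zero[OF D_ObjD[OF W] X, of "n - i"] by simp
  qed
  also have "\<dots> \<longleftrightarrow> (\<forall>i\<in>{1..<n}. \<forall>W\<in>D. hom_zero W (\<Sigma>\<^bsup>i\<^esup> (Fob Sn X)))"
  proof (intro iffI ballI)
    fix i W assume h: "\<forall>i\<in>{1..<n}. \<forall>W\<in>D. hom_zero W (\<Sigma>\<^bsup>n - i\<^esup> (Fob Sn X))"
      and i: "i \<in> {1..<n}" and W: "W \<in> D"
    have "n - (n - i) = i" "n - i \<in> {1..<n}" using i by auto
    then show "hom_zero W (\<Sigma>\<^bsup>i\<^esup> (Fob Sn X))" using h W by metis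
  qed auto
  finally show ?thesis using Z_left[OF X] Z_right[of "Fob Sn X"] X by simp
qed

end

section \<open>The shift of the reduction\<close>

context reduction_setting
begin

text \<open>The components of \<open>A X\<close>; the object \<open>tw X\<close> is \<open>X\<langle>1\<rangle>\<close>.\<close>

definition Dapp :: "'o \<Rightarrow> 'o" where "Dapp X = fst (snd (A X))"
definition tw :: "'o \<Rightarrow> 'o" where "tw X = fst (snd (snd (A X)))"
definition al :: "'o \<Rightarrow> 'm" where "al X = fst (snd (snd (snd (A X))))"
definition be :: "'o \<Rightarrow> 'm" where "be X = fst (snd (snd (snd (snd (A X)))))"
definition ga :: "'o \<Rightarrow> 'm" where "ga X = snd (snd (snd (snd (snd (A X)))))"

lemma A_left_approximation:
  assumes "X \<in> Z"
  shows "A X = (X, Dapp X, tw X, al X, be X, ga X)" "left_approximation T D X (Dapp X) (al X)"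
proof -
  obtain DX X1 a b c where "A X = (X, DX, X1, a, b, c)" "left_approximation T D X DX a"
    using A_triangles assms unfolding approximation_triangles_def by blast
  then show "A X = (X, Dapp X, tw X, al X, be X, ga X)" "left_approximation T D X (Dapp X) (al X)"
    by (simp_all add: Dapp_def tw_def al_def be_def ga_def)
qed

lemma A_tri: "X \<in> Z \<Longrightarrow> (X, Dapp X, tw X, al X, be X, ga X) \<in> Tri T"
  using A_triangles A_left_approximation(1) unfolding approximation_triangles_def by metis

lemma A_arrow:
  assumes "X \<in> Z"
  shows "al X \<Colon> X \<rightarrow> Dapp X" "be X \<Colon> Dapp X \<rightarrow> tw X" "ga X \<Colon> tw X \<rightarrow> \<Sigma> X"
  using tri_arrow[OF A_tri[OF assms]] by blast+

lemma Dapp_D: "X \<in> Z \<Longrightarrow> Dapp X \<in> D"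
  using A_left_approximation(2) unfolding left_approximation_def by blast

lemma al_extend:
  assumes "X \<in> Z" "W \<in> D" "u \<Colon> X \<rightarrow> W"
  obtains h where "h \<Colon> Dapp X \<rightarrow> W" "u = h \<cdot> al X"
proof -
  have "u \<in> mor T X W" using assms(3) unfolding arrow_def by blast
  then obtain h where h: "h \<in> mor T (Dapp X) W" "u = h \<cdot> al X"
    using A_left_approximation(2)[OF assms(1)] assms(2) unfolding left_approximation_def by blast
  then have "h \<Colon> Dapp X \<rightarrow> W"
    unfolding arrow_def using D_ObjD[OF Dapp_D[OF assms(1)]] D_ObjD[OF assms(2)] by blast
  then show ?thesis using h(2) by (rule that)
qed

text \<open>As \<open>(D, W[i]) = 0\<close>, a morphism from \<open>tw X\<close> to
  \<open>W[i]\<close> comes from one from \<open>X\<close> to \<open>W[i-1]\<close>. For i > 1 the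
  latter is zero because \<open>X\<close> lies in \<open>Z\<close>; for i = 1 it extends along the
  left approximation of \<open>X\<close>, and the composite with \<open>ga X\<close>
  vanishes.\<close>

lemma tw_Z:
  assumes X: "X \<in> Z"
  shows "tw X \<in> Z"
proof -
  note t = A_tri[OF X] and ta = A_arrow[OF X]
  have O: "tw X \<in> Obj T" "X \<in> Obj T" using ta by simp_all
  have "hom_zero (tw X) (\<Sigma>\<^bsup>i\<^esup> W)" if i: "0 < i" "i < n" and W: "W \<in> D" for i W
  proof -
    have WO: "W \<in> Obj T" using W by (rule D_ObjD)
    obtain j where j: "i = Suc j" using i(1) gr0_implies_Suc by blast
    show ?thesis
    proof (rule hom_zeroI[OF O(1)])
      show "\<Sigma>\<^bsup>i\<^esup> W \<in> Obj T" using WO by simp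
      fix h assume h: "h \<Colon> tw X \<rightarrow> \<Sigma>\<^bsup>i\<^esup> W"
      have "h \<cdot> be X = zero_mor T (Dapp X) (\<Sigma>\<^bsup>i\<^esup> W)"
        by (rule hom_zeroD[OF hom_zero_Z_D[OF W D_ZD[OF Dapp_D[OF X]] i]]) (use h ta in simp)
      then obtain k where k: "k \<Colon> \<Sigma> X \<rightarrow> \<Sigma>\<^bsup>i\<^esup> W" "h = k \<cdot> ga X"
        by (rule tri_extend2[OF t h])
      have "\<Sigma>\<^bsup>j\<^esup> W \<in> Obj T" using WO by simp
      then obtain k' where k': "k' \<Colon> X \<rightarrow> \<Sigma>\<^bsup>j\<^esup> W" "\<sigma> k' = k"
        using k(1)[unfolded j funpow.simps comp_apply] O(2) by (elim shift_fullE)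
      have "k' \<cdot> ident T X = k'" using k' by simp
      show "h = zero_mor T (tw X) (\<Sigma>\<^bsup>i\<^esup> W)"
      proof (cases "j = 0")
        case True
        then have "k' \<Colon> X \<rightarrow> W" using k'(1) by simp
        then obtain m where m: "m \<Colon> Dapp X \<rightarrow> W" "k' = m \<cdot> al X" by (rule al_extend[OF X W])
        have "h = \<sigma> m \<cdot> \<sigma> (al X) \<cdot> ga X"
          unfolding k(2) k'(2)[symmetric] m(2) using m(1) ta by simp
        then show ?thesis using tri_cmp_zero3[OF t] m(1) ta O j True WO by simp
      next
        case False
        have "k' = zero_mor T X (\<Sigma>\<^bsup>j\<^esup> W)"
          by (rule hom_zeroD[OF hom_zero_Z_D[OF W X]]) (use k' False i j in simp_all)
        then show ?thesis unfolding k(2) k'(2)[symmetric] using ta O WO j by simp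
      qed
    qed
  qed
  then show ?thesis using Z_left[OF O(1)] by auto
qed

lemma tw_ObjD [simp]: "X \<in> Z \<Longrightarrow> tw X \<in> Obj T"
  using tw_Z Z_ObjD by blast

text \<open>Congruence modulo \<open>[D]\<close>, phrased by adding a correction term so that the
  term is at hand in later proofs. \<open>cls_mem_iff\<close> identifies its classes with those of
  \<open>ideal_class\<close>.\<close>

definition cong :: "'m \<Rightarrow> 'm \<Rightarrow> bool" (infix \<open>\<approx>\<close> 50)
  where "f \<approx> f' \<longleftrightarrow> arr T f \<and> (\<exists>t. t \<Colon> src T f \<rightarrow> tgt T f \<and> factors D t \<and> f \<boxplus> t = f')"

lemma congI: "\<lbrakk>f \<Colon> X \<rightarrow> Y; t \<Colon> X \<rightarrow> Y; factors D t; f \<boxplus> t = f'\<rbrakk> \<Longrightarrow> f \<approx> f'"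
  unfolding cong_def by auto

lemma congE:
  assumes "f \<approx> f'" "f \<Colon> X \<rightarrow> Y"
  obtains t where "t \<Colon> X \<rightarrow> Y" "factors D t" "f \<boxplus> t = f'" "f' \<Colon> X \<rightarrow> Y"
proof -
  obtain t where t: "t \<Colon> src T f \<rightarrow> tgt T f" "factors D t" "f \<boxplus> t = f'"
    using assms(1) unfolding cong_def by blast
  have "src T f = X" "tgt T f = Y" using assms(2) by simp_all
  then have t': "t \<Colon> X \<rightarrow> Y" using t(1) by simp
  have "f' \<Colon> X \<rightarrow> Y" unfolding t(3)[symmetric] using assms(2) t' by simp
  then show ?thesis using t' t by (intro that)
qed

lemma cong_refl: "f \<Colon> X \<rightarrow> Y \<Longrightarrow> f \<approx> f"
  by (rule congI[of f X Y "zero_mor T X Y"]) (simp_all add: factors_zero[OF D_sub])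

lemma cong_sym:
  assumes "f \<approx> g"
  shows "g \<approx> f"
proof -
  define X Y where "X = src T f" and "Y = tgt T f"
  have f: "f \<Colon> X \<rightarrow> Y" using assms unfolding cong_def X_def Y_def by simp
  obtain t where t: "t \<Colon> X \<rightarrow> Y" "factors D t" "f \<boxplus> t = g" "g \<Colon> X \<rightarrow> Y" by (rule congE[OF assms f])
  show ?thesis
  proof (rule congI[OF t(4) _ factors_neg[OF t(2)]])
    show "g \<boxplus> \<boxminus> t = f" unfolding t(3)[symmetric] using f t(1) by simp
  qed (use t in simp)
qed

lemma cong_trans:
  assumes "f \<approx> g" "g \<approx> h"
  shows "f \<approx> h"
proof -
  define X Y where "X = src T f" and "Y = tgt T f"
  have f: "f \<Colon> X \<rightarrow> Y" using assms unfolding cong_def X_def Y_def by simp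
  obtain t where t: "t \<Colon> X \<rightarrow> Y" "factors D t" "f \<boxplus> t = g" "g \<Colon> X \<rightarrow> Y" by (rule congE[OF assms(1) f])
  obtain s where s: "s \<Colon> X \<rightarrow> Y" "factors D s" "g \<boxplus> s = h" "h \<Colon> X \<rightarrow> Y" by (rule congE[OF assms(2) t(4)])
  show ?thesis
  proof (rule congI[OF f])
    show "factors D (t \<boxplus> s)" by (rule factors_add[OF D_sub t(2) s(2)]) (use t(1) s(1) in simp_all)
    show "f \<boxplus> (t \<boxplus> s) = h"
      unfolding s(3)[symmetric] t(3)[symmetric] using f t(1) s(1) by simp
  qed (use t(1) s(1) in simp)
qed

lemma cong_arrow: "\<lbrakk>f \<approx> g; f \<Colon> X \<rightarrow> Y\<rbrakk> \<Longrightarrow> g \<Colon> X \<rightarrow> Y"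
  by (erule congE) assumption+

lemma cong_factors: "\<lbrakk>f \<Colon> X \<rightarrow> Y; factors D f\<rbrakk> \<Longrightarrow> f \<approx> zero_mor T X Y"
  by (rule cong_sym, rule congI[of _ X Y f]) simp_all

lemma factors_cong: 
  assumes "zero_mor T X Y \<approx> f" "X \<in> Obj T" "Y \<in> Obj T"
  shows "factors D f"
proof -
  have z: "zero_mor T X Y \<Colon> X \<rightarrow> Y" using assms(2,3) by simp
  obtain t where t: "t \<Colon> X \<rightarrow> Y" "factors D t" "zero_mor T X Y \<boxplus> t = f"
    by (rule congE[OF assms(1) z])
  then show ?thesis by simp
qed

lemma cong_add:
  assumes "f \<approx> f'" "g \<approx> g'" "f \<Colon> X \<rightarrow> Y" "g \<Colon> X \<rightarrow> Y"
  shows "f \<boxplus> g \<approx> f' \<boxplus> g'"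
proof -
  obtain t where t: "t \<Colon> X \<rightarrow> Y" "factors D t" "f \<boxplus> t = f'" by (rule congE[OF assms(1,3)])
  obtain s where s: "s \<Colon> X \<rightarrow> Y" "factors D s" "g \<boxplus> s = g'" by (rule congE[OF assms(2,4)])
  show ?thesis
  proof (rule congI[of _ X Y])
    show "factors D (t \<boxplus> s)" by (rule factors_add[OF D_sub t(2) s(2)]) (use t(1) s(1) in simp_all)
    show "f \<boxplus> g \<boxplus> (t \<boxplus> s) = f' \<boxplus> g'"
      unfolding s(3)[symmetric] t(3)[symmetric] using assms(3,4) t(1) s(1)
      by (simp add: add_left_commute[of g t])
  qed (use t(1) s(1) assms(3,4) in simp_all)
qed

lemma cong_cmp:
  assumes "f \<approx> f'" "g \<approx> g'" "f \<Colon> X \<rightarrow> Y" "g \<Colon> Y \<rightarrow> W"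
  shows "g \<cdot> f \<approx> g' \<cdot> f'"
proof -
  obtain t where t: "t \<Colon> X \<rightarrow> Y" "factors D t" "f \<boxplus> t = f'" "f' \<Colon> X \<rightarrow> Y" by (rule congE[OF assms(1,3)])
  obtain s where s: "s \<Colon> Y \<rightarrow> W" "factors D s" "g \<boxplus> s = g'" by (rule congE[OF assms(2,4)])
  have "g \<cdot> f \<approx> g \<cdot> f'"
  proof (rule congI[of _ X W])
    show "factors D (g \<cdot> t)" by (rule factors_cmp_left[OF t(2)]) (use assms(4) t(1) in simp_all)
    show "g \<cdot> f \<boxplus> g \<cdot> t = g \<cdot> f'"
      unfolding t(3)[symmetric] using assms(3,4) t(1) by (simp add: cmp_add_right)
  qed (use t(1) assms(3,4) in simp_all)
  moreover have "g \<cdot> f' \<approx> g' \<cdot> f'"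
  proof (rule congI[of _ X W])
    show "factors D (s \<cdot> f')" by (rule factors_cmp_right[OF s(2)]) (use t(4) s(1) in simp_all)
    show "g \<cdot> f' \<boxplus> s \<cdot> f' = g' \<cdot> f'"
      unfolding s(3)[symmetric] using assms(4) t(4) s(1) by (simp add: cmp_add_left)
  qed (use s(1) t(4) assms(4) in simp_all)
  ultimately show ?thesis by (rule cong_trans)
qed

text \<open>
  \<open>h\<close> represents \<open>f\<langle>1\<rangle>\<close>. The middle component of a morphism of
  triangles is not needed: the condition on \<open>\<gamma>\<close> alone determines \<open>h\<close> modulo \<open>[D]\<close>.
\<close>

definition tr :: "'o \<Rightarrow> 'o \<Rightarrow> 'm \<Rightarrow> 'm \<Rightarrow> bool"
  where "tr X Y f h \<longleftrightarrow> X \<in> Z \<and> Y \<in> Z \<and> f \<Colon> X \<rightarrow> Y \<and> h \<Colon> tw X \<rightarrow> tw Y \<and> ga Y \<cdot> h = \<sigma> f \<cdot> ga X"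

lemma sextuple_mor_tr:
  assumes "X \<in> Z" "Y \<in> Z" "sextuple_mor T (A X) (A Y) f g h"
  shows "tr X Y f h"
proof -
  have "f \<in> mor T X Y" "h \<in> mor T (tw X) (tw Y)" "ga Y \<cdot> h = \<sigma> f \<cdot> ga X"
    using assms(3) A_left_approximation(1)[OF assms(1)] A_left_approximation(1)[OF assms(2)] by simp_all
  then show ?thesis
    unfolding tr_def arrow_def using assms(1,2) Z_ObjD tw_ObjD by blast
qed

lemma sextuple_mor_exists:
  assumes X: "X \<in> Z" and Y: "Y \<in> Z" and f: "f \<Colon> X \<rightarrow> Y"
  obtains g h where "sextuple_mor T (A X) (A Y) f g h"
proof -
  note X1 = A_arrow[OF X] and Y1 = A_arrow[OF Y]
  have af: "al Y \<cdot> f \<Colon> X \<rightarrow> Dapp Y" using f Y1 by simp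
  obtain g where g: "g \<Colon> Dapp X \<rightarrow> Dapp Y" "al Y \<cdot> f = g \<cdot> al X"
    by (rule al_extend[OF X Dapp_D[OF Y] af])
  obtain h where h: "h \<Colon> tw X \<rightarrow> tw Y" "h \<cdot> be X = be Y \<cdot> g" "\<sigma> f \<cdot> ga X = ga Y \<cdot> h"
    by (rule tri_complete[OF A_tri[OF X] A_tri[OF Y] f g(1) g(2)[symmetric]])
  have "sextuple_mor T (A X) (A Y) f g h"
    unfolding A_left_approximation(1)[OF X] A_left_approximation(1)[OF Y] sextuple_mor.simps
    using f g h unfolding arrow_def by simp
  then show ?thesis by (rule that)
qed

lemma tr_exists:
  assumes "X \<in> Z" "Y \<in> Z" "f \<Colon> X \<rightarrow> Y"
  obtains h where "tr X Y f h"
  by (rule sextuple_mor_exists[OF assms]) (use sextuple_mor_tr assms(1,2) that in blast)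

text \<open>If \<open>f\<close> factors through \<open>D\<close>, it extends along the approximation
  of \<open>X\<close>, so \<open>ga Y \<cdot> h\<close> vanishes and \<open>h\<close> lifts to
  \<open>Dapp Y\<close>. If \<open>h\<close> factors through \<open>D\<close>, then
  \<open>(D, Y[1]) = 0\<close> kills \<open>ga Y \<cdot> h\<close>, so the shift of \<open>f\<close>
  extends along that of \<open>al X\<close>, and \<open>f\<close> factors through
  \<open>Dapp X\<close>.\<close>

lemma tr_factors_iff:
  assumes "tr X Y f h"
  shows "factors D h \<longleftrightarrow> factors D f"
proof -
  have X: "X \<in> Z" "Y \<in> Z" "X \<in> Obj T" "Y \<in> Obj T" and f: "f \<Colon> X \<rightarrow> Y" "h \<Colon> tw X \<rightarrow> tw Y"
    and e: "ga Y \<cdot> h = \<sigma> f \<cdot> ga X"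
    using assms Z_ObjD unfolding tr_def by blast+
  note tX = A_tri[OF X(1)] and tY = A_tri[OF X(2)] and aX = A_arrow[OF X(1)] and aY = A_arrow[OF X(2)]
  show ?thesis
  proof
    assume "factors D f"
    then obtain W u v where w: "W \<in> D" "W \<in> Obj T" "u \<Colon> X \<rightarrow> W" "v \<Colon> W \<rightarrow> Y" "v \<cdot> u = f"
      by (rule factorsE[OF _ f(1)])
    obtain m where m: "m \<Colon> Dapp X \<rightarrow> W" "u = m \<cdot> al X" by (rule al_extend[OF X(1) w(1,3)])
    have "\<sigma> f \<cdot> ga X = \<sigma> v \<cdot> \<sigma> m \<cdot> \<sigma> (al X) \<cdot> ga X"
      unfolding w(5)[symmetric] m(2) using w(4) m(1) aX by simp
    also have "\<dots> = zero_mor T (tw X) (\<Sigma> Y)"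
      using tri_cmp_zero3[OF tX] w(4) m(1) aX X by simp
    finally have "ga Y \<cdot> h = zero_mor T (tw X) (\<Sigma> Y)" using e by simp
    then obtain k where k: "k \<Colon> tw X \<rightarrow> Dapp Y" "h = be Y \<cdot> k" by (rule tri_lift2[OF tY f(2)])
    show "factors D h" by (rule factorsI[OF Dapp_D[OF X(2)] k(1) aY(2) k(2)[symmetric]])
  next
    assume "factors D h"
    then obtain W u v where w: "W \<in> D" "W \<in> Obj T" "u \<Colon> tw X \<rightarrow> W" "v \<Colon> W \<rightarrow> tw Y" "v \<cdot> u = h"
      by (rule factorsE[OF _ f(2)])
    have v0: "ga Y \<cdot> v = zero_mor T W (\<Sigma> Y)"
      by (rule hom_zeroD[OF hom_zero_D_Z1[OF w(1) X(2)]]) (use w(4) aY in simp)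
    have sf: "\<sigma> f \<Colon> \<Sigma> X \<rightarrow> \<Sigma> Y" using f by simp
    have "\<sigma> f \<cdot> ga X = ga Y \<cdot> v \<cdot> u" using e w(5) by simp
    also have "\<dots> = zero_mor T (tw X) (\<Sigma> Y)"
      using w(2,3,4) aY X by (simp add: cmp_reassoc[OF v0])
    finally obtain k where k: "k \<Colon> \<Sigma> (Dapp X) \<rightarrow> \<Sigma> Y" "\<sigma> f = k \<cdot> \<sigma> (al X)"
      by (rule tri_extend3[OF tX sf])
    obtain k' where k': "k' \<Colon> Dapp X \<rightarrow> Y" "\<sigma> k' = k"
      by (rule shift_fullE[OF k(1) D_ObjD[OF Dapp_D[OF X(1)]] X(4)])
    have "\<sigma> (k' \<cdot> al X) = \<sigma> f" using k'(1) aX by (simp add: k(2) k'(2))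
    then have "k' \<cdot> al X = f" by (rule shift_faithful) (use k'(1) aX f in simp_all)
    then show "factors D f" by (rule factorsI[OF Dapp_D[OF X(1)] aX(1) k'(1)])
  qed
qed

text \<open>The relation is additive, so this is \<open>tr_factors_iff\<close> for the differences.
  Read from right to left it says that \<open><1>\<close> is well defined on classes, read from left
  to right that it is faithful.\<close>

lemma tr_cong_iff:
  assumes "tr X Y f h" "tr X Y f' h'"
  shows "h \<approx> h' \<longleftrightarrow> f \<approx> f'"
proof -
  have X: "X \<in> Z" "Y \<in> Z" "X \<in> Obj T" "Y \<in> Obj T" and f: "f \<Colon> X \<rightarrow> Y" "h \<Colon> tw X \<rightarrow> tw Y"
    and f': "f' \<Colon> X \<rightarrow> Y" "h' \<Colon> tw X \<rightarrow> tw Y"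
    and e: "ga Y \<cdot> h = \<sigma> f \<cdot> ga X" "ga Y \<cdot> h' = \<sigma> f' \<cdot> ga X"
    using assms Z_ObjD unfolding tr_def by blast+
  note aX = A_arrow[OF X(1)] and aY = A_arrow[OF X(2)]
  define t s where "t = \<boxminus> f \<boxplus> f'" and "s = \<boxminus> h \<boxplus> h'"
  have t: "t \<Colon> X \<rightarrow> Y" "f \<boxplus> t = f'" and s: "s \<Colon> tw X \<rightarrow> tw Y" "h \<boxplus> s = h'"
    unfolding t_def s_def using f f' by simp_all
  have "ga Y \<cdot> s = \<sigma> t \<cdot> ga X"
    unfolding t_def s_def using f f' aX aY
    by (simp add: cmp_add_left cmp_add_right functor_add[OF Shift_additive] e)
  then have "tr X Y t s" unfolding tr_def using X t s by blast
  then have st: "factors D s \<longleftrightarrow> factors D t" by (rule tr_factors_iff)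
  have cong_diff: "u \<approx> u' \<longleftrightarrow> factors D (\<boxminus> u \<boxplus> u')" if u: "u \<Colon> V \<rightarrow> W" "u' \<Colon> V \<rightarrow> W" for u u' V W
  proof
    assume "u \<approx> u'"
    then obtain r where r: "r \<Colon> V \<rightarrow> W" "factors D r" "u \<boxplus> r = u'" by (rule congE[OF _ u(1)])
    have "\<boxminus> u \<boxplus> u' = r" unfolding r(3)[symmetric] using u r(1) by simp
    then show "factors D (\<boxminus> u \<boxplus> u')" using r(2) by simp
  next
    assume "factors D (\<boxminus> u \<boxplus> u')"
    then show "u \<approx> u'" by (rule congI[OF u(1), rotated]) (use u in simp_all)
  qed
  show ?thesis using st cong_diff[OF f(2) f'(2)] cong_diff[OF f(1) f'(1)] unfolding s_def t_def by blast
qed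

text \<open>Since \<open>(D, Y[1]) = 0\<close>, the composite \<open>ga Y \<cdot> h\<close> kills
  \<open>be X\<close> and therefore comes from a morphism between the shifts of \<open>X\<close> and
  \<open>Y\<close>.\<close>

lemma tr_full:
  assumes X: "X \<in> Z" and Y: "Y \<in> Z" and h: "h \<Colon> tw X \<rightarrow> tw Y"
  obtains f where "tr X Y f h"
proof -
  note tX = A_tri[OF X] and aX = A_arrow[OF X] and aY = A_arrow[OF Y]
  have g: "ga Y \<cdot> h \<Colon> tw X \<rightarrow> \<Sigma> Y" using h aY by simp
  have "(ga Y \<cdot> h) \<cdot> be X = zero_mor T (Dapp X) (\<Sigma> Y)"
    by (rule hom_zeroD[OF hom_zero_D_Z1[OF Dapp_D[OF X] Y]]) (use h aX aY in simp)
  then obtain k where k: "k \<Colon> \<Sigma> X \<rightarrow> \<Sigma> Y" "ga Y \<cdot> h = k \<cdot> ga X" by (rule tri_extend2[OF tX g])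
  obtain f where "f \<Colon> X \<rightarrow> Y" "\<sigma> f = k" by (rule shift_fullE[OF k(1) Z_ObjD[OF X] Z_ObjD[OF Y]])
  then have "tr X Y f h" unfolding tr_def using X Y h k by blast
  then show ?thesis by (rule that)
qed

lemma tr_ident: "X \<in> Z \<Longrightarrow> tr X X (ident T X) (ident T (tw X))"
  unfolding tr_def using A_arrow(3)[of X] Z_ObjD[of X] by simp

lemma tr_cmp:
  assumes "tr X Y f h" "tr Y W g k"
  shows "tr X W (g \<cdot> f) (k \<cdot> h)"
proof -
  have X: "X \<in> Z" "Y \<in> Z" "W \<in> Z" and f: "f \<Colon> X \<rightarrow> Y" "h \<Colon> tw X \<rightarrow> tw Y"
    and g: "g \<Colon> Y \<rightarrow> W" "k \<Colon> tw Y \<rightarrow> tw W"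
    and e: "ga Y \<cdot> h = \<sigma> f \<cdot> ga X" "ga W \<cdot> k = \<sigma> g \<cdot> ga Y"
    using assms unfolding tr_def by blast+
  have "ga W \<cdot> k \<cdot> h = \<sigma> (g \<cdot> f) \<cdot> ga X"
    using f g A_arrow[OF X(1)] A_arrow[OF X(2)] A_arrow[OF X(3)]
    by (simp add: cmp_reassoc[OF e(2)] e(1))
  then show ?thesis unfolding tr_def using X f g by simp
qed

text \<open>Complete a right \<open>D\<close>-approximation \<open>b\<close> of \<open>Y\<close> to
  a triangle starting at \<open>X\<close>. Then \<open>X\<close> lies in \<open>Z\<close>, the case
  of index 1 being the approximation property of \<open>b\<close>, and \<open>a\<close> is a left
  \<open>D\<close>-approximation because \<open>(Y, D[1]) = 0\<close>. Two left approximations of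
  \<open>X\<close> have cones that agree modulo \<open>[D]\<close>.\<close>

lemma tw_ess_surj:
  assumes Y: "Y \<in> Z"
  obtains X h h' where "X \<in> Z" "h \<Colon> tw X \<rightarrow> Y" "h' \<Colon> Y \<rightarrow> tw X"
    "h' \<cdot> h \<approx> ident T (tw X)" "h \<cdot> h' \<approx> ident T Y"
proof -
  have YO: "Y \<in> Obj T" using Y by (rule Z_ObjD)
  obtain W b where b: "right_approximation T D W Y b"
    using D_ff YO unfolding functorially_finite_def by blast
  have W: "W \<in> D" "W \<in> Obj T" and bWY: "b \<Colon> W \<rightarrow> Y"
    using b D_ObjD YO unfolding right_approximation_def arrow_def by blast+
  have blift: "\<exists>k. k \<Colon> V \<rightarrow> W \<and> g = b \<cdot> k" if "V \<in> D" "g \<Colon> V \<rightarrow> Y" for V g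
    using b that W unfolding right_approximation_def arrow_def by blast
  obtain X a c where t: "(X, W, Y, a, b, c) \<in> Tri T" by (rule tri_cocone[OF bWY])
  note ta = tri_arrow[OF t]
  have XO: "X \<in> Obj T" using ta by simp
  have "hom_zero V (\<Sigma>\<^bsup>i\<^esup> X)" if i: "0 < i" "i < n" and V: "V \<in> D" for i V
  proof -
    have VO: "V \<in> Obj T" using V by (rule D_ObjD)
    obtain j where j: "i = Suc j" using i(1) gr0_implies_Suc by blast
    \<comment> \<open>Hom from \<open>V\<close> into \<open>X[i]\<close> is computed as Hom from
      \<open>V[-j]\<close> into \<open>X[1]\<close>, so that the triangle can be used without
      shifting it.\<close>
    have "hom_zero (unshift j V) (\<Sigma> X)"
    proof (rule hom_zeroI)
      fix h assume h: "h \<Colon> unshift j V \<rightarrow> \<Sigma> X"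
      have "hom_zero V (\<Sigma>\<^bsup>j\<^esup> (\<Sigma> W))"
        using hom_zero_D_Z[OF V D_ZD[OF W(1)] i] j by (simp add: funpow_swap1)
      then have "hom_zero (unshift j V) (\<Sigma> W)" using hom_zero_unshift VO W(2) by simp
      then have "\<sigma> a \<cdot> h = zero_mor T (unshift j V) (\<Sigma> W)"
        by (rule hom_zeroD) (use h ta in simp)
      then obtain k where k: "k \<Colon> unshift j V \<rightarrow> Y" "h = c \<cdot> k" by (rule tri_lift3[OF t h])
      show "h = zero_mor T (unshift j V) (\<Sigma> X)"
      proof (cases "j = 0")
        case True
        then have "k \<Colon> V \<rightarrow> Y" using k(1) by simp
        then obtain m where m: "m \<Colon> V \<rightarrow> W" "k = b \<cdot> m" using blift[OF V] by blast
        show ?thesis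
          unfolding k(2) m(2) using m(1) ta True XO VO W(2) by (simp add: cmp_reassoc[OF tri_cmp_zero2[OF t]])
      next
        case False
        then have "hom_zero V (\<Sigma>\<^bsup>j\<^esup> Y)" using hom_zero_D_Z[OF V Y, of j] i j by simp
        then have "hom_zero (unshift j V) Y" using hom_zero_unshift VO YO by simp
        then have "k = zero_mor T (unshift j V) Y" using k(1) by (rule hom_zeroD)
        then show ?thesis unfolding k(2) using ta VO by simp
      qed
    qed (use VO XO in simp_all)
    then have "hom_zero V (\<Sigma>\<^bsup>j\<^esup> (\<Sigma> X))" using hom_zero_unshift VO XO by simp
    then show ?thesis using j by (simp add: funpow_swap1)
  qed
  then have X: "X \<in> Z" using Z_right[OF XO] by auto
  have aext: "\<exists>k. k \<Colon> W \<rightarrow> V \<and> u = k \<cdot> a" if V: "V \<in> D" and u: "u \<Colon> X \<rightarrow> V" for V u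
  proof -
    have VO: "V \<in> Obj T" using V by (rule D_ObjD)
    have su: "\<sigma> u \<Colon> \<Sigma> X \<rightarrow> \<Sigma> V" using u by simp
    have "\<sigma> u \<cdot> c = zero_mor T Y (\<Sigma> V)"
      by (rule hom_zeroD[OF hom_zero_Z_D1[OF V Y]]) (use u ta in simp)
    then obtain k where k: "k \<Colon> \<Sigma> W \<rightarrow> \<Sigma> V" "\<sigma> u = k \<cdot> \<sigma> a" by (rule tri_extend3[OF t su])
    obtain k' where k': "k' \<Colon> W \<rightarrow> V" "\<sigma> k' = k" by (rule shift_fullE[OF k(1) W(2) VO])
    have "\<sigma> u = \<sigma> (k' \<cdot> a)" using k'(1) ta by (simp add: k(2) k'(2))
    then have "u = k' \<cdot> a" by (rule shift_faithful) (use k'(1) ta u in simp_all)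
    then show ?thesis using k'(1) by blast
  qed
  note tX = A_tri[OF X] and aX = A_arrow[OF X]
  have idX: "ident T X \<Colon> X \<rightarrow> X" using XO by simp
  obtain g where g: "g \<Colon> Dapp X \<rightarrow> W" "a = g \<cdot> al X" by (rule al_extend[OF X W(1) ta(1)])
  have ge: "g \<cdot> al X = a \<cdot> ident T X" using g(2) ta by simp
  obtain h where h: "h \<Colon> tw X \<rightarrow> Y" "\<sigma> (ident T X) \<cdot> ga X = c \<cdot> h"
    by (rule tri_complete[OF tX t idX g(1) ge])
  obtain g' where g': "g' \<Colon> W \<rightarrow> Dapp X" "al X = g' \<cdot> a" using aext[OF Dapp_D[OF X] aX(1)] by blast
  have ge': "g' \<cdot> a = al X \<cdot> ident T X" using g'(2) aX by simp
  obtain h' where h': "h' \<Colon> Y \<rightarrow> tw X" "\<sigma> (ident T X) \<cdot> c = ga X \<cdot> h'"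
    by (rule tri_complete[OF t tX idX g'(1) ge'])
  have ch: "c \<cdot> h = ga X" and gh: "ga X \<cdot> h' = c" using h(2) h'(2) ta aX XO by simp_all
  \<comment> \<open>Both composites are compatible with the maps to \<open>X[1]\<close>. Their
    differences from the identities are killed by those maps, hence lift to the middle terms of the
    triangles, which lie in \<open>D\<close>.\<close>
  have "h' \<cdot> h \<approx> ident T (tw X)"
  proof -
    have u: "ident T (tw X) \<boxplus> \<boxminus> (h' \<cdot> h) \<Colon> tw X \<rightarrow> tw X"
      using h(1) h'(1) by simp
    have "ga X \<cdot> (ident T (tw X) \<boxplus> \<boxminus> (h' \<cdot> h)) = zero_mor T (tw X) (\<Sigma> X)"
      using h(1) h'(1) aX by (simp add: cmp_add_right cmp_reassoc[OF gh] ch)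
    then obtain k where k: "k \<Colon> tw X \<rightarrow> Dapp X" "ident T (tw X) \<boxplus> \<boxminus> (h' \<cdot> h) = be X \<cdot> k"
      by (rule tri_lift2[OF tX u])
    show ?thesis
    proof (rule congI[OF _ u])
      show "factors D (ident T (tw X) \<boxplus> \<boxminus> (h' \<cdot> h))"
        by (rule factorsI[OF Dapp_D[OF X] k(1) aX(2) k(2)[symmetric]])
    qed (use h(1) h'(1) in simp_all)
  qed
  moreover have "h \<cdot> h' \<approx> ident T Y"
  proof -
    have u: "ident T Y \<boxplus> \<boxminus> (h \<cdot> h') \<Colon> Y \<rightarrow> Y"
      using h(1) h'(1) by simp
    have "c \<cdot> (ident T Y \<boxplus> \<boxminus> (h \<cdot> h')) = zero_mor T Y (\<Sigma> X)"
      using h(1) h'(1) ta by (simp add: cmp_add_right cmp_reassoc[OF ch] gh)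
    then obtain k where k: "k \<Colon> Y \<rightarrow> W" "ident T Y \<boxplus> \<boxminus> (h \<cdot> h') = b \<cdot> k"
      by (rule tri_lift2[OF t u])
    show ?thesis
    proof (rule congI[OF _ u])
      show "factors D (ident T Y \<boxplus> \<boxminus> (h \<cdot> h'))"
        by (rule factorsI[OF W(1) k(1) ta(2) k(2)[symmetric]])
    qed (use h(1) h'(1) in simp_all)
  qed
  ultimately show ?thesis using that[OF X h(1) h'(1)] by blast
qed

text \<open>In terms of \<open>U\<close>: every morphism from \<open>X\<close> to \<open>Y\<close> in \<open>Z/[D]\<close> vanishes.\<close>

definition stably_zero :: "'o \<Rightarrow> 'o \<Rightarrow> bool"
  where "stably_zero X Y \<longleftrightarrow> (\<forall>f. f \<Colon> X \<rightarrow> Y \<longrightarrow> factors D f)"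

text \<open>The map from \<open>(X, tw Y)\<close> to \<open>(X, Y[1])\<close> is onto because
  \<open>(X, D[1]) = 0\<close>. Its kernel consists of the morphisms factoring through
  \<open>D\<close>: those lifting to \<open>Dapp Y\<close> lie in it by construction, and all others
  through \<open>D\<close> because \<open>(D, Y[1]) = 0\<close>.\<close>

lemma stably_zero_tw:
  assumes X: "X \<in> Z" and Y: "Y \<in> Z"
  shows "stably_zero X (tw Y) \<longleftrightarrow> hom_zero X (\<Sigma> Y)"
proof
  note t = A_tri[OF Y] and ta = A_arrow[OF Y]
  have O: "X \<in> Obj T" "Y \<in> Obj T" "\<Sigma> Y \<in> Obj T" using X Y Z_ObjD by simp_all
  show "hom_zero X (\<Sigma> Y)" if z: "stably_zero X (tw Y)"
  proof (rule hom_zeroI[OF O(1,3)])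
    fix h assume h: "h \<Colon> X \<rightarrow> \<Sigma> Y"
    have "\<sigma> (al Y) \<cdot> h = zero_mor T X (\<Sigma> (Dapp Y))"
      by (rule hom_zeroD[OF hom_zero_Z_D1[OF Dapp_D[OF Y] X]]) (use h ta in simp)
    then obtain k where k: "k \<Colon> X \<rightarrow> tw Y" "h = ga Y \<cdot> k" by (rule tri_lift3[OF t h])
    then have "factors D k" using z unfolding stably_zero_def by blast
    then obtain W u v where w: "W \<in> D" "W \<in> Obj T" "u \<Colon> X \<rightarrow> W" "v \<Colon> W \<rightarrow> tw Y" "v \<cdot> u = k"
      by (rule factorsE[OF _ k(1)])
    have v0: "ga Y \<cdot> v = zero_mor T W (\<Sigma> Y)"
      by (rule hom_zeroD[OF hom_zero_D_Z1[OF w(1) Y]]) (use w(4) ta in simp)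
    show "h = zero_mor T X (\<Sigma> Y)"
      unfolding k(2) w(5)[symmetric] using w(2-4) ta O by (simp add: cmp_reassoc[OF v0])
  qed
next
  note t = A_tri[OF Y] and ta = A_arrow[OF Y]
  assume z: "hom_zero X (\<Sigma> Y)"
  show "stably_zero X (tw Y)"
    unfolding stably_zero_def
  proof (intro allI impI)
    fix h assume h: "h \<Colon> X \<rightarrow> tw Y"
    have "ga Y \<cdot> h = zero_mor T X (\<Sigma> Y)" by (rule hom_zeroD[OF z]) (use h ta in simp)
    then obtain k where k: "k \<Colon> X \<rightarrow> Dapp Y" "h = be Y \<cdot> k" by (rule tri_lift2[OF t h])
    show "factors D h" by (rule factorsI[OF Dapp_D[OF Y] k(1) ta(2) k(2)[symmetric]])
  qed
qed

text \<open>At these indices \<open>(X, D[j])\<close> and \<open>(X, D[j+1])\<close> both vanish, so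
  the long exact sequence gives an isomorphism on the nose, with no passage to the quotient. The
  bound on \<open>j + 1\<close> keeps the second group in range.\<close>

lemma hom_zero_shift_tw:
  assumes X: "X \<in> Z" and Y: "Y \<in> Z" and j: "0 < j" "Suc j < n"
  shows "hom_zero X (\<Sigma>\<^bsup>j\<^esup> (tw Y)) \<longleftrightarrow> hom_zero X (\<Sigma>\<^bsup>Suc j\<^esup> Y)"
proof -
  note t = A_tri[OF Y] and ta = A_arrow[OF Y]
  have O: "X \<in> Obj T" "Y \<in> Obj T" "\<Sigma> Y \<in> Obj T" "unshift j X \<in> Obj T" "tw Y \<in> Obj T" "Dapp Y \<in> Obj T"
    using X Y Z_ObjD ta by simp_all
  have "hom_zero X (\<Sigma>\<^bsup>j\<^esup> (Dapp Y))" using hom_zero_Z_D[OF Dapp_D[OF Y] X] j by simp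
  then have z0: "hom_zero (unshift j X) (Dapp Y)" using hom_zero_unshift O by simp
  have "hom_zero X (\<Sigma>\<^bsup>j\<^esup> (\<Sigma> (Dapp Y)))"
    using hom_zero_Z_D[OF Dapp_D[OF Y] X _ j(2)] by (simp add: funpow_swap1)
  then have z1: "hom_zero (unshift j X) (\<Sigma> (Dapp Y))" using hom_zero_unshift O by simp
  have "hom_zero (unshift j X) (tw Y) \<longleftrightarrow> hom_zero (unshift j X) (\<Sigma> Y)"
  proof
    assume z: "hom_zero (unshift j X) (tw Y)"
    show "hom_zero (unshift j X) (\<Sigma> Y)"
    proof (rule hom_zeroI[OF O(4,3)])
      fix h assume h: "h \<Colon> unshift j X \<rightarrow> \<Sigma> Y"
      have "\<sigma> (al Y) \<cdot> h = zero_mor T (unshift j X) (\<Sigma> (Dapp Y))"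
        by (rule hom_zeroD[OF z1]) (use h ta in simp)
      then obtain k where k: "k \<Colon> unshift j X \<rightarrow> tw Y" "h = ga Y \<cdot> k" by (rule tri_lift3[OF t h])
      show "h = zero_mor T (unshift j X) (\<Sigma> Y)"
        unfolding k(2) hom_zeroD[OF z k(1)] using ta O by simp
    qed
  next
    assume z: "hom_zero (unshift j X) (\<Sigma> Y)"
    show "hom_zero (unshift j X) (tw Y)"
    proof (rule hom_zeroI[OF O(4,5)])
      fix h assume h: "h \<Colon> unshift j X \<rightarrow> tw Y"
      have "ga Y \<cdot> h = zero_mor T (unshift j X) (\<Sigma> Y)" by (rule hom_zeroD[OF z]) (use h ta in simp)
      then obtain k where k: "k \<Colon> unshift j X \<rightarrow> Dapp Y" "h = be Y \<cdot> k" by (rule tri_lift2[OF t h])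
      show "h = zero_mor T (unshift j X) (tw Y)"
        unfolding k(2) hom_zeroD[OF z0 k(1)] using ta O by simp
    qed
  qed
  then show ?thesis using hom_zero_unshift[OF O(1,5)] hom_zero_unshift[OF O(1,3)]
    by (simp add: funpow_swap1)
qed

lemma funpow_tw_Z: "Y \<in> Z \<Longrightarrow> (tw ^^ i) Y \<in> Z"
  by (induction i) (simp_all add: tw_Z)

text \<open>The quotient enters once, at the outermost twist, which becomes a shift by
  \<open>stably_zero_tw\<close>. The remaining twists are then exchanged for shifts one at a time
  inside \<open>T\<close>.\<close>

lemma stably_zero_funpow_tw:
  assumes X: "X \<in> Z" and Y: "Y \<in> Z" and i: "0 < i" "i < n"
  shows "stably_zero X ((tw ^^ i) Y) \<longleftrightarrow> hom_zero X (\<Sigma>\<^bsup>i\<^esup> Y)"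
proof -
  have "hom_zero X (\<Sigma> ((tw ^^ k) Y)) \<longleftrightarrow> hom_zero X (\<Sigma>\<^bsup>Suc k\<^esup> Y)" if "Suc k < n" for k
  proof -
    \<comment> \<open>Generalised over the number \<open>Suc j\<close> of shifts already produced,
      which grows as the twists are consumed.\<close>
    have "hom_zero X (\<Sigma>\<^bsup>Suc j\<^esup> ((tw ^^ k) V)) \<longleftrightarrow> hom_zero X (\<Sigma>\<^bsup>Suc j + k\<^esup> V)"
      if "V \<in> Z" "Suc j + k < n" for j V
      using that
    proof (induction k arbitrary: j)
      case (Suc k)
      have "hom_zero X (\<Sigma>\<^bsup>Suc j\<^esup> (tw ((tw ^^ k) V))) \<longleftrightarrow> hom_zero X (\<Sigma>\<^bsup>Suc (Suc j)\<^esup> ((tw ^^ k) V))"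
        by (rule hom_zero_shift_tw[OF X funpow_tw_Z]) (use Suc.prems in simp_all)
      also have "\<dots> \<longleftrightarrow> hom_zero X (\<Sigma>\<^bsup>Suc (Suc j) + k\<^esup> V)"
        by (rule Suc.IH) (use Suc.prems in simp_all)
      finally show ?case by simp
    qed simp
    from this[OF Y, of 0] that show ?thesis by simp
  qed
  moreover obtain k where "i = Suc k" using i(1) gr0_implies_Suc by blast
  ultimately show ?thesis using stably_zero_tw[OF X funpow_tw_Z[OF Y, of k]] i by simp
qed

end

section \<open>The reduction as a preadditive category with shift\<close>

context reduction_setting
begin

abbreviation U :: "('k, 'o, 'm set) tri_cat"
  where "U \<equiv> reduction T D Z A"

abbreviation cls :: "'m \<Rightarrow> 'm set"
  where "cls \<equiv> ideal_class T D"

lemma cls_mem_iff: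
  assumes "f \<Colon> X \<rightarrow> Y"
  shows "f' \<in> cls f \<longleftrightarrow> f \<approx> f'"
proof
  assume "f' \<in> cls f"
  then obtain V W where V: "V \<in> Obj T" "W \<in> Obj T" "f \<in> mor T V W" "f' \<in> mor T V W"
    "f' \<ominus>\<^bsub>Hom T V W\<^esub> f \<in> factors_through T D V W"
    unfolding ideal_class_def by blast
  then have f: "f \<Colon> V \<rightarrow> W" "f' \<Colon> V \<rightarrow> W" unfolding arrow_def by blast+
  have "f' \<ominus>\<^bsub>Hom T V W\<^esub> f = f' \<boxplus> \<boxminus> f" unfolding a_minus_def using f by (simp add: Hom_neg Hom_add)
  then have "factors D (f' \<boxplus> \<boxminus> f)" using V(5) factors_through_iff[OF V(1,2) D_Obj] by simp
  then show "f \<approx> f'" by (rule congI[OF f(1), rotated]) (use f in simp_all)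
next
  assume "f \<approx> f'"
  then obtain t where t: "t \<Colon> X \<rightarrow> Y" "factors D t" "f \<boxplus> t = f'" "f' \<Colon> X \<rightarrow> Y" by (rule congE[OF _ assms])
  have X: "X \<in> Obj T" "Y \<in> Obj T" "f \<in> mor T X Y" "f' \<in> mor T X Y"
    using assms t(4) unfolding arrow_def by blast+
  have "f' \<ominus>\<^bsub>Hom T X Y\<^esub> f = f' \<boxplus> \<boxminus> f" unfolding a_minus_def using assms t(4) by (simp add: Hom_neg Hom_add)
  also have "\<dots> = \<boxminus> f \<boxplus> f'" by (rule add_commute) (use assms t(4) in simp_all)
  also have "\<dots> = t" unfolding t(3)[symmetric] using assms t(1) by simp
  finally have "f' \<ominus>\<^bsub>Hom T X Y\<^esub> f \<in> factors_through T D X Y"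
    using factors_through_iff[OF X(1,2) D_Obj] t by simp
  then show "f' \<in> cls f" unfolding ideal_class_def using X by blast
qed

lemma cls_eq_iff:
  assumes "f \<Colon> X \<rightarrow> Y"
  shows "cls f = cls g \<longleftrightarrow> f \<approx> g"
proof
  assume e: "f \<approx> g"
  have g: "g \<Colon> X \<rightarrow> Y" by (rule cong_arrow[OF e assms])
  show "cls f = cls g"
    using cls_mem_iff[OF assms] cls_mem_iff[OF g] cong_trans cong_sym e by blast
next
  assume e: "cls f = cls g"
  have f: "f \<in> cls g" using cls_mem_iff[OF assms] cong_refl[OF assms] e by blast
  then obtain V W where "V \<in> Obj T" "W \<in> Obj T" "g \<in> mor T V W" unfolding ideal_class_def by blast
  then have "g \<Colon> V \<rightarrow> W" unfolding arrow_def by blast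
  then have "g \<in> cls f" using cls_mem_iff cong_refl e by blast
  then show "f \<approx> g" using cls_mem_iff[OF assms] by blast
qed

text \<open>Operations of the quotient are unions over representatives. Such a union collapses to a
  single member once the family is constant on the class.\<close>

lemma Union_cls:
  assumes "f \<Colon> X \<rightarrow> Y" "\<And>f'. f \<approx> f' \<Longrightarrow> F f' = F f"
  shows "(\<Union>f'\<in>cls f. F f') = F f"
  using assms cls_mem_iff[OF assms(1)] cong_refl[OF assms(1)] by blast

section \<open>Operations of the quotient on representatives\<close>

lemma U_sel:
  "Obj U = Z" "Hom U = Hom (quotient_category T Z D)" "ident U = ident (quotient_category T Z D)"
  "cmp U = cmp (quotient_category T Z D)" "Shift U = reduction_shift T D Z A"
  by (simp_all add: reduction_def reduction_shift_cat_def shift_cat.extend_def lin_cat.extend_def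
      shift_cat.fields_def tri_cat.fields_def quotient_category_def)

lemma U_ident: "ident U X = cls (ident T X)"
  and U_mor: "mor U X Y = cls ` mor T X Y"
  and U_zero: "zero_mor U X Y = cls (zero_mor T X Y)"
  by (simp_all add: U_sel quotient_category_def)

lemma U_arrow_iff:
  "\<Phi> \<Colon>\<^bsub>U\<^esub> X \<rightarrow> Y \<longleftrightarrow> X \<in> Z \<and> Y \<in> Z \<and> (\<exists>f. f \<Colon> X \<rightarrow> Y \<and> \<Phi> = cls f)"
  unfolding arrow_def U_mor U_sel(1) using Z_Obj by blast

lemma U_arrow_cls: "\<lbrakk>X \<in> Z; Y \<in> Z; f \<Colon> X \<rightarrow> Y\<rbrakk> \<Longrightarrow> cls f \<Colon>\<^bsub>U\<^esub> X \<rightarrow> Y"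
  unfolding U_arrow_iff by blast

lemma U_cmp:
  assumes "f \<Colon> X \<rightarrow> Y" "g \<Colon> Y \<rightarrow> W"
  shows "cls g \<cdot>\<^bsub>U\<^esub> cls f = cls (g \<cdot> f)"
proof -
  have "cls g \<cdot>\<^bsub>U\<^esub> cls f = (\<Union>g'\<in>cls g. \<Union>f'\<in>cls f. cls (g' \<cdot> f'))"
    by (simp add: U_sel quotient_category_def)
  also have "\<dots> = (\<Union>f'\<in>cls f. cls (g \<cdot> f'))"
  proof (rule Union_cls[OF assms(2)])
    fix g' assume g': "g \<approx> g'"
    have "cls (g' \<cdot> f') = cls (g \<cdot> f')" if f': "f' \<in> cls f" for f'
    proof -
      have f'a: "f' \<Colon> X \<rightarrow> Y" using f' cong_arrow assms(1) cls_mem_iff by blast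
      have "g \<cdot> f' \<Colon> X \<rightarrow> W" using f'a assms(2) by simp
      then show ?thesis using cls_eq_iff cong_cmp[OF cong_refl[OF f'a] g' f'a assms(2)] by blast
    qed
    then show "(\<Union>f'\<in>cls f. cls (g' \<cdot> f')) = (\<Union>f'\<in>cls f. cls (g \<cdot> f'))" by blast
  qed
  also have "\<dots> = cls (g \<cdot> f)"
  proof (rule Union_cls[OF assms(1)])
    fix f' assume f': "f \<approx> f'"
    have "g \<cdot> f \<Colon> X \<rightarrow> W" using assms by simp
    then show "cls (g \<cdot> f') = cls (g \<cdot> f)"
      using cls_eq_iff cong_cmp[OF f' cong_refl[OF assms(2)] assms] by blast
  qed
  finally show ?thesis .
qed

lemma U_add:
  assumes "f \<Colon> X \<rightarrow> Y" "g \<Colon> X \<rightarrow> Y"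
  shows "cls f \<oplus>\<^bsub>Hom U X Y\<^esub> cls g = cls (f \<boxplus> g)"
proof -
  have "cls f \<oplus>\<^bsub>Hom U X Y\<^esub> cls g = (\<Union>f'\<in>cls f. \<Union>g'\<in>cls g. cls (f' \<oplus>\<^bsub>Hom T X Y\<^esub> g'))"
    by (simp add: U_sel quotient_category_def)
  also have "\<dots> = (\<Union>f'\<in>cls f. \<Union>g'\<in>cls g. cls (f' \<boxplus> g'))"
  proof -
    have "f' \<oplus>\<^bsub>Hom T X Y\<^esub> g' = f' \<boxplus> g'" if "f' \<in> cls f" for f' g'
    proof -
      have "f' \<Colon> X \<rightarrow> Y" using that cong_arrow assms(1) cls_mem_iff by blast
      then show ?thesis by (intro Hom_add) simp_all
    qed
    then show ?thesis by simp
  qed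
  also have "\<dots> = (\<Union>g'\<in>cls g. cls (f \<boxplus> g'))"
  proof (rule Union_cls[OF assms(1)])
    fix f' assume f': "f \<approx> f'"
    have "cls (f' \<boxplus> g') = cls (f \<boxplus> g')" if g': "g' \<in> cls g" for g'
    proof -
      have g'a: "g' \<Colon> X \<rightarrow> Y" using g' cong_arrow assms(2) cls_mem_iff by blast
      have "f \<boxplus> g' \<Colon> X \<rightarrow> Y" using g'a assms(1) by simp
      then show ?thesis using cls_eq_iff cong_add[OF f' cong_refl[OF g'a] assms(1) g'a] by blast
    qed
    then show "(\<Union>g'\<in>cls g. cls (f' \<boxplus> g')) = (\<Union>g'\<in>cls g. cls (f \<boxplus> g'))" by blast
  qed
  also have "\<dots> = cls (f \<boxplus> g)"
  proof (rule Union_cls[OF assms(2)])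
    fix g' assume g': "g \<approx> g'"
    have "f \<boxplus> g \<Colon> X \<rightarrow> Y" using assms by simp
    then show "cls (f \<boxplus> g') = cls (f \<boxplus> g)"
      using cls_eq_iff cong_add[OF cong_refl[OF assms(1)] g' assms] by blast
  qed
  finally show ?thesis .
qed

lemma U_preadditive: "preadditive_category U"
proof (rule preadditive_category.intro)
  fix X Y assume "X \<in> Obj U" "Y \<in> Obj U"
  then have X: "X \<in> Z" "Y \<in> Z" "X \<in> Obj T" "Y \<in> Obj T" using U_sel(1) Z_ObjD by blast+
  have mem: "\<exists>f. f \<Colon> X \<rightarrow> Y \<and> \<Phi> = cls f" if "\<Phi> \<in> mor U X Y" for \<Phi>
    using that X unfolding U_mor arrow_def by blast
  have memI: "cls f \<in> mor U X Y" if "f \<Colon> X \<rightarrow> Y" for f using that unfolding U_mor arrow_def by blast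
  have z: "zero_mor T X Y \<Colon> X \<rightarrow> Y" using X by simp
  show "abelian_group (Hom U X Y)"
  proof (rule abelian_groupI)
    fix \<Phi> \<Psi> assume "\<Phi> \<in> mor U X Y" "\<Psi> \<in> mor U X Y"
    then obtain f g where f: "f \<Colon> X \<rightarrow> Y" "g \<Colon> X \<rightarrow> Y" "\<Phi> = cls f" "\<Psi> = cls g" using mem by metis
    have fg: "f \<boxplus> g \<Colon> X \<rightarrow> Y" using f(1,2) by simp
    show "\<Phi> \<oplus>\<^bsub>Hom U X Y\<^esub> \<Psi> \<in> mor U X Y" unfolding f(3,4) U_add[OF f(1,2)] by (rule memI[OF fg])
    have "f \<boxplus> g = g \<boxplus> f" by (rule add_commute) (use f(1,2) in simp_all)
    then show "\<Phi> \<oplus>\<^bsub>Hom U X Y\<^esub> \<Psi> = \<Psi> \<oplus>\<^bsub>Hom U X Y\<^esub> \<Phi>"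
      unfolding f(3,4) U_add[OF f(1,2)] U_add[OF f(2,1)] by (rule arg_cong)
  next
    show "zero_mor U X Y \<in> mor U X Y" unfolding U_zero by (rule memI[OF z])
  next
    fix \<Phi> \<Psi> \<Theta> assume "\<Phi> \<in> mor U X Y" "\<Psi> \<in> mor U X Y" "\<Theta> \<in> mor U X Y"
    then obtain f g h where f: "f \<Colon> X \<rightarrow> Y" "g \<Colon> X \<rightarrow> Y" "h \<Colon> X \<rightarrow> Y"
      and e: "\<Phi> = cls f" "\<Psi> = cls g" "\<Theta> = cls h" using mem by metis
    have fg: "f \<boxplus> g \<Colon> X \<rightarrow> Y" "g \<boxplus> h \<Colon> X \<rightarrow> Y" using f by simp_all
    have "f \<boxplus> g \<boxplus> h = f \<boxplus> (g \<boxplus> h)" using f by simp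
    then show "\<Phi> \<oplus>\<^bsub>Hom U X Y\<^esub> \<Psi> \<oplus>\<^bsub>Hom U X Y\<^esub> \<Theta> = \<Phi> \<oplus>\<^bsub>Hom U X Y\<^esub> (\<Psi> \<oplus>\<^bsub>Hom U X Y\<^esub> \<Theta>)"
      unfolding e U_add[OF f(1,2)] U_add[OF f(2,3)] U_add[OF fg(1) f(3)] U_add[OF f(1) fg(2)]
      by (rule arg_cong)
  next
    fix \<Phi> assume "\<Phi> \<in> mor U X Y"
    then obtain f where f: "f \<Colon> X \<rightarrow> Y" "\<Phi> = cls f" using mem by metis
    show "zero_mor U X Y \<oplus>\<^bsub>Hom U X Y\<^esub> \<Phi> = \<Phi>"
      unfolding f(2) U_zero U_add[OF z f(1)] using f(1) by simp
    have nf: "\<boxminus> f \<Colon> X \<rightarrow> Y" using f(1) by simp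
    have "cls (\<boxminus> f) \<oplus>\<^bsub>Hom U X Y\<^esub> \<Phi> = zero_mor U X Y"
      unfolding f(2) U_zero U_add[OF nf f(1)] using f(1) by simp
    then show "\<exists>\<Psi>\<in>mor U X Y. \<Psi> \<oplus>\<^bsub>Hom U X Y\<^esub> \<Phi> = zero_mor U X Y" using memI[OF nf] by blast
  qed
next
  fix \<Phi> X Y X' Y' assume "\<Phi> \<Colon>\<^bsub>U\<^esub> X \<rightarrow> Y" "\<Phi> \<Colon>\<^bsub>U\<^esub> X' \<rightarrow> Y'"
  then obtain f f' where f: "f \<Colon> X \<rightarrow> Y" "f' \<Colon> X' \<rightarrow> Y'" "cls f = cls f'" unfolding U_arrow_iff by blast
  then have "f' \<Colon> X \<rightarrow> Y" using cls_eq_iff cong_arrow by blast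
  then show "X = X' \<and> Y = Y'" using f(2) by simp
next
  fix X assume "X \<in> Obj U"
  then show "ident U X \<Colon>\<^bsub>U\<^esub> X \<rightarrow> X"
    unfolding U_ident U_sel(1) using Z_ObjD by (intro U_arrow_cls) simp_all
next
  fix \<Phi> \<Psi> X Y W assume "\<Phi> \<Colon>\<^bsub>U\<^esub> X \<rightarrow> Y" "\<Psi> \<Colon>\<^bsub>U\<^esub> Y \<rightarrow> W"
  then obtain f g where f: "f \<Colon> X \<rightarrow> Y" "g \<Colon> Y \<rightarrow> W" and e: "\<Phi> = cls f" "\<Psi> = cls g" and X: "X \<in> Z" "W \<in> Z"
    unfolding U_arrow_iff by blast
  show "\<Psi> \<cdot>\<^bsub>U\<^esub> \<Phi> \<Colon>\<^bsub>U\<^esub> X \<rightarrow> W"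
    unfolding e U_cmp[OF f] using f X by (intro U_arrow_cls) simp_all
next
  fix \<Phi> X Y assume "\<Phi> \<Colon>\<^bsub>U\<^esub> X \<rightarrow> Y"
  then obtain f where f: "f \<Colon> X \<rightarrow> Y" and e: "\<Phi> = cls f" unfolding U_arrow_iff by blast
  have i: "ident T X \<Colon> X \<rightarrow> X" "ident T Y \<Colon> Y \<rightarrow> Y" using f by simp_all
  show "\<Phi> \<cdot>\<^bsub>U\<^esub> ident U X = \<Phi> \<and> ident U Y \<cdot>\<^bsub>U\<^esub> \<Phi> = \<Phi>"
    unfolding e U_ident U_cmp[OF i(1) f] U_cmp[OF f i(2)] using f by simp
next
  fix \<Phi> \<Psi> \<Theta> V X Y W assume "\<Phi> \<Colon>\<^bsub>U\<^esub> V \<rightarrow> X" "\<Psi> \<Colon>\<^bsub>U\<^esub> X \<rightarrow> Y" "\<Theta> \<Colon>\<^bsub>U\<^esub> Y \<rightarrow> W"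
  then obtain f g h where f: "f \<Colon> V \<rightarrow> X" "g \<Colon> X \<rightarrow> Y" "h \<Colon> Y \<rightarrow> W"
    and e: "\<Phi> = cls f" "\<Psi> = cls g" "\<Theta> = cls h"
    unfolding U_arrow_iff by blast
  have fg: "g \<cdot> f \<Colon> V \<rightarrow> Y" "h \<cdot> g \<Colon> X \<rightarrow> W" using f by simp_all
  have "(h \<cdot> g) \<cdot> f = h \<cdot> (g \<cdot> f)" using f by simp
  then show "(\<Theta> \<cdot>\<^bsub>U\<^esub> \<Psi>) \<cdot>\<^bsub>U\<^esub> \<Phi> = \<Theta> \<cdot>\<^bsub>U\<^esub> (\<Psi> \<cdot>\<^bsub>U\<^esub> \<Phi>)"
    unfolding e U_cmp[OF f(1,2)] U_cmp[OF f(2,3)] U_cmp[OF fg(1) f(3)] U_cmp[OF f(1) fg(2)]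
    by (rule arg_cong)
next
  fix \<Phi> \<Psi> \<Theta> X Y W assume "\<Phi> \<Colon>\<^bsub>U\<^esub> X \<rightarrow> Y" "\<Psi> \<Colon>\<^bsub>U\<^esub> Y \<rightarrow> W" "\<Theta> \<Colon>\<^bsub>U\<^esub> Y \<rightarrow> W"
  then obtain f g h where f: "f \<Colon> X \<rightarrow> Y" "g \<Colon> Y \<rightarrow> W" "h \<Colon> Y \<rightarrow> W"
    and e: "\<Phi> = cls f" "\<Psi> = cls g" "\<Theta> = cls h"
    unfolding U_arrow_iff by blast
  have fg: "g \<cdot> f \<Colon> X \<rightarrow> W" "h \<cdot> f \<Colon> X \<rightarrow> W" "g \<boxplus> h \<Colon> Y \<rightarrow> W" using f by simp_all
  have "(g \<boxplus> h) \<cdot> f = g \<cdot> f \<boxplus> h \<cdot> f" using f by (simp add: cmp_add_left)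
  then show "(\<Psi> \<oplus>\<^bsub>Hom U Y W\<^esub> \<Theta>) \<cdot>\<^bsub>U\<^esub> \<Phi> = \<Psi> \<cdot>\<^bsub>U\<^esub> \<Phi> \<oplus>\<^bsub>Hom U X W\<^esub> \<Theta> \<cdot>\<^bsub>U\<^esub> \<Phi>"
    unfolding e U_cmp[OF f(1,2)] U_cmp[OF f(1,3)] U_add[OF f(2,3)] U_add[OF fg(1,2)] U_cmp[OF f(1) fg(3)]
    by (rule arg_cong)
next
  fix \<Phi> \<Psi> \<Theta> X Y W assume "\<Phi> \<Colon>\<^bsub>U\<^esub> X \<rightarrow> Y" "\<Psi> \<Colon>\<^bsub>U\<^esub> X \<rightarrow> Y" "\<Theta> \<Colon>\<^bsub>U\<^esub> Y \<rightarrow> W"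
  then obtain f g h where f: "f \<Colon> X \<rightarrow> Y" "g \<Colon> X \<rightarrow> Y" "h \<Colon> Y \<rightarrow> W"
    and e: "\<Phi> = cls f" "\<Psi> = cls g" "\<Theta> = cls h"
    unfolding U_arrow_iff by blast
  have fg: "h \<cdot> f \<Colon> X \<rightarrow> W" "h \<cdot> g \<Colon> X \<rightarrow> W" "f \<boxplus> g \<Colon> X \<rightarrow> Y" using f by simp_all
  have "h \<cdot> (f \<boxplus> g) = h \<cdot> f \<boxplus> h \<cdot> g" using f by (simp add: cmp_add_right)
  then show "\<Theta> \<cdot>\<^bsub>U\<^esub> (\<Phi> \<oplus>\<^bsub>Hom U X Y\<^esub> \<Psi>) = \<Theta> \<cdot>\<^bsub>U\<^esub> \<Phi> \<oplus>\<^bsub>Hom U X W\<^esub> \<Theta> \<cdot>\<^bsub>U\<^esub> \<Psi>"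
    unfolding e U_cmp[OF f(1,3)] U_cmp[OF f(2,3)] U_add[OF f(1,2)] U_add[OF fg(1,2)] U_cmp[OF fg(3) f(3)]
    by (rule arg_cong)
qed

sublocale U: preadditive_category U
  by (rule U_preadditive)

lemma U_arrE:
  assumes "arr U \<Phi>"
  obtains X Y f where "X \<in> Z" "Y \<in> Z" "f \<Colon> X \<rightarrow> Y" "\<Phi> = cls f" "src U \<Phi> = X" "tgt U \<Phi> = Y"
  using U.arr_arrow[OF assms] that unfolding U_arrow_iff by blast

lemma U_hom_zero_iff:
  assumes "X \<in> Z" "Y \<in> Z"
  shows "U.hom_zero X Y \<longleftrightarrow> stably_zero X Y"
proof
  have O: "X \<in> Obj T" "Y \<in> Obj T" using assms Z_ObjD by blast+
  have z: "zero_mor T X Y \<Colon> X \<rightarrow> Y" using O by simp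
  show "stably_zero X Y" if h: "U.hom_zero X Y"
    unfolding stably_zero_def
  proof (intro allI impI)
    fix f assume f: "f \<Colon> X \<rightarrow> Y"
    have "cls (zero_mor T X Y) = cls f"
      using U.hom_zeroD[OF h U_arrow_cls[OF assms f]] unfolding U_zero by simp
    then show "factors D f" using cls_eq_iff[OF z] factors_cong O by blast
  qed
  show "U.hom_zero X Y" if h: "stably_zero X Y"
  proof (rule U.hom_zeroI)
    fix \<Phi> assume "\<Phi> \<Colon>\<^bsub>U\<^esub> X \<rightarrow> Y"
    then obtain f where f: "f \<Colon> X \<rightarrow> Y" "\<Phi> = cls f" unfolding U_arrow_iff by blast
    have "f \<approx> zero_mor T X Y" using cong_factors[OF f(1)] h f(1) unfolding stably_zero_def by blast
    then show "\<Phi> = zero_mor U X Y" unfolding U_zero f(2) cls_eq_iff[OF f(1)] .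
  qed (simp_all add: U_sel assms)
qed

lemma U_isomorphic_iff:
  assumes "X \<in> Z" "Y \<in> Z"
  shows "isomorphic U X Y \<longleftrightarrow>
    (\<exists>f g. f \<Colon> X \<rightarrow> Y \<and> g \<Colon> Y \<rightarrow> X \<and> g \<cdot> f \<approx> ident T X \<and> f \<cdot> g \<approx> ident T Y)"
proof
  have O: "X \<in> Obj U" "Y \<in> Obj U" using assms by (simp_all add: U_sel)
  assume "isomorphic U X Y"
  then obtain \<Phi> \<Psi> where p: "\<Phi> \<Colon>\<^bsub>U\<^esub> X \<rightarrow> Y" "\<Psi> \<Colon>\<^bsub>U\<^esub> Y \<rightarrow> X"
    "\<Psi> \<cdot>\<^bsub>U\<^esub> \<Phi> = ident U X" "\<Phi> \<cdot>\<^bsub>U\<^esub> \<Psi> = ident U Y"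
    using U.isomorphicE O by blast
  then obtain f g where f: "f \<Colon> X \<rightarrow> Y" "g \<Colon> Y \<rightarrow> X" and e: "\<Phi> = cls f" "\<Psi> = cls g"
    unfolding U_arrow_iff by blast
  have fg: "g \<cdot> f \<Colon> X \<rightarrow> X" "f \<cdot> g \<Colon> Y \<rightarrow> Y" using f by simp_all
  have "g \<cdot> f \<approx> ident T X" "f \<cdot> g \<approx> ident T Y"
    using p(3,4) unfolding e U_ident U_cmp[OF f] U_cmp[OF f(2,1)] cls_eq_iff[OF fg(1)] cls_eq_iff[OF fg(2)]
    by blast+
  with f show "\<exists>f g. f \<Colon> X \<rightarrow> Y \<and> g \<Colon> Y \<rightarrow> X \<and> g \<cdot> f \<approx> ident T X \<and> f \<cdot> g \<approx> ident T Y" by blast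
next
  assume "\<exists>f g. f \<Colon> X \<rightarrow> Y \<and> g \<Colon> Y \<rightarrow> X \<and> g \<cdot> f \<approx> ident T X \<and> f \<cdot> g \<approx> ident T Y"
  then obtain f g where f: "f \<Colon> X \<rightarrow> Y" "g \<Colon> Y \<rightarrow> X" and e: "g \<cdot> f \<approx> ident T X" "f \<cdot> g \<approx> ident T Y"
    by blast
  have fg: "g \<cdot> f \<Colon> X \<rightarrow> X" "f \<cdot> g \<Colon> Y \<rightarrow> Y" using f by simp_all
  show "isomorphic U X Y"
  proof (rule U.isomorphicI[OF U_arrow_cls[OF assms f(1)] U_arrow_cls[OF assms(2,1) f(2)]])
    show "cls g \<cdot>\<^bsub>U\<^esub> cls f = ident U X"
      unfolding U_ident U_cmp[OF f] cls_eq_iff[OF fg(1)] by (rule e)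
    show "cls f \<cdot>\<^bsub>U\<^esub> cls g = ident U Y"
      unfolding U_ident U_cmp[OF f(2,1)] cls_eq_iff[OF fg(2)] by (rule e)
  qed
qed

lemma U_Shift_Fob: "Fob (Shift U) X = tw X"
  unfolding U_sel(5) reduction_shift_def tw_def by (simp add: case_prod_beta)

text \<open>The defining union runs over all triangle morphisms whose first component represents the
  class. That component determines the two objects, and \<open>tr_cong_iff\<close> makes all third
  components congruent.\<close>

lemma U_Shift_Fmor:
  assumes "tr X Y f h"
  shows "Fmor (Shift U) (cls f) = cls h"
proof -
  have X: "X \<in> Z" "Y \<in> Z" and f: "f \<Colon> X \<rightarrow> Y" "h \<Colon> tw X \<rightarrow> tw Y"
    using assms unfolding tr_def by blast+
  have "{cls h' | h'. \<exists>X\<in>Z. \<exists>X'\<in>Z. \<exists>f'\<in>cls f. \<exists>g. sextuple_mor T (A X) (A X') f' g h'} = {cls h}"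
    (is "?L = _")
  proof (rule equalityI)
    show "?L \<subseteq> {cls h}"
    proof
      fix \<Phi> assume "\<Phi> \<in> ?L"
      then obtain h' X' Y' f' g where h': "\<Phi> = cls h'" "X' \<in> Z" "Y' \<in> Z" "f' \<in> cls f"
        "sextuple_mor T (A X') (A Y') f' g h'"
        by blast
      note t = sextuple_mor_tr[OF h'(2,3,5)]
      have e: "f \<approx> f'" using h'(4) cls_mem_iff[OF f(1)] by blast
      have "f' \<Colon> X \<rightarrow> Y" "f' \<Colon> X' \<rightarrow> Y'"
        using cong_arrow[OF e f(1)] t unfolding tr_def by blast+
      then have "X' = X" "Y' = Y" by simp_all
      then have "h \<approx> h'" using tr_cong_iff[OF assms] t e by blast
      then show "\<Phi> \<in> {cls h}" unfolding h'(1) using cls_eq_iff[OF f(2)] by blast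
    qed
    obtain g h' where s: "sextuple_mor T (A X) (A Y) f g h'" by (rule sextuple_mor_exists[OF X f(1)])
    have "h \<approx> h'"
      using tr_cong_iff[OF assms sextuple_mor_tr[OF X s]] cong_refl[OF f(1)] by blast
    then have "cls h = cls h'" using cls_eq_iff[OF f(2)] by blast
    moreover have "f \<in> cls f" using cls_mem_iff[OF f(1)] cong_refl[OF f(1)] by blast
    ultimately show "{cls h} \<subseteq> ?L" using X s by blast
  qed
  then show ?thesis unfolding U_sel(5) reduction_shift_def by simp
qed

text \<open>The relation \<open>r X Y f h\<close> says that \<open>h\<close> represents the value of \<open>F\<close> at the class of \<open>f\<close>.\<close>

lemma U_autoequivalenceI:
  assumes ob: "\<And>X. X \<in> Z \<Longrightarrow> Fob F X \<in> Z"
    and r: "\<And>X Y f h. r X Y f h \<Longrightarrow> f \<Colon> X \<rightarrow> Y \<and> h \<Colon> Fob F X \<rightarrow> Fob F Y"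
    and F: "\<And>X Y f h. r X Y f h \<Longrightarrow> Fmor F (cls f) = cls h"
    and ex: "\<And>X Y f. \<lbrakk>X \<in> Z; Y \<in> Z; f \<Colon> X \<rightarrow> Y\<rbrakk> \<Longrightarrow> \<exists>h. r X Y f h"
    and fl: "\<And>X Y h. \<lbrakk>X \<in> Z; Y \<in> Z; h \<Colon> Fob F X \<rightarrow> Fob F Y\<rbrakk> \<Longrightarrow> \<exists>f. r X Y f h"
    and ff: "\<And>X Y f h g k. \<lbrakk>r X Y f h; r X Y g k\<rbrakk> \<Longrightarrow> h \<approx> k \<longleftrightarrow> f \<approx> g"
    and id: "\<And>X. X \<in> Z \<Longrightarrow> r X X (ident T X) (ident T (Fob F X))"
    and cmp: "\<And>X Y W f h g k. \<lbrakk>r X Y f h; r Y W g k\<rbrakk> \<Longrightarrow> r X W (g \<cdot> f) (k \<cdot> h)"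
    and es: "\<And>Y. Y \<in> Z \<Longrightarrow> \<exists>X\<in>Z. isomorphic U (Fob F X) Y"
  shows "autoequivalence U F"
  unfolding U.autoequivalence_iff
proof (intro conjI)
  show "endofunctor U F"
  proof (rule U.endofunctorI)
    fix X assume "X \<in> Obj U"
    then have X: "X \<in> Z" by (simp add: U_sel)
    then show "Fob F X \<in> Obj U" unfolding U_sel(1) by (rule ob)
    show "Fmor F (ident U X) = ident U (Fob F X)" unfolding U_ident by (rule F[OF id[OF X]])
  next
    fix \<Phi> assume "arr U \<Phi>"
    then obtain X Y f where f: "X \<in> Z" "Y \<in> Z" "f \<Colon> X \<rightarrow> Y" "\<Phi> = cls f" "src U \<Phi> = X" "tgt U \<Phi> = Y"
      by (rule U_arrE)
    obtain h where h: "r X Y f h" using ex f(1-3) by blast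
    then have "h \<Colon> Fob F X \<rightarrow> Fob F Y" using r by blast
    then show "Fmor F \<Phi> \<Colon>\<^bsub>U\<^esub> Fob F (src U \<Phi>) \<rightarrow> Fob F (tgt U \<Phi>)"
      unfolding f(5,6) unfolding f(4) F[OF h] by (rule U_arrow_cls[OF ob[OF f(1)] ob[OF f(2)]])
  next
    fix \<Phi> \<Psi> assume p: "arr U \<Phi>" "arr U \<Psi>" "src U \<Psi> = tgt U \<Phi>"
    obtain X Y f where f: "X \<in> Z" "Y \<in> Z" "f \<Colon> X \<rightarrow> Y" "\<Phi> = cls f" "src U \<Phi> = X" "tgt U \<Phi> = Y"
      by (rule U_arrE[OF p(1)])
    obtain Y' W g where g': "Y' \<in> Z" "W \<in> Z" "g \<Colon> Y' \<rightarrow> W" "\<Psi> = cls g" "src U \<Psi> = Y'" "tgt U \<Psi> = W"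
      by (rule U_arrE[OF p(2)])
    have g: "g \<Colon> Y \<rightarrow> W" using g'(3,5) p(3) f(6) by simp
    obtain h k where h: "r X Y f h" and k: "r Y W g k" using ex f(1-3) g'(2) g by meson
    have hk: "h \<Colon> Fob F X \<rightarrow> Fob F Y" "k \<Colon> Fob F Y \<rightarrow> Fob F W" using r h k by blast+
    show "Fmor F (\<Psi> \<cdot>\<^bsub>U\<^esub> \<Phi>) = Fmor F \<Psi> \<cdot>\<^bsub>U\<^esub> Fmor F \<Phi>"
      unfolding f(4) g'(4) U_cmp[OF f(3) g] F[OF h] F[OF k] F[OF cmp[OF h k]] U_cmp[OF hk] ..
  qed
  show "U.faithful F"
    unfolding U.faithful_def
  proof (intro allI impI, elim conjE)
    fix \<Phi> \<Psi> assume p: "arr U \<Phi>" "arr U \<Psi>" "src U \<Psi> = src U \<Phi>" "tgt U \<Psi> = tgt U \<Phi>"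
      "Fmor F \<Phi> = Fmor F \<Psi>"
    obtain X Y f where f: "X \<in> Z" "Y \<in> Z" "f \<Colon> X \<rightarrow> Y" "\<Phi> = cls f" "src U \<Phi> = X" "tgt U \<Phi> = Y"
      by (rule U_arrE[OF p(1)])
    obtain X' Y' g where g': "g \<Colon> X' \<rightarrow> Y'" "\<Psi> = cls g" "src U \<Psi> = X'" "tgt U \<Psi> = Y'"
      by (rule U_arrE[OF p(2)])
    have g: "g \<Colon> X \<rightarrow> Y" using g' p(3,4) f(5,6) by simp
    obtain h k where h: "r X Y f h" and k: "r X Y g k" using ex f(1-3) g by meson
    have ha: "h \<Colon> Fob F X \<rightarrow> Fob F Y" using r h by blast
    have "cls h = cls k" using p(5) unfolding f(4) g'(2) F[OF h] F[OF k] .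
    then show "\<Phi> = \<Psi>" unfolding f(4) g'(2) cls_eq_iff[OF ha] cls_eq_iff[OF f(3)] ff[OF h k] .
  qed
  show "U.full F"
    unfolding U.full_def U_sel(1)
  proof (intro ballI allI impI)
    fix X Y \<Phi> assume X: "X \<in> Z" "Y \<in> Z" and p: "\<Phi> \<Colon>\<^bsub>U\<^esub> Fob F X \<rightarrow> Fob F Y"
    then obtain h where h: "h \<Colon> Fob F X \<rightarrow> Fob F Y" "\<Phi> = cls h" unfolding U_arrow_iff by blast
    obtain f where f: "r X Y f h" using fl[OF X h(1)] by blast
    then have "cls f \<Colon>\<^bsub>U\<^esub> X \<rightarrow> Y" using U_arrow_cls[OF X] r by blast
    then show "\<exists>\<Psi>. \<Psi> \<Colon>\<^bsub>U\<^esub> X \<rightarrow> Y \<and> Fmor F \<Psi> = \<Phi>" using F[OF f] h(2) by blast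
  qed
  show "U.ess_surj F" unfolding U.ess_surj_def U_sel(1) using es by blast
qed

lemma U_Shift_auto: "autoequivalence U (Shift U)"
proof (rule U_autoequivalenceI[where r = tr])
  show "\<exists>X\<in>Z. isomorphic U (Fob (Shift U) X) Y" if Y: "Y \<in> Z" for Y
  proof -
    obtain X h h' where X: "X \<in> Z" and "h \<Colon> tw X \<rightarrow> Y" "h' \<Colon> Y \<rightarrow> tw X"
      "h' \<cdot> h \<approx> ident T (tw X)" "h \<cdot> h' \<approx> ident T Y"
      by (rule tw_ess_surj[OF Y])
    then show ?thesis unfolding U_Shift_Fob using U_isomorphic_iff[OF tw_Z[OF X] Y] by blast
  qed
  show "\<exists>h. tr X Y f h" if "X \<in> Z" "Y \<in> Z" "f \<Colon> X \<rightarrow> Y" for X Y f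
    using tr_exists[OF that] by blast
  show "\<exists>f. tr X Y f h" if "X \<in> Z" "Y \<in> Z" "h \<Colon> Fob (Shift U) X \<rightarrow> Fob (Shift U) Y" for X Y h
    using tr_full[OF that[unfolded U_Shift_Fob]] by blast
  show "f \<Colon> X \<rightarrow> Y \<and> h \<Colon> Fob (Shift U) X \<rightarrow> Fob (Shift U) Y" if "tr X Y f h" for X Y f h
    using that unfolding tr_def U_Shift_Fob by blast
qed (simp_all only: U_Shift_Fob tw_Z U_Shift_Fmor tr_cong_iff tr_ident tr_cmp)

sublocale U: preadditive_shift_category U
  by (intro preadditive_shift_category.intro preadditive_shift_category_axioms.intro
      U_preadditive U_Shift_auto)

lemma U_hom_zero_shift:
  assumes "X \<in> Z" "Y \<in> Z" "0 < i" "i < n"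
  shows "U.hom_zero X ((Fob (Shift U) ^^ i) Y) \<longleftrightarrow> hom_zero X (\<Sigma>\<^bsup>i\<^esup> Y)"
proof -
  have "Fob (Shift U) = tw" by (rule ext) (rule U_Shift_Fob)
  then show ?thesis
    using U_hom_zero_iff[OF assms(1) funpow_tw_Z[OF assms(2)]] stably_zero_funpow_tw[OF assms] by simp
qed

section \<open>The Serre twists on the quotient\<close>

lemma factors_Sn:
  assumes "f \<Colon> X \<rightarrow> Y"
  shows "factors D (Fmor Sn f) \<longleftrightarrow> factors D f"
proof
  assume "factors D f"
  then obtain W u v where w: "W \<in> D" "W \<in> Obj T" "u \<Colon> X \<rightarrow> W" "v \<Colon> W \<rightarrow> Y" "v \<cdot> u = f"
    by (rule factorsE[OF _ assms])
  have "Fob Sn W \<in> D" using D_Sn[OF w(2)] w(1) by blast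
  then show "factors D (Fmor Sn f)"
    by (rule factorsI[of _ _ "Fmor Sn u" "Fob Sn X" "Fmor Sn v" "Fob Sn Y"])
      (use w(3,4) in \<open>simp_all add: w(5)[symmetric]\<close>)
next
  have Sf: "Fmor Sn f \<Colon> Fob Sn X \<rightarrow> Fob Sn Y" using assms by simp
  have O: "X \<in> Obj T" "Y \<in> Obj T" using assms by simp_all
  assume "factors D (Fmor Sn f)"
  then obtain W u v where w: "W \<in> D" "W \<in> Obj T" "u \<Colon> Fob Sn X \<rightarrow> W" "v \<Colon> W \<rightarrow> Fob Sn Y" "v \<cdot> u = Fmor Sn f"
    by (rule factorsE[OF _ Sf])
  \<comment> \<open>The intermediate object is replaced by an isomorphic \<open>S_n V\<close> with
    \<open>V\<close> in \<open>D\<close>; fullness and faithfulness of \<open>S_n\<close> then pull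
    the whole factorisation back.\<close>
  obtain V where V: "V \<in> D" "isomorphic T (Fob Sn V) W" by (rule D_Sn_preimage[OF w(1)])
  have VO: "V \<in> Obj T" "Fob Sn V \<in> Obj T" using V D_ObjD by simp_all
  obtain p q where p: "p \<Colon> Fob Sn V \<rightarrow> W" "q \<Colon> W \<rightarrow> Fob Sn V" "p \<cdot> q = ident T W"
    using isomorphicE[OF V(2) VO(2) w(2)] by metis
  have a: "q \<cdot> u \<Colon> Fob Sn X \<rightarrow> Fob Sn V" "v \<cdot> p \<Colon> Fob Sn V \<rightarrow> Fob Sn Y"
    using p w(3,4) by simp_all
  obtain u' where u': "u' \<Colon> X \<rightarrow> V" "Fmor Sn u' = q \<cdot> u"
    by (rule fullE[OF autoequivalenceD(3)[OF Sn_auto] a(1) O(1) VO(1)])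
  obtain v' where v': "v' \<Colon> V \<rightarrow> Y" "Fmor Sn v' = v \<cdot> p"
    by (rule fullE[OF autoequivalenceD(3)[OF Sn_auto] a(2) VO(1) O(2)])
  have "Fmor Sn (v' \<cdot> u') = Fmor Sn f"
    using u' v' w(3-5) p(1,2) by (simp add: cmp_reassoc[OF p(3)])
  then have "v' \<cdot> u' = f"
    by (rule faithfulD[OF autoequivalenceD(2)[OF Sn_auto]]) (use u'(1) v'(1) assms in simp_all)
  then show "factors D f" by (rule factorsI[OF V(1) u'(1) v'(1)])
qed

lemma Sn_cong_iff:
  assumes "f \<Colon> X \<rightarrow> Y" "g \<Colon> X \<rightarrow> Y"
  shows "Fmor Sn f \<approx> Fmor Sn g \<longleftrightarrow> f \<approx> g"
proof
  assume "f \<approx> g"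
  then obtain t where t: "t \<Colon> X \<rightarrow> Y" "factors D t" "f \<boxplus> t = g" by (rule congE[OF _ assms(1)])
  show "Fmor Sn f \<approx> Fmor Sn g"
  proof (rule congI[of _ "Fob Sn X" "Fob Sn Y"])
    show "factors D (Fmor Sn t)" using factors_Sn[OF t(1)] t(2) by blast
    show "Fmor Sn f \<boxplus> Fmor Sn t = Fmor Sn g"
      unfolding t(3)[symmetric] by (rule functor_add[OF Sn_additive, symmetric]) (use t(1) assms in simp_all)
  qed (use t(1) assms in simp_all)
next
  assume e: "Fmor Sn f \<approx> Fmor Sn g"
  have Sf: "Fmor Sn f \<Colon> Fob Sn X \<rightarrow> Fob Sn Y" using assms by simp
  obtain t where t: "t \<Colon> Fob Sn X \<rightarrow> Fob Sn Y" "factors D t" "Fmor Sn f \<boxplus> t = Fmor Sn g"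
    by (rule congE[OF e Sf])
  define s where "s = \<boxminus> f \<boxplus> g"
  have s: "s \<Colon> X \<rightarrow> Y" unfolding s_def using assms by simp
  have "Fmor Sn s = \<boxminus> Fmor Sn f \<boxplus> Fmor Sn g"
    unfolding s_def using assms by (simp add: functor_add[OF Sn_additive])
  also have "\<dots> = t" unfolding t(3)[symmetric] using assms t(1) by simp
  finally have "factors D s" using factors_Sn[OF s] t(2) by simp
  then show "f \<approx> g" by (rule congI[OF assms(1) s]) (use assms in \<open>simp add: s_def\<close>)
qed

abbreviation QSn :: "('o, 'm set) endo"
  where "QSn \<equiv> quotient_functor T D Sn"

lemma QSn_Fob: "Fob QSn = Fob Sn"
  by (simp add: quotient_functor_def)

lemma QSn_Fmor:
  assumes "f \<Colon> X \<rightarrow> Y"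
  shows "Fmor QSn (cls f) = cls (Fmor Sn f)"
proof -
  have "(\<Union>f'\<in>cls f. cls (Fmor Sn f')) = cls (Fmor Sn f)"
  proof (rule Union_cls[OF assms])
    fix f' assume e: "f \<approx> f'"
    have f': "f' \<Colon> X \<rightarrow> Y" by (rule cong_arrow[OF e assms])
    have Sf: "Fmor Sn f \<Colon> Fob Sn X \<rightarrow> Fob Sn Y" using assms by simp
    show "cls (Fmor Sn f') = cls (Fmor Sn f)"
      using cls_eq_iff[OF Sf] Sn_cong_iff[OF assms f'] e by blast
  qed
  then show ?thesis by (simp add: quotient_functor_def)
qed

lemma Z_SnI: "X \<in> Z \<Longrightarrow> Fob Sn X \<in> Z"
  using Z_Sn Z_ObjD by blast

lemma isomorphic_imp_U:
  assumes "X \<in> Z" "Y \<in> Z" "isomorphic T X Y"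
  shows "isomorphic U X Y"
proof -
  have O: "X \<in> Obj T" "Y \<in> Obj T" using assms Z_ObjD by blast+
  obtain f g where f: "f \<Colon> X \<rightarrow> Y" "g \<Colon> Y \<rightarrow> X" "g \<cdot> f = ident T X" "f \<cdot> g = ident T Y"
    by (rule isomorphicE[OF assms(3) O])
  have i: "ident T X \<Colon> X \<rightarrow> X" "ident T Y \<Colon> Y \<rightarrow> Y" using O by simp_all
  show ?thesis
    unfolding U_isomorphic_iff[OF assms(1,2)] using f(1,2) cong_refl[OF i(1)] cong_refl[OF i(2)]
    by (intro exI[of _ f] exI[of _ g]) (simp only: f(3,4))
qed

lemma QSn_auto: "autoequivalence U QSn"
proof (rule U_autoequivalenceI[where r = "\<lambda>X Y f h. X \<in> Z \<and> Y \<in> Z \<and> f \<Colon> X \<rightarrow> Y \<and> h = Fmor Sn f"])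
  show "\<exists>f. X \<in> Z \<and> Y \<in> Z \<and> f \<Colon> X \<rightarrow> Y \<and> h = Fmor Sn f"
    if X: "X \<in> Z" "Y \<in> Z" and h: "h \<Colon> Fob QSn X \<rightarrow> Fob QSn Y" for X Y h
    using fullE[OF autoequivalenceD(3)[OF Sn_auto] h[unfolded QSn_Fob] Z_ObjD[OF X(1)] Z_ObjD[OF X(2)]] X
    by blast
  show "\<exists>X\<in>Z. isomorphic U (Fob QSn X) Y" if Y: "Y \<in> Z" for Y
  proof -
    have YO: "Y \<in> Obj T" using Y by (rule Z_ObjD)
    obtain X where X: "X \<in> Obj T" "isomorphic T (Fob Sn X) Y"
      using autoequivalenceD(4)[OF Sn_auto] YO unfolding ess_surj_def by blast
    have SX: "Fob Sn X \<in> Z" using subcategory_iso_iff[OF Z_sub _ YO X(2)] X(1) Y by simp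
    then have "X \<in> Z" using Z_Sn[OF X(1)] by blast
    then show ?thesis using isomorphic_imp_U[OF SX Y X(2)] QSn_Fob by auto
  qed
  show "h \<approx> k \<longleftrightarrow> f \<approx> g"
    if "X \<in> Z \<and> Y \<in> Z \<and> f \<Colon> X \<rightarrow> Y \<and> h = Fmor Sn f" "X \<in> Z \<and> Y \<in> Z \<and> g \<Colon> X \<rightarrow> Y \<and> k = Fmor Sn g"
    for X Y f g h k
    using that Sn_cong_iff by blast
  show "Fmor QSn (cls f) = cls h" if "X \<in> Z \<and> Y \<in> Z \<and> f \<Colon> X \<rightarrow> Y \<and> h = Fmor Sn f" for X Y f h
    using that QSn_Fmor by blast
qed (simp_all add: QSn_Fob Z_SnI Z_ObjD)

abbreviation USn :: "('o, 'm set) endo"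
  where "USn \<equiv> serre_n U (reduction_serre T S n D Z A) n"

lemma USn_eq:
  "USn = comp_functor (comp_functor QSn (functor_power U (Shift U) (int n))) (functor_power U (Shift U) (- int n))"
  unfolding serre_n_def[of U] reduction_serre_def shift_def[of U] ..

lemma USn_auto: "autoequivalence U USn"
  unfolding USn_eq
  by (intro U.autoequivalence_comp U.autoequivalence_power U_Shift_auto QSn_auto)

text \<open>The powers \<open><n>\<close> and \<open><-n>\<close> inside \<open>S'_n\<close> cancel
  up to isomorphism, leaving the functor induced by \<open>S_n\<close>.\<close>

lemma USn_isomorphic:
  assumes "X \<in> Z"
  shows "isomorphic U (Fob USn X) (Fob Sn X)"
proof -
  have X: "X \<in> Obj U" using assms by (simp add: U_sel)
  note p = U.autoequivalenceD(1)[OF U.autoequivalence_power[OF U_Shift_auto]]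
  have "isomorphic U (Fob QSn (Fob (functor_power U (Shift U) (int n)) (Fob (functor_power U (Shift U) (- int n)) X)))
      (Fob QSn X)"
    by (rule U.functor_isomorphic[OF U.autoequivalenceD(1)[OF QSn_auto] _ X
          U.isomorphic_power_minus[OF U_Shift_auto X]])
      (use X p in simp)
  then show ?thesis
    unfolding USn_eq QSn_Fob[symmetric] by (simp only: comp_functor_def endo.select_convs comp_apply)
qed

end

section \<open>Subcategories of the reduction\<close>

context reduction_setting
begin

text \<open>The correction term factors through \<open>D\<close>, hence through \<open>C\<close>. So
  factoring through a \<open>C\<close> containing \<open>D\<close> is a property of classes modulo
  \<open>[D]\<close>.\<close>

lemma factors_cong_mono:
  assumes C: "subcategory T C" "D \<subseteq> C" and e: "f \<approx> g" and f: "f \<Colon> X \<rightarrow> Y" "factors C f"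
  shows "factors C g"
proof -
  obtain t where t: "t \<Colon> X \<rightarrow> Y" "factors D t" "f \<boxplus> t = g" by (rule congE[OF e f(1)])
  have "factors C (f \<boxplus> t)"
    by (rule factors_add[OF C(1) f(2) factors_mono[OF t(2) C(2)]]) (use f(1) t(1) in simp_all)
  then show ?thesis using t(3) by simp
qed

text \<open>A retract in the quotient yields an endomorphism factoring through \<open>C\<close> and
  congruent to the identity. The identity then factors through \<open>C\<close> as well, so the
  object is an honest retract of an object of \<open>C\<close>.\<close>

lemma cong_retract_mem:
  assumes C: "subcategory T C" "D \<subseteq> C" and P: "P \<in> C"
    and f: "f \<Colon> X \<rightarrow> P" "g \<Colon> P \<rightarrow> X" "g \<cdot> f \<approx> ident T X"
  shows "X \<in> C"
proof -
  have gf: "g \<cdot> f \<Colon> X \<rightarrow> X" and X: "X \<in> Obj T" using f(1,2) by simp_all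
  have "factors C (g \<cdot> f)" by (rule factorsI[OF P f(1,2)]) simp
  then have "factors C (ident T X)" by (rule factors_cong_mono[OF C f(3) gf])
  then show ?thesis by (rule factors_ident_imp_mem[OF C(1) X])
qed

lemma finsum_cls:
  assumes "V \<in> Z" "finite J" "\<And>j. j \<in> J \<Longrightarrow> h j \<Colon> V \<rightarrow> V"
  shows "(\<Oplus>\<^bsub>Hom U V V\<^esub>j\<in>J. cls (h j)) = cls (\<Oplus>\<^bsub>Hom T V V\<^esub>j\<in>J. h j)"
proof -
  have SO: "V \<in> Obj T" "V \<in> Obj U" using assms(1) Z_ObjD by (simp_all add: U_sel)
  interpret TG: abelian_group "Hom T V V" by (rule Hom_abelian_group[OF SO(1) SO(1)])
  interpret UG: abelian_group "Hom U V V" by (rule U.Hom_abelian_group[OF SO(2) SO(2)])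
  have m: "u \<in> mor T V V \<longleftrightarrow> u \<Colon> V \<rightarrow> V" for u using SO unfolding arrow_def by blast
  have mU: "cls u \<in> mor U V V" if "u \<Colon> V \<rightarrow> V" for u
    using that unfolding m[symmetric] U_mor by blast
  show ?thesis using assms(2,3)
  proof (induction J)
    case empty
    then show ?case by (simp add: U_zero)
  next
    case (insert j J)
    have hj: "h \<in> J \<rightarrow> mor T V V" "h j \<in> mor T V V" using insert.prems m by blast+
    have cj: "(\<lambda>j. cls (h j)) \<in> J \<rightarrow> mor U V V" "cls (h j) \<in> mor U V V"
      using insert.prems mU by blast+
    let ?s = "\<Oplus>\<^bsub>Hom T V V\<^esub>j\<in>J. h j"
    have s: "?s \<Colon> V \<rightarrow> V" using TG.finsum_closed[OF hj(1)] unfolding m .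
    have hs: "h j \<oplus>\<^bsub>Hom T V V\<^esub> ?s = h j \<boxplus> ?s"
      using hj(2)[unfolded m] by (intro Hom_add) simp_all
    have ih: "(\<Oplus>\<^bsub>Hom U V V\<^esub>j\<in>J. cls (h j)) = cls ?s"
      by (rule insert.IH) (rule insert.prems, blast)
    have "(\<Oplus>\<^bsub>Hom U V V\<^esub>j\<in>insert j J. cls (h j)) = cls (h j) \<oplus>\<^bsub>Hom U V V\<^esub> (\<Oplus>\<^bsub>Hom U V V\<^esub>j\<in>J. cls (h j))"
      by (rule UG.finsum_insert[OF insert.hyps cj])
    also have "\<dots> = cls (h j) \<oplus>\<^bsub>Hom U V V\<^esub> cls ?s" unfolding ih ..
    also have "\<dots> = cls (h j \<boxplus> ?s)" by (rule U_add[OF hj(2)[unfolded m] s])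
    also have "\<dots> = cls (\<Oplus>\<^bsub>Hom T V V\<^esub>j\<in>insert j J. h j)"
      using TG.finsum_insert[OF insert.hyps hj] hs by simp
    finally show ?case .
  qed
qed

lemma direct_sum_U:
  assumes V: "direct_sum T Xs V" and SZ: "V \<in> Z" and Xs: "set Xs \<subseteq> Z"
  shows "direct_sum U Xs V"
proof -
  obtain \<iota> \<pi> where \<iota>: "\<And>j. j < length Xs \<Longrightarrow> \<iota> j \<Colon> Xs ! j \<rightarrow> V"
    and \<pi>: "\<And>j. j < length Xs \<Longrightarrow> \<pi> j \<Colon> V \<rightarrow> Xs ! j"
    and \<pi>\<iota>: "\<And>j l. \<lbrakk>j < length Xs; l < length Xs\<rbrakk> \<Longrightarrow>
      \<pi> j \<cdot> \<iota> l = (if j = l then ident T (Xs ! j) else zero_mor T (Xs ! l) (Xs ! j))"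
    and sum: "(\<Oplus>\<^bsub>Hom T V V\<^esub>j\<in>{..<length Xs}. \<iota> j \<cdot> \<pi> j) = ident T V"
    by (rule direct_sumE[OF V]) (rule that; assumption)
  have XZ: "Xs ! j \<in> Z" if "j < length Xs" for j using Xs that by auto
  have h: "\<iota> j \<cdot> \<pi> j \<Colon> V \<rightarrow> V" if "j \<in> {..<length Xs}" for j
    using \<iota>[of j] \<pi>[of j] that by simp
  have SU: "V \<in> Obj U" using SZ by (simp add: U_sel)
  interpret UG: abelian_group "Hom U V V" using SU SU by (rule U.Hom_abelian_group)
  have "(\<Oplus>\<^bsub>Hom U V V\<^esub>j\<in>{..<length Xs}. cls (\<iota> j) \<cdot>\<^bsub>U\<^esub> cls (\<pi> j))
      = (\<Oplus>\<^bsub>Hom U V V\<^esub>j\<in>{..<length Xs}. cls (\<iota> j \<cdot> \<pi> j))"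
  proof (rule UG.finsum_cong')
    show "(\<lambda>j. cls (\<iota> j \<cdot> \<pi> j)) \<in> {..<length Xs} \<rightarrow> mor U V V"
      using h unfolding U_mor arrow_def by blast
    show "cls (\<iota> j) \<cdot>\<^bsub>U\<^esub> cls (\<pi> j) = cls (\<iota> j \<cdot> \<pi> j)" if "j \<in> {..<length Xs}" for j
      using U_cmp[OF \<pi> \<iota>] that by simp
  qed simp
  also have "\<dots> = cls (\<Oplus>\<^bsub>Hom T V V\<^esub>j\<in>{..<length Xs}. \<iota> j \<cdot> \<pi> j)"
    by (rule finsum_cls[OF SZ finite_lessThan h])
  also have "\<dots> = ident U V" unfolding sum U_ident ..
  finally have sumU: "(\<Oplus>\<^bsub>Hom U V V\<^esub>j\<in>{..<length Xs}. cls (\<iota> j) \<cdot>\<^bsub>U\<^esub> cls (\<pi> j)) = ident U V" .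
  have 1: "\<forall>j<length Xs. cls (\<iota> j) \<in> mor U (Xs ! j) V \<and> cls (\<pi> j) \<in> mor U V (Xs ! j)"
    using \<iota> \<pi> unfolding U_mor arrow_def by blast
  have 2: "\<forall>j<length Xs. \<forall>l<length Xs. cls (\<pi> j) \<cdot>\<^bsub>U\<^esub> cls (\<iota> l) =
      (if j = l then ident U (Xs ! j) else zero_mor U (Xs ! l) (Xs ! j))"
  proof (intro allI impI)
    fix j l assume j: "j < length Xs" "l < length Xs"
    show "cls (\<pi> j) \<cdot>\<^bsub>U\<^esub> cls (\<iota> l) =
        (if j = l then ident U (Xs ! j) else zero_mor U (Xs ! l) (Xs ! j))"
      unfolding U_cmp[OF \<iota>[OF j(2)] \<pi>[OF j(1)]] \<pi>\<iota>[OF j] U_ident U_zero by simp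
  qed
  have "\<exists>\<iota> \<pi>. (\<forall>j<length Xs. \<iota> j \<in> mor U (Xs ! j) V \<and> \<pi> j \<in> mor U V (Xs ! j)) \<and>
      (\<forall>j<length Xs. \<forall>l<length Xs. \<pi> j \<cdot>\<^bsub>U\<^esub> \<iota> l =
        (if j = l then ident U (Xs ! j) else zero_mor U (Xs ! l) (Xs ! j))) \<and>
      (\<Oplus>\<^bsub>Hom U V V\<^esub>j\<in>{..<length Xs}. \<iota> j \<cdot>\<^bsub>U\<^esub> \<pi> j) = ident U V"
    by (rule exI[of _ "\<lambda>j. cls (\<iota> j)"], rule exI[of _ "\<lambda>j. cls (\<pi> j)"]) (intro conjI 1 2 sumU)
  then show ?thesis unfolding direct_sum_def using Xs SZ by (simp add: U_sel(1))
qed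

lemma subcategory_U_iff:
  "subcategory U C \<longleftrightarrow> subcategory T C \<and> D \<subseteq> C \<and> C \<subseteq> Z"
proof
  assume C: "subcategory U C"
  have CZ: "C \<subseteq> Z" using C unfolding subcategory_def U_sel(1) by blast
  have DC: "D \<subseteq> C"
  proof
    fix W assume W: "W \<in> D"
    have WO: "W \<in> Obj T" "W \<in> Obj U" using W D_ObjD D_ZD by (simp_all add: U_sel)
    have i: "ident T W \<Colon> W \<rightarrow> W" using WO by simp
    have "ident U W = zero_mor U W W"
      unfolding U_ident U_zero cls_eq_iff[OF i]
      by (rule cong_factors[OF i factors_ident[OF W WO(1)]])
    then show "W \<in> C" by (rule U.subcategory_zero[OF C WO(2)])
  qed
  have "subcategory T C"
    unfolding subcategory_def
  proof (intro conjI ballI impI allI)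
    show "C \<subseteq> Obj T" using CZ Z_Obj by blast
    fix X Y assume X: "X \<in> C" "Y \<in> Obj T" "isomorphic T X Y"
    have XZ: "X \<in> Z" "X \<in> Obj T" using X(1) CZ Z_Obj by blast+
    have YZ: "Y \<in> Z" by (rule subcategory_iso[OF Z_sub XZ(1) X(2,3)])
    have "isomorphic U X Y" by (rule isomorphic_imp_U[OF XZ(1) YZ X(3)])
    then show "Y \<in> C" using U.subcategory_iso[OF C X(1)] YZ by (simp add: U_sel)
  next
    fix Xs S assume S: "direct_sum T Xs S"
    \<comment> \<open>\<open>Z\<close> is closed under sums and summands in \<open>T\<close>.
      Whichever side is assumed, all objects involved lie in \<open>Z\<close>, and the sum can be
      read in \<open>U\<close>.\<close>
    have ZS: "set Xs \<subseteq> Z \<longleftrightarrow> S \<in> Z" using Z_sub S unfolding subcategory_def by blast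
    have CS: "set Xs \<subseteq> C \<longleftrightarrow> S \<in> C" if "direct_sum U Xs S" using C that unfolding subcategory_def by blast
    show "set Xs \<subseteq> C \<longleftrightarrow> S \<in> C" using ZS CS direct_sum_U[OF S] CZ by blast
  qed
  with DC CZ show "subcategory T C \<and> D \<subseteq> C \<and> C \<subseteq> Z" by blast
next
  assume "subcategory T C \<and> D \<subseteq> C \<and> C \<subseteq> Z"
  then have C: "subcategory T C" "D \<subseteq> C" "C \<subseteq> Z" by blast+
  show "subcategory U C"
    unfolding subcategory_def U_sel(1)
  proof (intro conjI ballI impI allI)
    show "C \<subseteq> Z" by fact
    fix X Y assume X: "X \<in> C" "Y \<in> Z" "isomorphic U X Y"
    have XZ: "X \<in> Z" using X(1) C(3) by blast
    obtain f g where "f \<Colon> X \<rightarrow> Y" "g \<Colon> Y \<rightarrow> X" "f \<cdot> g \<approx> ident T Y"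
      using X(3) unfolding U_isomorphic_iff[OF XZ X(2)] by blast
    then show "Y \<in> C" using cong_retract_mem[OF C(1,2) X(1)] by blast
  next
    fix Xs S assume S: "direct_sum U Xs S"
    obtain \<iota> \<pi> where SO: "S \<in> Obj U" "set Xs \<subseteq> Obj U"
      and \<iota>: "\<And>j. j < length Xs \<Longrightarrow> \<iota> j \<Colon>\<^bsub>U\<^esub> Xs ! j \<rightarrow> S"
      and \<pi>: "\<And>j. j < length Xs \<Longrightarrow> \<pi> j \<Colon>\<^bsub>U\<^esub> S \<rightarrow> Xs ! j"
      and \<pi>\<iota>: "\<And>j l. \<lbrakk>j < length Xs; l < length Xs\<rbrakk> \<Longrightarrow>
        \<pi> j \<cdot>\<^bsub>U\<^esub> \<iota> l = (if j = l then ident U (Xs ! j) else zero_mor U (Xs ! l) (Xs ! j))"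
      and sum: "(\<Oplus>\<^bsub>Hom U S S\<^esub>j\<in>{..<length Xs}. \<iota> j \<cdot>\<^bsub>U\<^esub> \<pi> j) = ident U S"
      by (rule U.direct_sumE[OF S]) (rule that; assumption)
    have SZ: "S \<in> Z" "S \<in> Obj T" using SO Z_ObjD by (simp_all add: U_sel)
    show "set Xs \<subseteq> C \<longleftrightarrow> S \<in> C"
    proof
      assume XC: "set Xs \<subseteq> C"
      \<comment> \<open>A direct sum in \<open>U\<close> gives no direct sum decomposition of
        \<open>S\<close> in \<open>T\<close>, so the argument follows the identity of
        \<open>S\<close>. In \<open>U\<close> it is a sum of classes with representatives factoring
        through \<open>C\<close>, hence has such a representative itself.\<close>
      let ?P = "\<lambda>\<Phi>. \<exists>h. h \<Colon> S \<rightarrow> S \<and> \<Phi> = cls h \<and> factors C h"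
      have "?P (\<Oplus>\<^bsub>Hom U S S\<^esub>j\<in>{..<length Xs}. \<iota> j \<cdot>\<^bsub>U\<^esub> \<pi> j)"
      proof (rule U.finsum_induct[OF SO(1)])
        fix j assume "j \<in> {..<length Xs}"
        then have j: "j < length Xs" by simp
        show "\<iota> j \<cdot>\<^bsub>U\<^esub> \<pi> j \<Colon>\<^bsub>U\<^esub> S \<rightarrow> S" by (rule U.cmp_arrow[OF \<pi>[OF j] \<iota>[OF j]])
        obtain p q where p: "p \<Colon> Xs ! j \<rightarrow> S" "\<iota> j = cls p" "q \<Colon> S \<rightarrow> Xs ! j" "\<pi> j = cls q"
          using \<iota>[OF j] \<pi>[OF j] unfolding U_arrow_iff by blast
        have "Xs ! j \<in> C" using XC j by auto
        then have "factors C (p \<cdot> q)" by (rule factorsI[OF _ p(3,1)]) simp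
        moreover have "p \<cdot> q \<Colon> S \<rightarrow> S" using p(1,3) by simp
        ultimately show "?P (\<iota> j \<cdot>\<^bsub>U\<^esub> \<pi> j)" unfolding p(2,4) U_cmp[OF p(3,1)] by blast
      next
        have "zero_mor T S S \<Colon> S \<rightarrow> S" using SZ by simp
        then show "?P (zero_mor U S S)"
          unfolding U_zero using factors_zero[OF C(1) SZ(2) SZ(2)] by blast
      next
        fix \<Phi> \<Psi> assume ta: "\<Phi> \<Colon>\<^bsub>U\<^esub> S \<rightarrow> S" and "?P \<Phi>" "?P \<Psi>"
        then obtain p q where p: "p \<Colon> S \<rightarrow> S" "q \<Colon> S \<rightarrow> S" "factors C p" "factors C q"
          and e: "\<Phi> = cls p" "\<Psi> = cls q" by blast
        have "\<Phi> \<boxplus>\<^bsub>U\<^esub> \<Psi> = \<Phi> \<oplus>\<^bsub>Hom U S S\<^esub> \<Psi>"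
          by (rule U.Hom_add[symmetric]) (use ta in simp_all)
        also have "\<dots> = cls (p \<boxplus> q)" unfolding e by (rule U_add[OF p(1,2)])
        finally have "\<Phi> \<boxplus>\<^bsub>U\<^esub> \<Psi> = cls (p \<boxplus> q)" .
        moreover have "factors C (p \<boxplus> q)"
          by (rule factors_add[OF C(1) p(3,4)]) (use p(1,2) in simp_all)
        moreover have "p \<boxplus> q \<Colon> S \<rightarrow> S" using p(1,2) by simp
        ultimately show "?P (\<Phi> \<boxplus>\<^bsub>U\<^esub> \<Psi>)" by blast
      qed simp
      then obtain h where h: "h \<Colon> S \<rightarrow> S" "cls (ident T S) = cls h" "factors C h"
        unfolding sum U_ident by blast
      then have "h \<approx> ident T S" using cls_eq_iff[OF h(1), of "ident T S"] by metis
      then have "factors C (ident T S)" by (rule factors_cong_mono[OF C(1,2) _ h(1,3)])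
      then show "S \<in> C" by (rule factors_ident_imp_mem[OF C(1) SZ(2)])
    next
      assume SC: "S \<in> C"
      show "set Xs \<subseteq> C"
      proof
        fix X assume "X \<in> set Xs"
        then obtain j where j: "j < length Xs" "X = Xs ! j" by (metis in_set_conv_nth)
        obtain p q where p: "p \<Colon> X \<rightarrow> S" "\<iota> j = cls p" "q \<Colon> S \<rightarrow> X" "\<pi> j = cls q"
          using \<iota>[OF j(1)] \<pi>[OF j(1)] unfolding U_arrow_iff j(2) by blast
        have qp: "q \<cdot> p \<Colon> X \<rightarrow> X" using p(1,3) by simp
        have "cls (q \<cdot> p) = cls (ident T X)"
          using \<pi>\<iota>[OF j(1) j(1)] unfolding p(2,4) U_cmp[OF p(1,3)] U_ident j(2) by simp
        then have "q \<cdot> p \<approx> ident T X" using cls_eq_iff[OF qp] by blast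
        then show "X \<in> C" by (rule cong_retract_mem[OF C(1,2) SC p(1,3)])
      qed
    qed
  qed
qed

section \<open>Approximations\<close>

lemma right_approximation_iff:
  assumes "C \<subseteq> Obj T" "V \<in> Obj T"
  shows "right_approximation T C X V f \<longleftrightarrow> X \<in> C \<and> f \<Colon> X \<rightarrow> V \<and>
    (\<forall>Y\<in>C. \<forall>g. g \<Colon> Y \<rightarrow> V \<longrightarrow> (\<exists>h. h \<Colon> Y \<rightarrow> X \<and> f \<cdot> h = g))"
proof (cases "X \<in> C")
  case True
  then have X: "X \<in> Obj T" using assms(1) by blast
  have m: "u \<in> mor T V' W \<longleftrightarrow> u \<Colon> V' \<rightarrow> W" if "V' \<in> Obj T" "W \<in> Obj T" for u V' W
    using that unfolding arrow_def by blast
  have "(\<forall>g\<in>mor T Y V. \<exists>h\<in>mor T Y X. g = f \<cdot> h)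
      \<longleftrightarrow> (\<forall>g. g \<Colon> Y \<rightarrow> V \<longrightarrow> (\<exists>h. h \<Colon> Y \<rightarrow> X \<and> f \<cdot> h = g))" if "Y \<in> C" for Y
  proof -
    have Y: "Y \<in> Obj T" using that assms(1) by blast
    show ?thesis unfolding Ball_def Bex_def m[OF Y assms(2)] m[OF Y X] by metis
  qed
  then show ?thesis
    unfolding right_approximation_def m[OF X assms(2)] by simp
qed (simp add: right_approximation_def)

lemma left_approximation_iff:
  assumes "C \<subseteq> Obj T" "V \<in> Obj T"
  shows "left_approximation T C V X f \<longleftrightarrow> X \<in> C \<and> f \<Colon> V \<rightarrow> X \<and>
    (\<forall>Y\<in>C. \<forall>g. g \<Colon> V \<rightarrow> Y \<longrightarrow> (\<exists>h. h \<Colon> X \<rightarrow> Y \<and> h \<cdot> f = g))"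
proof (cases "X \<in> C")
  case True
  then have X: "X \<in> Obj T" using assms(1) by blast
  have m: "u \<in> mor T V' W \<longleftrightarrow> u \<Colon> V' \<rightarrow> W" if "V' \<in> Obj T" "W \<in> Obj T" for u V' W
    using that unfolding arrow_def by blast
  have "(\<forall>g\<in>mor T V Y. \<exists>h\<in>mor T X Y. g = h \<cdot> f)
      \<longleftrightarrow> (\<forall>g. g \<Colon> V \<rightarrow> Y \<longrightarrow> (\<exists>h. h \<Colon> X \<rightarrow> Y \<and> h \<cdot> f = g))" if "Y \<in> C" for Y
  proof -
    have Y: "Y \<in> Obj T" using that assms(1) by blast
    show ?thesis unfolding Ball_def Bex_def m[OF assms(2) Y] m[OF X Y] by metis
  qed
  then show ?thesis
    unfolding left_approximation_def m[OF assms(2) X] by simp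
qed (simp add: left_approximation_def)

text \<open>
  \<open>W'\<close> is the cone of a right \<open>D[-j]\<close>-approximation of \<open>W\<close>. As \<open>D\<close> is rigid, the step preserves
  the vanishing already achieved for indices above \<open>j\<close>; hence the descending order of the indices.
\<close>

lemma left_approximation_step:
  assumes W: "W \<in> Obj T" and j: "0 < j" "j < n"
    and van: "\<And>i V. \<lbrakk>j < i; i < n; V \<in> D\<rbrakk> \<Longrightarrow> hom_zero V (\<Sigma>\<^bsup>i\<^esup> W)"
  obtains W' b where "b \<Colon> W \<rightarrow> W'"
    "\<And>i V. \<lbrakk>j \<le> i; i < n; V \<in> D\<rbrakk> \<Longrightarrow> hom_zero V (\<Sigma>\<^bsup>i\<^esup> W')"
    "\<And>Y g. \<lbrakk>Y \<in> Z; g \<Colon> W \<rightarrow> Y\<rbrakk> \<Longrightarrow> \<exists>h. h \<Colon> W' \<rightarrow> Y \<and> h \<cdot> b = g"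
proof -
  define F where "F = shift T (int j)"
  have F: "autoequivalence T F" unfolding F_def shift_def by (rule autoequivalence_power[OF Shift_auto])
  note F1 = autoequivalenceD[OF F]
  have FX: "Fob F X = \<Sigma>\<^bsup>j\<^esup> X" for X unfolding F_def Fob_shift ..
  have SW: "\<Sigma>\<^bsup>j\<^esup> W \<in> Obj T" using W by simp
  obtain D' b where b: "right_approximation T D D' (\<Sigma>\<^bsup>j\<^esup> W) b"
    using D_ff SW unfolding functorially_finite_def by blast
  then have D': "D' \<in> D" "D' \<in> Obj T" and bt: "b \<Colon> D' \<rightarrow> \<Sigma>\<^bsup>j\<^esup> W"
    and bu: "\<And>Y g. \<lbrakk>Y \<in> D; g \<Colon> Y \<rightarrow> \<Sigma>\<^bsup>j\<^esup> W\<rbrakk> \<Longrightarrow> \<exists>h. h \<Colon> Y \<rightarrow> D' \<and> b \<cdot> h = g"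
    unfolding right_approximation_iff[OF D_Obj SW] using D_ObjD by blast+
  \<comment> \<open>\<open>P\<close> stands for \<open>D'[-j]\<close>; the approximation of
    \<open>W[j]\<close> is carried back along the \<open>j\<close>-th power of the shift to a
    morphism from \<open>P\<close> to \<open>W\<close>.\<close>
  obtain P where P: "P \<in> Obj T" "isomorphic T (\<Sigma>\<^bsup>j\<^esup> P) D'"
    using F1(4) D'(2) unfolding ess_surj_def FX by blast
  have SP: "\<Sigma>\<^bsup>j\<^esup> P \<in> Obj T" using P by simp
  have SPD: "\<Sigma>\<^bsup>j\<^esup> P \<in> D" using subcategory_iso[OF D_sub D'(1) SP] isomorphic_sym[OF SP D'(2) P(2)] by blast
  obtain \<phi> \<psi> where \<phi>: "\<phi> \<Colon> \<Sigma>\<^bsup>j\<^esup> P \<rightarrow> D'" "\<psi> \<Colon> D' \<rightarrow> \<Sigma>\<^bsup>j\<^esup> P" "\<phi> \<cdot> \<psi> = ident T D'"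
    using isomorphicE[OF P(2) SP D'(2)] by metis
  have b\<phi>: "b \<cdot> \<phi> \<Colon> Fob F P \<rightarrow> Fob F W" using bt \<phi> by (simp add: FX)
  obtain p where p: "p \<Colon> P \<rightarrow> W" "Fmor F p = b \<cdot> \<phi>" by (rule fullE[OF F1(3) b\<phi> P(1) W])
  have pu: "\<exists>m. m \<Colon> X \<rightarrow> P \<and> p \<cdot> m = q" if X: "\<Sigma>\<^bsup>j\<^esup> X \<in> D" and q: "q \<Colon> X \<rightarrow> W" for X q
  proof -
    have XO: "X \<in> Obj T" using q by simp
    have "Fmor F q \<Colon> \<Sigma>\<^bsup>j\<^esup> X \<rightarrow> \<Sigma>\<^bsup>j\<^esup> W" using q F1(1) by (simp add: FX)
    then obtain k where k: "k \<Colon> \<Sigma>\<^bsup>j\<^esup> X \<rightarrow> D'" "b \<cdot> k = Fmor F q" using bu[OF X] by blast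
    have \<psi>k: "\<psi> \<cdot> k \<Colon> Fob F X \<rightarrow> Fob F P" using k(1) \<phi> by (simp add: FX)
    obtain m where m: "m \<Colon> X \<rightarrow> P" "Fmor F m = \<psi> \<cdot> k" by (rule fullE[OF F1(3) \<psi>k XO P(1)])
    have "Fmor F (p \<cdot> m) = Fmor F q"
      using p m k \<phi>(1,2) bt F1(1) by (simp add: cmp_reassoc[OF \<phi>(3)])
    then have "p \<cdot> m = q" by (rule faithfulD[OF F1(2)]) (use p(1) m(1) q in simp_all)
    with m(1) show ?thesis by blast
  qed
  have pm: "P \<in> Obj T" "W \<in> Obj T" "p \<in> mor T P W" using p(1) unfolding arrow_def by blast+
  obtain W' b' c where t: "(P, W, W', p, b', c) \<in> Tri T" using Tri_cone[OF pm] by blast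
  note ta = tri_arrow[OF t]
  have W'O: "W' \<in> Obj T" using ta by simp
  show ?thesis
  proof (rule that[OF ta(2)])
    fix i V assume i: "j \<le> i" "i < n" and V: "V \<in> D"
    have VO: "V \<in> Obj T" using V by (rule D_ObjD)
    define X where "X = unshift i V"
    have XO: "X \<in> Obj T" unfolding X_def using VO by simp
    \<comment> \<open>This rewrites \<open>P[i+1]\<close> as an object of \<open>D\<close> shifted
      by \<open>i - j + 1\<close>. That index lies strictly between 0 and \<open>n\<close> because
      \<open>0 < j \<le> i < n\<close>, so rigidity applies.\<close>
    have e: "\<Sigma>\<^bsup>Suc (i - j)\<^esup> (\<Sigma>\<^bsup>j\<^esup> P) = \<Sigma>\<^bsup>i\<^esup> (\<Sigma> P)"
    proof -
      have "\<Sigma>\<^bsup>Suc (i - j)\<^esup> (\<Sigma>\<^bsup>j\<^esup> P) = \<Sigma>\<^bsup>Suc (i - j) + j\<^esup> P" by (simp only: funpow_add comp_apply)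
      also have "Suc (i - j) + j = Suc i" using i(1) by simp
      finally show ?thesis by (simp only: funpow_Suc_right comp_apply)
    qed
    have "hom_zero V (\<Sigma>\<^bsup>Suc (i - j)\<^esup> (\<Sigma>\<^bsup>j\<^esup> P))"
      by (rule hom_zero_D_Z[OF V D_ZD[OF SPD]]) (use i j in simp_all)
    then have zP: "hom_zero X (\<Sigma> P)" unfolding e X_def using hom_zero_unshift VO P(1) by simp
    have "hom_zero X W'"
    proof (rule hom_zeroI[OF XO W'O])
      fix h assume h: "h \<Colon> X \<rightarrow> W'"
      have "c \<cdot> h = zero_mor T X (\<Sigma> P)" by (rule hom_zeroD[OF zP]) (use h ta in simp)
      then obtain k where k: "k \<Colon> X \<rightarrow> W" "h = b' \<cdot> k" by (rule tri_lift2[OF t h])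
      show "h = zero_mor T X W'"
      proof (cases "i = j")
        case True
        have iso: "isomorphic T (\<Sigma>\<^bsup>j\<^esup> X) V"
          unfolding X_def using shift_unshift_isomorphic[OF VO, of i] True by simp
        have "\<Sigma>\<^bsup>j\<^esup> X \<in> D"
          using subcategory_iso_iff[OF D_sub _ VO iso] XO V by simp
        then obtain m where m: "m \<Colon> X \<rightarrow> P" "p \<cdot> m = k" using pu k(1) by blast
        show ?thesis
          unfolding k(2) m(2)[symmetric] using m(1) ta XO P(1) W'O by (simp add: cmp_reassoc[OF tri_cmp_zero[OF t]])
      next
        case False
        then have "hom_zero V (\<Sigma>\<^bsup>i\<^esup> W)" using van i V by simp
        then have "hom_zero X W" unfolding X_def using hom_zero_unshift VO W by simp
        then have "k = zero_mor T X W" using k(1) by (rule hom_zeroD)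
        then show ?thesis unfolding k(2) using ta XO by simp
      qed
    qed
    then show "hom_zero V (\<Sigma>\<^bsup>i\<^esup> W')" unfolding X_def using hom_zero_unshift VO W'O by simp
  next
    fix Y g assume Y: "Y \<in> Z" and g: "g \<Colon> W \<rightarrow> Y"
    have YO: "Y \<in> Obj T" using Y by (rule Z_ObjD)
    \<comment> \<open>\<open>(P, Y)\<close> is \<open>(P[j], Y[j])\<close> with \<open>P[j]\<close>
      in \<open>D\<close>, so it vanishes, and morphisms from \<open>W\<close> into \<open>Z\<close>
      extend over the cone.\<close>
    have "hom_zero P Y"
      using hom_zero_D_Z[OF SPD Y j] hom_zero_shift_pow[OF P(1) YO] by blast
    then have "g \<cdot> p = zero_mor T P Y" by (rule hom_zeroD) (use g p(1) in simp)
    then obtain h where "h \<Colon> W' \<rightarrow> Y" "g = h \<cdot> b'" by (rule tri_extend[OF t g])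
    then show "\<exists>h. h \<Colon> W' \<rightarrow> Y \<and> h \<cdot> b' = g" by blast
  qed
qed

text \<open>The dual step: \<open>W'\<close> is the fibre of a left approximation of
  \<open>W\<close> by an object of \<open>D[j]\<close>. That approximation is the shift of a left
  \<open>D\<close>-approximation of \<open>V\<close>, which stands for \<open>W[-j]\<close>.\<close>

lemma right_approximation_step:
  assumes W: "W \<in> Obj T" and j: "0 < j" "j < n"
    and van: "\<And>i V. \<lbrakk>j < i; i < n; V \<in> D\<rbrakk> \<Longrightarrow> hom_zero W (\<Sigma>\<^bsup>i\<^esup> V)"
  obtains W' a where "a \<Colon> W' \<rightarrow> W"
    "\<And>i V. \<lbrakk>j \<le> i; i < n; V \<in> D\<rbrakk> \<Longrightarrow> hom_zero W' (\<Sigma>\<^bsup>i\<^esup> V)"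
    "\<And>Y g. \<lbrakk>Y \<in> Z; g \<Colon> Y \<rightarrow> W\<rbrakk> \<Longrightarrow> \<exists>h. h \<Colon> Y \<rightarrow> W' \<and> a \<cdot> h = g"
proof -
  define F where "F = shift T (int j)"
  have F: "autoequivalence T F" unfolding F_def shift_def by (rule autoequivalence_power[OF Shift_auto])
  note F1 = autoequivalenceD[OF F]
  have FX: "Fob F X = \<Sigma>\<^bsup>j\<^esup> X" for X unfolding F_def Fob_shift ..
  obtain V where V: "V \<in> Obj T" "isomorphic T (\<Sigma>\<^bsup>j\<^esup> V) W"
    using F1(4) W unfolding ess_surj_def FX by blast
  obtain D' b where b: "left_approximation T D V D' b"
    using D_ff V(1) unfolding functorially_finite_def by blast
  then have D': "D' \<in> D" "D' \<in> Obj T" and bt: "b \<Colon> V \<rightarrow> D'"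
    and bu: "\<And>Y g. \<lbrakk>Y \<in> D; g \<Colon> V \<rightarrow> Y\<rbrakk> \<Longrightarrow> \<exists>h. h \<Colon> D' \<rightarrow> Y \<and> h \<cdot> b = g"
    unfolding left_approximation_iff[OF D_Obj V(1)] using D_ObjD by blast+
  have SV: "\<Sigma>\<^bsup>j\<^esup> V \<in> Obj T" using V by simp
  obtain \<phi> \<psi> where \<phi>: "\<phi> \<Colon> \<Sigma>\<^bsup>j\<^esup> V \<rightarrow> W" "\<psi> \<Colon> W \<rightarrow> \<Sigma>\<^bsup>j\<^esup> V" "\<phi> \<cdot> \<psi> = ident T W"
    using isomorphicE[OF V(2) SV W] by metis
  define P where "P = \<Sigma>\<^bsup>j\<^esup> D'"
  have P: "P \<in> Obj T" unfolding P_def using D' by simp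
  define p where "p = Fmor F b \<cdot> \<psi>"
  have Fb: "Fmor F b \<Colon> \<Sigma>\<^bsup>j\<^esup> V \<rightarrow> P" unfolding P_def using bt F1(1) by (simp add: FX)
  have p: "p \<Colon> W \<rightarrow> P" unfolding p_def using Fb \<phi> by simp
  have pu: "\<exists>m. m \<Colon> P \<rightarrow> \<Sigma>\<^bsup>j\<^esup> X \<and> m \<cdot> p = q" if X: "X \<in> D" and q: "q \<Colon> W \<rightarrow> \<Sigma>\<^bsup>j\<^esup> X" for X q
  proof -
    have XO: "X \<in> Obj T" using X by (rule D_ObjD)
    have q\<phi>: "q \<cdot> \<phi> \<Colon> Fob F V \<rightarrow> Fob F X" using q \<phi> by (simp add: FX)
    obtain u where u: "u \<Colon> V \<rightarrow> X" "Fmor F u = q \<cdot> \<phi>" by (rule fullE[OF F1(3) q\<phi> V(1) XO])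
    obtain m where m: "m \<Colon> D' \<rightarrow> X" "m \<cdot> b = u" using bu[OF X u(1)] by blast
    have Fm: "Fmor F m \<Colon> P \<rightarrow> \<Sigma>\<^bsup>j\<^esup> X" unfolding P_def using m(1) F1(1) by (simp add: FX)
    have e: "Fmor F m \<cdot> Fmor F b = q \<cdot> \<phi>"
      using m bt F1(1) u(2) by (simp flip: functor_cmp)
    have "Fmor F m \<cdot> p = (q \<cdot> \<phi>) \<cdot> \<psi>"
      unfolding p_def using Fm Fb \<phi>(1,2) q by (simp add: cmp_reassoc[OF e])
    also have "\<dots> = q" using q \<phi> by simp
    finally show ?thesis using Fm by blast
  qed
  obtain W' a c where t: "(W', W, P, a, p, c) \<in> Tri T" by (rule tri_cocone[OF p])
  note ta = tri_arrow[OF t]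
  have W'O: "W' \<in> Obj T" using ta by simp
  show ?thesis
  proof (rule that[OF ta(1)])
    fix i X assume i: "j \<le> i" "i < n" and X: "X \<in> D"
    have XO: "X \<in> Obj T" "\<Sigma>\<^bsup>i\<^esup> X \<in> Obj T" using D_ObjD[OF X] by simp_all
    have e: "\<Sigma>\<^bsup>j\<^esup> (\<Sigma>\<^bsup>Suc (i - j)\<^esup> X) = \<Sigma> (\<Sigma>\<^bsup>i\<^esup> X)"
    proof -
      have "\<Sigma>\<^bsup>j\<^esup> (\<Sigma>\<^bsup>Suc (i - j)\<^esup> X) = \<Sigma>\<^bsup>j + Suc (i - j)\<^esup> X" by (simp only: funpow_add comp_apply)
      also have "j + Suc (i - j) = Suc i" using i(1) by simp
      finally show ?thesis by (simp only: funpow.simps(2) comp_apply)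
    qed
    have "hom_zero D' (\<Sigma>\<^bsup>Suc (i - j)\<^esup> X)"
      by (rule hom_zero_D_Z[OF D'(1) D_ZD[OF X]]) (use i j in simp_all)
    moreover have "\<Sigma>\<^bsup>Suc (i - j)\<^esup> X \<in> Obj T" using XO(1) by (rule shift_pow_Obj)
    ultimately have "hom_zero P (\<Sigma>\<^bsup>j\<^esup> (\<Sigma>\<^bsup>Suc (i - j)\<^esup> X))"
      unfolding P_def using hom_zero_shift_pow[OF D'(2)] by blast
    then have zP: "hom_zero P (\<Sigma> (\<Sigma>\<^bsup>i\<^esup> X))" unfolding e .
    show "hom_zero W' (\<Sigma>\<^bsup>i\<^esup> X)"
    proof (rule hom_zeroI[OF W'O XO(2)])
      fix h assume h: "h \<Colon> W' \<rightarrow> \<Sigma>\<^bsup>i\<^esup> X"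
      have sh: "\<sigma> h \<Colon> \<Sigma> W' \<rightarrow> \<Sigma> (\<Sigma>\<^bsup>i\<^esup> X)" using h by simp
      have "\<sigma> h \<cdot> c = zero_mor T P (\<Sigma> (\<Sigma>\<^bsup>i\<^esup> X))" by (rule hom_zeroD[OF zP]) (use h ta in simp)
      then obtain k where k: "k \<Colon> \<Sigma> W \<rightarrow> \<Sigma> (\<Sigma>\<^bsup>i\<^esup> X)" "\<sigma> h = k \<cdot> \<sigma> a" by (rule tri_extend3[OF t sh])
      obtain l where l: "l \<Colon> W \<rightarrow> \<Sigma>\<^bsup>i\<^esup> X" "\<sigma> l = k" by (rule shift_fullE[OF k(1) W XO(2)])
      have "\<sigma> h = \<sigma> (l \<cdot> a)" using l(1) ta by (simp add: k(2) l(2))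
      then have hl: "h = l \<cdot> a" by (rule shift_faithful) (use l(1) ta h in simp_all)
      show "h = zero_mor T W' (\<Sigma>\<^bsup>i\<^esup> X)"
      proof (cases "i = j")
        case True
        then obtain m where m: "m \<Colon> P \<rightarrow> \<Sigma>\<^bsup>i\<^esup> X" "m \<cdot> p = l" using pu[OF X] l(1) by blast
        show ?thesis unfolding hl m(2)[symmetric] using m(1) ta W'O by (simp add: tri_cmp_zero[OF t])
      next
        case False
        then have "hom_zero W (\<Sigma>\<^bsup>i\<^esup> X)" using van i X by simp
        then have "l = zero_mor T W (\<Sigma>\<^bsup>i\<^esup> X)" using l(1) by (rule hom_zeroD)
        then show ?thesis unfolding hl using ta XO by simp
      qed
    qed
  next
    fix Y g assume Y: "Y \<in> Z" and g: "g \<Colon> Y \<rightarrow> W"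
    have "hom_zero Y P" unfolding P_def by (rule hom_zero_Z_D[OF D'(1) Y j])
    then have "p \<cdot> g = zero_mor T Y P" by (rule hom_zeroD) (use g p in simp)
    then obtain h where "h \<Colon> Y \<rightarrow> W'" "g = a \<cdot> h" by (rule tri_lift[OF t g])
    then show "\<exists>h. h \<Colon> Y \<rightarrow> W' \<and> a \<cdot> h = g" by blast
  qed
qed

lemma left_Z_approximation:
  assumes V: "V \<in> Obj T"
  obtains W f where "W \<in> Z" "f \<Colon> V \<rightarrow> W"
    "\<And>Y g. \<lbrakk>Y \<in> Z; g \<Colon> V \<rightarrow> Y\<rbrakk> \<Longrightarrow> \<exists>h. h \<Colon> W \<rightarrow> Y \<and> h \<cdot> f = g"
proof -
  have lt: "n - 1 < n" using n_ge_2 by simp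
  \<comment> \<open>\<open>k\<close> counts the indices already treated, from n - 1 downwards. After
    n - 1 rounds the bound \<open>n - k\<close> is 1, so every index is covered.\<close>
  have "\<exists>W f. f \<Colon> V \<rightarrow> W \<and> (\<forall>i X. n - k \<le> i \<and> i < n \<and> X \<in> D \<longrightarrow> hom_zero X (\<Sigma>\<^bsup>i\<^esup> W)) \<and>
      (\<forall>Y g. Y \<in> Z \<and> g \<Colon> V \<rightarrow> Y \<longrightarrow> (\<exists>h. h \<Colon> W \<rightarrow> Y \<and> h \<cdot> f = g))" if "k < n" for k
    using that
  proof (induction k)
    case 0
    show ?case
    proof (rule exI[of _ V], rule exI[of _ "ident T V"], intro conjI allI impI)
      show "\<exists>h. h \<Colon> V \<rightarrow> Y \<and> h \<cdot> ident T V = g" if "Y \<in> Z \<and> g \<Colon> V \<rightarrow> Y" for Y g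
        using that by (intro exI[of _ g]) simp
    qed (use V in auto)
  next
    case (Suc k)
    then obtain W f where f: "f \<Colon> V \<rightarrow> W"
      and van: "\<And>i X. \<lbrakk>n - k \<le> i; i < n; X \<in> D\<rbrakk> \<Longrightarrow> hom_zero X (\<Sigma>\<^bsup>i\<^esup> W)"
      and un: "\<And>Y g. \<lbrakk>Y \<in> Z; g \<Colon> V \<rightarrow> Y\<rbrakk> \<Longrightarrow> \<exists>h. h \<Colon> W \<rightarrow> Y \<and> h \<cdot> f = g"
      using Suc_lessD by blast
    have W: "W \<in> Obj T" using f by simp
    have j: "0 < n - Suc k" "n - Suc k < n" using Suc.prems by simp_all
    have van': "hom_zero X (\<Sigma>\<^bsup>i\<^esup> W)" if "n - Suc k < i" "i < n" "X \<in> D" for i X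
      by (rule van) (use that Suc.prems in simp_all)
    obtain W' b where b: "b \<Colon> W \<rightarrow> W'"
      and v: "\<And>i X. \<lbrakk>n - Suc k \<le> i; i < n; X \<in> D\<rbrakk> \<Longrightarrow> hom_zero X (\<Sigma>\<^bsup>i\<^esup> W')"
      and u: "\<And>Y g. \<lbrakk>Y \<in> Z; g \<Colon> W \<rightarrow> Y\<rbrakk> \<Longrightarrow> \<exists>h. h \<Colon> W' \<rightarrow> Y \<and> h \<cdot> b = g"
      by (rule left_approximation_step[OF W j]) ((rule van'; assumption) | (rule that; assumption))+
    have bf: "b \<cdot> f \<Colon> V \<rightarrow> W'" using b f by simp
    have un': "\<exists>h. h \<Colon> W' \<rightarrow> Y \<and> h \<cdot> b \<cdot> f = g" if Y: "Y \<in> Z" and g: "g \<Colon> V \<rightarrow> Y" for Y g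
    proof -
      obtain h where h: "h \<Colon> W \<rightarrow> Y" "h \<cdot> f = g" using un[OF Y g] by blast
      obtain l where l: "l \<Colon> W' \<rightarrow> Y" "l \<cdot> b = h" using u[OF Y h(1)] by blast
      have "l \<cdot> b \<cdot> f = g" using l(1) b f h(2) by (simp add: cmp_reassoc[OF l(2)])
      with l(1) show ?thesis by blast
    qed
    show ?case using bf v un' by blast
  qed
  from this[OF lt] obtain W f where f: "f \<Colon> V \<rightarrow> W"
    and van: "\<forall>i X. n - (n - 1) \<le> i \<and> i < n \<and> X \<in> D \<longrightarrow> hom_zero X (\<Sigma>\<^bsup>i\<^esup> W)"
    and un: "\<forall>Y g. Y \<in> Z \<and> g \<Colon> V \<rightarrow> Y \<longrightarrow> (\<exists>h. h \<Colon> W \<rightarrow> Y \<and> h \<cdot> f = g)"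
    by blast
  have W: "W \<in> Obj T" using f by simp
  have "W \<in> Z" unfolding Z_right[OF W] using van n_ge_2 by auto
  then show ?thesis using that f un by blast
qed

lemma right_Z_approximation:
  assumes V: "V \<in> Obj T"
  obtains W f where "W \<in> Z" "f \<Colon> W \<rightarrow> V"
    "\<And>Y g. \<lbrakk>Y \<in> Z; g \<Colon> Y \<rightarrow> V\<rbrakk> \<Longrightarrow> \<exists>h. h \<Colon> Y \<rightarrow> W \<and> f \<cdot> h = g"
proof -
  have lt: "n - 1 < n" using n_ge_2 by simp
  have "\<exists>W f. f \<Colon> W \<rightarrow> V \<and> (\<forall>i X. n - k \<le> i \<and> i < n \<and> X \<in> D \<longrightarrow> hom_zero W (\<Sigma>\<^bsup>i\<^esup> X)) \<and>
      (\<forall>Y g. Y \<in> Z \<and> g \<Colon> Y \<rightarrow> V \<longrightarrow> (\<exists>h. h \<Colon> Y \<rightarrow> W \<and> f \<cdot> h = g))" if "k < n" for k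
    using that
  proof (induction k)
    case 0
    show ?case
    proof (rule exI[of _ V], rule exI[of _ "ident T V"], intro conjI allI impI)
      show "\<exists>h. h \<Colon> Y \<rightarrow> V \<and> ident T V \<cdot> h = g" if "Y \<in> Z \<and> g \<Colon> Y \<rightarrow> V" for Y g
        using that by (intro exI[of _ g]) simp
    qed (use V in auto)
  next
    case (Suc k)
    then obtain W f where f: "f \<Colon> W \<rightarrow> V"
      and van: "\<And>i X. \<lbrakk>n - k \<le> i; i < n; X \<in> D\<rbrakk> \<Longrightarrow> hom_zero W (\<Sigma>\<^bsup>i\<^esup> X)"
      and un: "\<And>Y g. \<lbrakk>Y \<in> Z; g \<Colon> Y \<rightarrow> V\<rbrakk> \<Longrightarrow> \<exists>h. h \<Colon> Y \<rightarrow> W \<and> f \<cdot> h = g"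
      using Suc_lessD by blast
    have W: "W \<in> Obj T" using f by simp
    have j: "0 < n - Suc k" "n - Suc k < n" using Suc.prems by simp_all
    have van': "hom_zero W (\<Sigma>\<^bsup>i\<^esup> X)" if "n - Suc k < i" "i < n" "X \<in> D" for i X
      by (rule van) (use that Suc.prems in simp_all)
    obtain W' a where a: "a \<Colon> W' \<rightarrow> W"
      and v: "\<And>i X. \<lbrakk>n - Suc k \<le> i; i < n; X \<in> D\<rbrakk> \<Longrightarrow> hom_zero W' (\<Sigma>\<^bsup>i\<^esup> X)"
      and u: "\<And>Y g. \<lbrakk>Y \<in> Z; g \<Colon> Y \<rightarrow> W\<rbrakk> \<Longrightarrow> \<exists>h. h \<Colon> Y \<rightarrow> W' \<and> a \<cdot> h = g"
      by (rule right_approximation_step[OF W j]) ((rule van'; assumption) | (rule that; assumption))+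
    have fa: "f \<cdot> a \<Colon> W' \<rightarrow> V" using a f by simp
    have un': "\<exists>h. h \<Colon> Y \<rightarrow> W' \<and> (f \<cdot> a) \<cdot> h = g" if Y: "Y \<in> Z" and g: "g \<Colon> Y \<rightarrow> V" for Y g
    proof -
      obtain h where h: "h \<Colon> Y \<rightarrow> W" "f \<cdot> h = g" using un[OF Y g] by blast
      obtain l where l: "l \<Colon> Y \<rightarrow> W'" "a \<cdot> l = h" using u[OF Y h(1)] by blast
      have "(f \<cdot> a) \<cdot> l = g" using l a f h(2) by simp
      with l(1) show ?thesis by blast
    qed
    show ?case using fa v un' by blast
  qed
  from this[OF lt] obtain W f where f: "f \<Colon> W \<rightarrow> V"
    and van: "\<forall>i X. n - (n - 1) \<le> i \<and> i < n \<and> X \<in> D \<longrightarrow> hom_zero W (\<Sigma>\<^bsup>i\<^esup> X)"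
    and un: "\<forall>Y g. Y \<in> Z \<and> g \<Colon> Y \<rightarrow> V \<longrightarrow> (\<exists>h. h \<Colon> Y \<rightarrow> W \<and> f \<cdot> h = g)"
    by blast
  have W: "W \<in> Obj T" using f by simp
  have "W \<in> Z" unfolding Z_left[OF W] using van n_ge_2 by auto
  then show ?thesis using that f un by blast
qed

section \<open>Functorial finiteness in the quotient\<close>

lemma U_right_approximation_iff:
  assumes C: "C \<subseteq> Z" and V: "V \<in> Z"
  shows "(\<exists>X \<Phi>. right_approximation U C X V \<Phi>) \<longleftrightarrow> (\<exists>X f. X \<in> C \<and> f \<Colon> X \<rightarrow> V \<and>
    (\<forall>Y\<in>C. \<forall>g. g \<Colon> Y \<rightarrow> V \<longrightarrow> (\<exists>h. h \<Colon> Y \<rightarrow> X \<and> f \<cdot> h \<approx> g)))"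
proof
  assume "\<exists>X \<Phi>. right_approximation U C X V \<Phi>"
  then obtain X \<Phi> where X: "X \<in> C" and \<Phi>: "\<Phi> \<in> mor U X V"
    and u: "\<forall>Y\<in>C. \<forall>\<Psi>\<in>mor U Y V. \<exists>\<Theta>\<in>mor U Y X. \<Psi> = \<Phi> \<cdot>\<^bsub>U\<^esub> \<Theta>"
    unfolding right_approximation_def by blast
  have XZ: "X \<in> Z" using X C by blast
  obtain f where f: "f \<Colon> X \<rightarrow> V" "\<Phi> = cls f"
    using \<Phi> XZ V Z_ObjD unfolding U_mor arrow_def by blast
  have "\<exists>h. h \<Colon> Y \<rightarrow> X \<and> f \<cdot> h \<approx> g" if Y: "Y \<in> C" and g: "g \<Colon> Y \<rightarrow> V" for Y g
  proof -
    have YZ: "Y \<in> Z" using Y C by blast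
    have "cls g \<in> mor U Y V" using g unfolding U_mor arrow_def by blast
    then obtain \<Theta> where \<Theta>: "\<Theta> \<in> mor U Y X" "cls g = \<Phi> \<cdot>\<^bsub>U\<^esub> \<Theta>" using u Y by blast
    obtain h where h: "h \<Colon> Y \<rightarrow> X" "\<Theta> = cls h"
      using \<Theta>(1) XZ YZ Z_ObjD unfolding U_mor arrow_def by blast
    have fh: "f \<cdot> h \<Colon> Y \<rightarrow> V" using f(1) h(1) by simp
    have "cls (f \<cdot> h) = cls g" using \<Theta>(2) unfolding f(2) h(2) U_cmp[OF h(1) f(1)] by simp
    then show ?thesis using h(1) cls_eq_iff[OF fh] by blast
  qed
  then show "\<exists>X f. X \<in> C \<and> f \<Colon> X \<rightarrow> V \<and>
    (\<forall>Y\<in>C. \<forall>g. g \<Colon> Y \<rightarrow> V \<longrightarrow> (\<exists>h. h \<Colon> Y \<rightarrow> X \<and> f \<cdot> h \<approx> g))"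
    using X f(1) by blast
next
  assume "\<exists>X f. X \<in> C \<and> f \<Colon> X \<rightarrow> V \<and>
    (\<forall>Y\<in>C. \<forall>g. g \<Colon> Y \<rightarrow> V \<longrightarrow> (\<exists>h. h \<Colon> Y \<rightarrow> X \<and> f \<cdot> h \<approx> g))"
  then obtain X f where X: "X \<in> C" and f: "f \<Colon> X \<rightarrow> V"
    and u: "\<forall>Y\<in>C. \<forall>g. g \<Colon> Y \<rightarrow> V \<longrightarrow> (\<exists>h. h \<Colon> Y \<rightarrow> X \<and> f \<cdot> h \<approx> g)" by blast
  have "right_approximation U C X V (cls f)"
    unfolding right_approximation_def
  proof (intro conjI ballI)
    show "X \<in> C" by fact
    show "cls f \<in> mor U X V" using f unfolding U_mor arrow_def by blast
    fix Y \<Psi> assume Y: "Y \<in> C" and "\<Psi> \<in> mor U Y V"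
    then obtain g where g: "g \<Colon> Y \<rightarrow> V" "\<Psi> = cls g"
      using C V Z_ObjD unfolding U_mor arrow_def by blast
    obtain h where h: "h \<Colon> Y \<rightarrow> X" "f \<cdot> h \<approx> g" using u Y g(1) by blast
    have fh: "f \<cdot> h \<Colon> Y \<rightarrow> V" using f(1) h(1) by simp
    have "\<Psi> = cls f \<cdot>\<^bsub>U\<^esub> cls h" unfolding g(2) U_cmp[OF h(1) f(1)] using cls_eq_iff[OF fh] h(2) by blast
    moreover have "cls h \<in> mor U Y X" using h(1) unfolding U_mor arrow_def by blast
    ultimately show "\<exists>\<Theta>\<in>mor U Y X. \<Psi> = cls f \<cdot>\<^bsub>U\<^esub> \<Theta>" by blast
  qed
  then show "\<exists>X \<Phi>. right_approximation U C X V \<Phi>" by blast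
qed

lemma U_left_approximation_iff:
  assumes C: "C \<subseteq> Z" and V: "V \<in> Z"
  shows "(\<exists>X \<Phi>. left_approximation U C V X \<Phi>) \<longleftrightarrow> (\<exists>X f. X \<in> C \<and> f \<Colon> V \<rightarrow> X \<and>
    (\<forall>Y\<in>C. \<forall>g. g \<Colon> V \<rightarrow> Y \<longrightarrow> (\<exists>h. h \<Colon> X \<rightarrow> Y \<and> h \<cdot> f \<approx> g)))"
proof
  assume "\<exists>X \<Phi>. left_approximation U C V X \<Phi>"
  then obtain X \<Phi> where X: "X \<in> C" and \<Phi>: "\<Phi> \<in> mor U V X"
    and u: "\<forall>Y\<in>C. \<forall>\<Psi>\<in>mor U V Y. \<exists>\<Theta>\<in>mor U X Y. \<Psi> = \<Theta> \<cdot>\<^bsub>U\<^esub> \<Phi>"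
    unfolding left_approximation_def by blast
  have XZ: "X \<in> Z" using X C by blast
  obtain f where f: "f \<Colon> V \<rightarrow> X" "\<Phi> = cls f"
    using \<Phi> XZ V Z_ObjD unfolding U_mor arrow_def by blast
  have "\<exists>h. h \<Colon> X \<rightarrow> Y \<and> h \<cdot> f \<approx> g" if Y: "Y \<in> C" and g: "g \<Colon> V \<rightarrow> Y" for Y g
  proof -
    have YZ: "Y \<in> Z" using Y C by blast
    have "cls g \<in> mor U V Y" using g unfolding U_mor arrow_def by blast
    then obtain \<Theta> where \<Theta>: "\<Theta> \<in> mor U X Y" "cls g = \<Theta> \<cdot>\<^bsub>U\<^esub> \<Phi>" using u Y by blast
    obtain h where h: "h \<Colon> X \<rightarrow> Y" "\<Theta> = cls h"
      using \<Theta>(1) XZ YZ Z_ObjD unfolding U_mor arrow_def by blast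
    have fh: "h \<cdot> f \<Colon> V \<rightarrow> Y" using f(1) h(1) by simp
    have "cls (h \<cdot> f) = cls g" using \<Theta>(2) unfolding f(2) h(2) U_cmp[OF f(1) h(1)] by simp
    then show ?thesis using h(1) cls_eq_iff[OF fh] by blast
  qed
  then show "\<exists>X f. X \<in> C \<and> f \<Colon> V \<rightarrow> X \<and>
    (\<forall>Y\<in>C. \<forall>g. g \<Colon> V \<rightarrow> Y \<longrightarrow> (\<exists>h. h \<Colon> X \<rightarrow> Y \<and> h \<cdot> f \<approx> g))"
    using X f(1) by blast
next
  assume "\<exists>X f. X \<in> C \<and> f \<Colon> V \<rightarrow> X \<and>
    (\<forall>Y\<in>C. \<forall>g. g \<Colon> V \<rightarrow> Y \<longrightarrow> (\<exists>h. h \<Colon> X \<rightarrow> Y \<and> h \<cdot> f \<approx> g))"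
  then obtain X f where X: "X \<in> C" and f: "f \<Colon> V \<rightarrow> X"
    and u: "\<forall>Y\<in>C. \<forall>g. g \<Colon> V \<rightarrow> Y \<longrightarrow> (\<exists>h. h \<Colon> X \<rightarrow> Y \<and> h \<cdot> f \<approx> g)" by blast
  have "left_approximation U C V X (cls f)"
    unfolding left_approximation_def
  proof (intro conjI ballI)
    show "X \<in> C" by fact
    show "cls f \<in> mor U V X" using f unfolding U_mor arrow_def by blast
    fix Y \<Psi> assume Y: "Y \<in> C" and "\<Psi> \<in> mor U V Y"
    then obtain g where g: "g \<Colon> V \<rightarrow> Y" "\<Psi> = cls g"
      using C V Z_ObjD unfolding U_mor arrow_def by blast
    obtain h where h: "h \<Colon> X \<rightarrow> Y" "h \<cdot> f \<approx> g" using u Y g(1) by blast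
    have fh: "h \<cdot> f \<Colon> V \<rightarrow> Y" using f(1) h(1) by simp
    have "\<Psi> = cls h \<cdot>\<^bsub>U\<^esub> cls f" unfolding g(2) U_cmp[OF f(1) h(1)] using cls_eq_iff[OF fh] h(2) by blast
    moreover have "cls h \<in> mor U X Y" using h(1) unfolding U_mor arrow_def by blast
    ultimately show "\<exists>\<Theta>\<in>mor U X Y. \<Psi> = \<Theta> \<cdot>\<^bsub>U\<^esub> cls f" by blast
  qed
  then show "\<exists>X \<Phi>. left_approximation U C V X \<Phi>" by blast
qed

lemma functorially_finite_imp_U:
  assumes C: "C \<subseteq> Z" and ff: "functorially_finite T C"
  shows "functorially_finite U C"
  unfolding functorially_finite_def U_sel(1)
proof (intro ballI conjI)
  fix V assume V: "V \<in> Z"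
  have VO: "V \<in> Obj T" and CO: "C \<subseteq> Obj T" using V C Z_Obj by blast+
  obtain X f where X: "right_approximation T C X V f" using ff VO unfolding functorially_finite_def by blast
  then show "\<exists>X \<Phi>. right_approximation U C X V \<Phi>"
    unfolding U_right_approximation_iff[OF C V] right_approximation_iff[OF CO VO]
    using cong_refl by metis
  obtain X f where X: "left_approximation T C V X f" using ff VO unfolding functorially_finite_def by blast
  then show "\<exists>X \<Phi>. left_approximation U C V X \<Phi>"
    unfolding U_left_approximation_iff[OF C V] left_approximation_iff[OF CO VO]
    using cong_refl by metis
qed

text \<open>Follow a right \<open>Z\<close>-approximation \<open>W\<close> of \<open>V\<close> by a
  right \<open>C\<close>-approximation of \<open>W\<close> modulo \<open>[D]\<close>. Lifts along
  the latter exist up to an error through \<open>D\<close>; adding a right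
  \<open>D\<close>-approximation of \<open>W\<close> as a second summand absorbs the error.\<close>

lemma functorially_finite_U_imp_right:
  assumes C: "subcategory T C" "D \<subseteq> C" "C \<subseteq> Z" and ff: "functorially_finite U C" and V: "V \<in> Obj T"
  shows "\<exists>X f. right_approximation T C X V f"
proof -
  have CO: "C \<subseteq> Obj T" using C Z_Obj by blast
  obtain W f where W: "W \<in> Z" and f: "f \<Colon> W \<rightarrow> V"
    and fu: "\<And>Y g. \<lbrakk>Y \<in> Z; g \<Colon> Y \<rightarrow> V\<rbrakk> \<Longrightarrow> \<exists>h. h \<Colon> Y \<rightarrow> W \<and> f \<cdot> h = g"
    by (rule right_Z_approximation[OF V]) (rule that; assumption)
  have WO: "W \<in> Obj T" using W by (rule Z_ObjD)
  obtain X p where X: "X \<in> C" and p: "p \<Colon> X \<rightarrow> W"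
    and pu: "\<forall>Y\<in>C. \<forall>g. g \<Colon> Y \<rightarrow> W \<longrightarrow> (\<exists>h. h \<Colon> Y \<rightarrow> X \<and> p \<cdot> h \<approx> g)"
    using ff W U_right_approximation_iff[OF C(3) W] unfolding functorially_finite_def U_sel(1) by blast
  obtain D' b where "right_approximation T D D' W b"
    using D_ff WO unfolding functorially_finite_def by blast
  then have D': "D' \<in> D" and b: "b \<Colon> D' \<rightarrow> W"
    and bu: "\<forall>Y\<in>D. \<forall>g. g \<Colon> Y \<rightarrow> W \<longrightarrow> (\<exists>h. h \<Colon> Y \<rightarrow> D' \<and> b \<cdot> h = g)"
    unfolding right_approximation_iff[OF D_Obj WO] by blast+
  have O: "X \<in> Obj T" "D' \<in> Obj T" using X CO D' D_Obj by blast+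
  obtain S i j r q where S: "direct_sum T [X, D'] S" "S \<in> Obj T"
    "i \<Colon> X \<rightarrow> S" "j \<Colon> D' \<rightarrow> S" "r \<Colon> S \<rightarrow> X" "q \<Colon> S \<rightarrow> D'"
    "r \<cdot> i = ident T X" "q \<cdot> j = ident T D'" "r \<cdot> j = zero_mor T D' X" "q \<cdot> i = zero_mor T X D'"
    by (rule binary_sum_exists[OF O])
  have SC: "S \<in> C" using subcategory_sum[OF C(1) S(1)] X D' C(2) by blast
  define P where "P = p \<cdot> r \<boxplus> b \<cdot> q"
  have P: "P \<Colon> S \<rightarrow> W" unfolding P_def using p b S(3-6) by simp
  have "right_approximation T C S V (f \<cdot> P)"
    unfolding right_approximation_iff[OF CO V]
  proof (intro conjI ballI allI impI)
    show "S \<in> C" by fact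
    show "f \<cdot> P \<Colon> S \<rightarrow> V" using f P by simp
    fix Y g assume Y: "Y \<in> C" and g: "g \<Colon> Y \<rightarrow> V"
    obtain g' where g': "g' \<Colon> Y \<rightarrow> W" "f \<cdot> g' = g" using fu g Y C(3) by blast
    obtain h where h: "h \<Colon> Y \<rightarrow> X" "p \<cdot> h \<approx> g'" using pu Y g'(1) by blast
    have ph: "p \<cdot> h \<Colon> Y \<rightarrow> W" using p h(1) by simp
    obtain t where t: "t \<Colon> Y \<rightarrow> W" "factors D t" "p \<cdot> h \<boxplus> t = g'" by (rule congE[OF h(2) ph])
    obtain E u v where E: "E \<in> D" "E \<in> Obj T" "u \<Colon> Y \<rightarrow> E" "v \<Colon> E \<rightarrow> W" "v \<cdot> u = t"
      by (rule factorsE[OF t(2,1)])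
    obtain m where m: "m \<Colon> E \<rightarrow> D'" "b \<cdot> m = v" using bu E(1,4) by blast
    define l where "l = i \<cdot> h \<boxplus> j \<cdot> m \<cdot> u"
    have l: "l \<Colon> Y \<rightarrow> S" unfolding l_def using h(1) m(1) E(3) S(3,4) by simp
    have "P \<cdot> l = p \<cdot> h \<boxplus> b \<cdot> m \<cdot> u"
      unfolding P_def l_def using p b h(1) m(1) E(3) S(3-6) O
      by (simp add: cmp_add_left cmp_add_right cmp_reassoc[OF S(7)] cmp_reassoc[OF S(8)]
          cmp_reassoc[OF S(9)] cmp_reassoc[OF S(10)])
    also have "b \<cdot> m \<cdot> u = t" using b m(1) E(3,5) by (simp add: cmp_reassoc[OF m(2)])
    finally have Pl: "P \<cdot> l = g'" using t(3) by simp
    have "(f \<cdot> P) \<cdot> l = g" using f P l Pl g'(2) by simp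
    with l show "\<exists>h. h \<Colon> Y \<rightarrow> S \<and> (f \<cdot> P) \<cdot> h = g" by blast
  qed
  then show ?thesis by blast
qed

text \<open>Dually, the error is absorbed by a left \<open>D\<close>-approximation of
  \<open>W\<close>, added as a second component of the target.\<close>

lemma functorially_finite_U_imp_left:
  assumes C: "subcategory T C" "D \<subseteq> C" "C \<subseteq> Z" and ff: "functorially_finite U C" and V: "V \<in> Obj T"
  shows "\<exists>X f. left_approximation T C V X f"
proof -
  have CO: "C \<subseteq> Obj T" using C Z_Obj by blast
  obtain W f where W: "W \<in> Z" and f: "f \<Colon> V \<rightarrow> W"
    and fu: "\<And>Y g. \<lbrakk>Y \<in> Z; g \<Colon> V \<rightarrow> Y\<rbrakk> \<Longrightarrow> \<exists>h. h \<Colon> W \<rightarrow> Y \<and> h \<cdot> f = g"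
    by (rule left_Z_approximation[OF V]) (rule that; assumption)
  have WO: "W \<in> Obj T" using W by (rule Z_ObjD)
  obtain X p where X: "X \<in> C" and p: "p \<Colon> W \<rightarrow> X"
    and pu: "\<forall>Y\<in>C. \<forall>g. g \<Colon> W \<rightarrow> Y \<longrightarrow> (\<exists>h. h \<Colon> X \<rightarrow> Y \<and> h \<cdot> p \<approx> g)"
    using ff W U_left_approximation_iff[OF C(3) W] unfolding functorially_finite_def U_sel(1) by blast
  obtain D' b where "left_approximation T D W D' b"
    using D_ff WO unfolding functorially_finite_def by blast
  then have D': "D' \<in> D" and b: "b \<Colon> W \<rightarrow> D'"
    and bu: "\<forall>Y\<in>D. \<forall>g. g \<Colon> W \<rightarrow> Y \<longrightarrow> (\<exists>h. h \<Colon> D' \<rightarrow> Y \<and> h \<cdot> b = g)"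
    unfolding left_approximation_iff[OF D_Obj WO] by blast+
  have O: "X \<in> Obj T" "D' \<in> Obj T" using X CO D' D_Obj by blast+
  obtain S i j r q where S: "direct_sum T [X, D'] S" "S \<in> Obj T"
    "i \<Colon> X \<rightarrow> S" "j \<Colon> D' \<rightarrow> S" "r \<Colon> S \<rightarrow> X" "q \<Colon> S \<rightarrow> D'"
    "r \<cdot> i = ident T X" "q \<cdot> j = ident T D'" "r \<cdot> j = zero_mor T D' X" "q \<cdot> i = zero_mor T X D'"
    by (rule binary_sum_exists[OF O])
  have SC: "S \<in> C" using subcategory_sum[OF C(1) S(1)] X D' C(2) by blast
  define P where "P = i \<cdot> p \<boxplus> j \<cdot> b"
  have P: "P \<Colon> W \<rightarrow> S" unfolding P_def using p b S(3-6) by simp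
  have "left_approximation T C V S (P \<cdot> f)"
    unfolding left_approximation_iff[OF CO V]
  proof (intro conjI ballI allI impI)
    show "S \<in> C" by fact
    show "P \<cdot> f \<Colon> V \<rightarrow> S" using f P by simp
    fix Y g assume Y: "Y \<in> C" and g: "g \<Colon> V \<rightarrow> Y"
    obtain g' where g': "g' \<Colon> W \<rightarrow> Y" "g' \<cdot> f = g" using fu g Y C(3) by blast
    obtain h where h: "h \<Colon> X \<rightarrow> Y" "h \<cdot> p \<approx> g'" using pu Y g'(1) by blast
    have hp: "h \<cdot> p \<Colon> W \<rightarrow> Y" using p h(1) by simp
    obtain t where t: "t \<Colon> W \<rightarrow> Y" "factors D t" "h \<cdot> p \<boxplus> t = g'" by (rule congE[OF h(2) hp])
    obtain E u v where E: "E \<in> D" "E \<in> Obj T" "u \<Colon> W \<rightarrow> E" "v \<Colon> E \<rightarrow> Y" "v \<cdot> u = t"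
      by (rule factorsE[OF t(2,1)])
    obtain m where m: "m \<Colon> D' \<rightarrow> E" "m \<cdot> b = u" using bu E(1,3) by blast
    define l where "l = h \<cdot> r \<boxplus> v \<cdot> m \<cdot> q"
    have l: "l \<Colon> S \<rightarrow> Y" unfolding l_def using h(1) m(1) E(4) S(5,6) by simp
    have "l \<cdot> P = h \<cdot> p \<boxplus> v \<cdot> m \<cdot> b"
      unfolding P_def l_def using p b h(1) m(1) E(4) S(3-6) O
      by (simp add: cmp_add_left cmp_add_right cmp_reassoc[OF S(7)] cmp_reassoc[OF S(8)]
          cmp_reassoc[OF S(9)] cmp_reassoc[OF S(10)])
    also have "v \<cdot> m \<cdot> b = t" using m(2) E(5) by simp
    finally have Pl: "l \<cdot> P = g'" using t(3) by simp
    have "l \<cdot> P \<cdot> f = g" using f P l g'(2) by (simp add: cmp_reassoc[OF Pl])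
    with l show "\<exists>h. h \<Colon> S \<rightarrow> Y \<and> h \<cdot> P \<cdot> f = g" by blast
  qed
  then show ?thesis by blast
qed

lemma functorially_finite_U_iff:
  assumes "subcategory T C" "D \<subseteq> C" "C \<subseteq> Z"
  shows "functorially_finite U C \<longleftrightarrow> functorially_finite T C"
  using functorially_finite_imp_U[OF assms(3)] functorially_finite_U_imp_right[OF assms]
    functorially_finite_U_imp_left[OF assms]
  unfolding functorially_finite_def by blast

section \<open>Rigidity, orthogonality and stability compared in \<open>T\<close> and
  \<open>U\<close>\<close>

lemma rigid_imp_subset_Z:
  assumes "subcategory T C" "D \<subseteq> C" "\<And>i X Y. \<lbrakk>0 < i; i < n; X \<in> C; Y \<in> C\<rbrakk> \<Longrightarrow> hom_zero X (\<Sigma>\<^bsup>i\<^esup> Y)"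
  shows "C \<subseteq> Z"
proof
  fix X assume X: "X \<in> C"
  have XO: "X \<in> Obj T" using X assms(1) unfolding subcategory_def by blast
  show "X \<in> Z" unfolding Z_left[OF XO] using assms X by auto
qed

lemma U_n_rigid_iff: "n_rigid U n C \<longleftrightarrow> n_rigid T n C \<and> D \<subseteq> C"
proof -
  have eq: "(\<forall>i\<in>{1..<n}. \<forall>X\<in>C. \<forall>Y\<in>C. U.hom_zero X ((Fob (Shift U) ^^ i) Y))
      \<longleftrightarrow> (\<forall>i\<in>{1..<n}. \<forall>X\<in>C. \<forall>Y\<in>C. hom_zero X (\<Sigma>\<^bsup>i\<^esup> Y))" if "C \<subseteq> Z"
    by (intro ball_cong refl U_hom_zero_shift) (use that in auto)
  have "C \<subseteq> Z" if "n_rigid T n C" "D \<subseteq> C"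
    by (rule rigid_imp_subset_Z[OF _ that(2)]) (use that(1) in \<open>auto simp: n_rigid_iff\<close>)
  then show ?thesis
    unfolding n_rigid_iff U.n_rigid_iff subcategory_U_iff using eq by blast
qed

text \<open>As \<open>C\<close> contains \<open>D\<close>, an object of \<open>T\<close> orthogonal
  to \<open>C\<close> is orthogonal to \<open>D\<close>. The perpendicular taken in \<open>T\<close>
  therefore stays inside \<open>Z\<close>, where Hom into shifts vanishes in both categories
  alike.\<close>

lemma U_n_right_perp:
  assumes "D \<subseteq> C" "C \<subseteq> Z"
  shows "n_right_perp U n C = n_right_perp T n C"
proof -
  have C: "C \<subseteq> Obj T" "C \<subseteq> Obj U" using assms Z_Obj by (auto simp: U_sel)
  have "n_right_perp T n C \<subseteq> Z"
    unfolding n_right_perp_eq[OF C(1)] using Z_right assms(1) by blast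
  then have "n_right_perp T n C = {W \<in> Z. \<forall>i\<in>{1..<n}. \<forall>X\<in>C. hom_zero X (\<Sigma>\<^bsup>i\<^esup> W)}"
    unfolding n_right_perp_eq[OF C(1)] using Z_Obj by blast
  also have "\<dots> = {W \<in> Z. \<forall>i\<in>{1..<n}. \<forall>X\<in>C. U.hom_zero X ((Fob (Shift U) ^^ i) W)}"
    by (intro Collect_cong conj_cong refl ball_cong U_hom_zero_shift[symmetric]) (use assms in auto)
  finally show ?thesis unfolding U.n_right_perp_eq[OF C(2)] U_sel(1) by simp
qed

lemma U_n_left_perp:
  assumes "D \<subseteq> C" "C \<subseteq> Z"
  shows "n_left_perp U n C = n_left_perp T n C"
proof -
  have C: "C \<subseteq> Obj T" "C \<subseteq> Obj U" using assms Z_Obj by (auto simp: U_sel)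
  have "n_left_perp T n C \<subseteq> Z"
    unfolding n_left_perp_eq[OF C(1)] using Z_left assms(1) by blast
  then have "n_left_perp T n C = {W \<in> Z. \<forall>i\<in>{1..<n}. \<forall>X\<in>C. hom_zero W (\<Sigma>\<^bsup>i\<^esup> X)}"
    unfolding n_left_perp_eq[OF C(1)] using Z_Obj by blast
  also have "\<dots> = {W \<in> Z. \<forall>i\<in>{1..<n}. \<forall>X\<in>C. U.hom_zero W ((Fob (Shift U) ^^ i) X)}"
    by (intro Collect_cong conj_cong refl ball_cong U_hom_zero_shift[symmetric]) (use assms in auto)
  finally show ?thesis unfolding U.n_left_perp_eq[OF C(2)] U_sel(1) by simp
qed

text \<open>A cluster tilting subcategory of \<open>T\<close> is contained in its own perpendicular,
  hence rigid; containing \<open>D\<close>, it must lie in \<open>Z\<close>. Both sides thus concern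
  subcategories between \<open>D\<close> and \<open>Z\<close>.\<close>

lemma U_n_cluster_tilting_iff: "n_cluster_tilting U n C \<longleftrightarrow> n_cluster_tilting T n C \<and> D \<subseteq> C"
proof -
  have CZ: "C \<subseteq> Z" if C: "n_cluster_tilting T n C" "D \<subseteq> C"
  proof (rule rigid_imp_subset_Z[OF _ C(2)])
    show s: "subcategory T C" using C(1) unfolding n_cluster_tilting_def by blast
    have CO: "C \<subseteq> Obj T" using s unfolding subcategory_def by blast
    have e: "C = {W \<in> Obj T. \<forall>i\<in>{1..<n}. \<forall>X\<in>C. hom_zero W (\<Sigma>\<^bsup>i\<^esup> X)}"
      using C(1) unfolding n_cluster_tilting_def n_left_perp_eq[OF CO] by blast
    fix i X Y assume i: "0 < i" "i < n" and X: "X \<in> C" "Y \<in> C"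
    have "\<forall>i\<in>{1..<n}. \<forall>Y\<in>C. hom_zero X (\<Sigma>\<^bsup>i\<^esup> Y)" using X(1) e by blast
    then show "hom_zero X (\<Sigma>\<^bsup>i\<^esup> Y)" using i X(2) by auto
  qed
  have "n_cluster_tilting U n C \<longleftrightarrow> n_cluster_tilting T n C" if "subcategory T C" "D \<subseteq> C" "C \<subseteq> Z"
    unfolding n_cluster_tilting_def subcategory_U_iff functorially_finite_U_iff[OF that]
      U_n_right_perp[OF that(2,3)] U_n_left_perp[OF that(2,3)]
    using that by blast
  moreover have "subcategory T C \<and> D \<subseteq> C \<and> C \<subseteq> Z" if "n_cluster_tilting U n C"
    using that unfolding n_cluster_tilting_def subcategory_U_iff by blast
  moreover have "subcategory T C" if "n_cluster_tilting T n C"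
    using that unfolding n_cluster_tilting_def by blast
  ultimately show ?thesis using CZ by blast
qed

lemma U_stable_subcategory_iff:
  assumes "subcategory T C" "D \<subseteq> C" "C \<subseteq> Z"
  shows "stable_subcategory U USn C \<longleftrightarrow> stable_subcategory T Sn C"
proof -
  have CU: "subcategory U C" unfolding subcategory_U_iff using assms by blast
  have e: "Fob USn X \<in> C \<longleftrightarrow> Fob Sn X \<in> C" if X: "X \<in> Z" for X
  proof -
    have "X \<in> Obj U" using X by (simp add: U_sel)
    then have "Fob USn X \<in> Obj U" by (rule U.functor_Obj[OF U.autoequivalenceD(1)[OF USn_auto]])
    moreover have "Fob Sn X \<in> Obj U" using Z_SnI[OF X] by (simp add: U_sel)
    ultimately show ?thesis using U.subcategory_iso_iff[OF CU _ _ USn_isomorphic[OF X]] by blast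
  qed
  \<comment> \<open>The test in \<open>T\<close> ranges over more objects than the one in
    \<open>U\<close>. On the extra ones both memberships are false, since \<open>Z\<close> is stable
    under \<open>S_n\<close>.\<close>
  have "X \<in> C \<longleftrightarrow> Fob Sn X \<in> C" if "X \<in> Obj T" "X \<notin> Z" for X
    using that Z_Sn assms(3) by blast
  then show ?thesis
    unfolding U.stable_subcategory_iff[OF USn_auto] stable_subcategory_iff[OF Sn_auto] U_sel(1)
    using CU assms(1) e Z_Obj by blast
qed

end

theorem theorem4p9:
  fixes K :: "'k ring"
    and T :: "('k, 'o, 'm) tri_cat"
    and S :: "('o, 'm) endo"
    and n :: nat
    and D Z :: "'o set"
    and A :: "'o \<Rightarrow> ('o, 'm) sextuple"
    and U :: "('k, 'o, 'm set) tri_cat"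
    and S' :: "('o, 'm set) endo"
  assumes "triangulated_category K T" and "hom_finite K T" and "krull_schmidt T"
    and "serre_functor K T S"
    and "n \<ge> 2"
    and "functorially_finite T D" and "n_rigid T n D"
    and "stable_subcategory T (serre_n T S n) D"
    and "Z = n_right_perp T n D"
    and "approximation_triangles T D Z A"
    and "U = reduction T D Z A"
    and "S' = reduction_serre T S n D Z A"
  shows "Z = n_left_perp T n D \<and> D \<subseteq> Z \<and>
    bij_betw (\<lambda>C. Obj (quotient_category T C D))
      {C. n_cluster_tilting T n C \<and> D \<subseteq> C}
      {C'. n_cluster_tilting U n C'} \<and>
    bij_betw (\<lambda>C. Obj (quotient_category T C D))
      {C. n_rigid T n C \<and> stable_subcategory T (serre_n T S n) C \<and> D \<subseteq> C}
      {C'. n_rigid U n C' \<and> stable_subcategory U (serre_n U S' n) C'}"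
proof -
  interpret R: reduction_setting K T S n D Z A
    using assms by (simp add: reduction_setting_def triangulated_def reduction_setting_axioms_def)
  have id: "(\<lambda>C. Obj (quotient_category T C D)) = id"
    by (rule ext) (simp add: quotient_category_def)
  have ct: "{C. n_cluster_tilting T n C \<and> D \<subseteq> C} = {C'. n_cluster_tilting U n C'}"
    unfolding assms(11) using R.U_n_cluster_tilting_iff by blast
  have st: "n_rigid T n C \<and> stable_subcategory T (serre_n T S n) C \<and> D \<subseteq> C \<longleftrightarrow>
      n_rigid U n C \<and> stable_subcategory U (serre_n U S' n) C" for C
  \<comment> \<open>Rigidity in \<open>U\<close> places \<open>C\<close> between \<open>D\<close>
    and \<open>Z\<close>, where the two stability conditions can be compared; when it fails, both
    sides are false.\<close>
  proof (cases "n_rigid U n C")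
    case True
    then have "subcategory U C" unfolding n_rigid_def by blast
    then have "subcategory T C" "D \<subseteq> C" "C \<subseteq> Z" unfolding assms(11) R.subcategory_U_iff by blast+
    then show ?thesis
      using R.U_stable_subcategory_iff[of C] R.U_n_rigid_iff[of C] unfolding assms(11,12) by blast
  next
    case False
    then show ?thesis using R.U_n_rigid_iff[of C] unfolding assms(11) by blast
  qed
  show ?thesis
    unfolding id ct st bij_betw_id_iff using R.Z_eq_left_perp R.D_subset_Z by blast
qed

end
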